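(* For each $\epsilon>0$ and $M\ge1$ there exists $C=C(\lambda,\epsilon,M)>1$ such that the following holds. Let $\mu\in\mathcal{M}(\mathbb{R}^{d})$ be $(\epsilon,m)$-non-saturated for all $m\ge M$, and let $\nu\in\mathcal{M}(\mathbb{R}^{d})$, $0<\beta<1/2$, and $t_{2}>t_{1}>0$ be such that $\frac{1}{t_{2}-t_{1}}H(\nu;\lambda^{t_{2}}\mid\lambda^{t_{1}})>\beta$. Then \[ H(\nu*\mu;\lambda^{t_{2}}\mid\lambda^{t_{1}})\ge H(\mu;\lambda^{t_{2}}\mid\lambda^{t_{1}})+C^{-1}\beta(\log\beta^{-1})^{-1}(t_{2}-t_{1})-C. \]
   Context: Fix $d\ge1$ and $\lambda=(\lambda_1,\dots,\lambda_d)\in(0,1)^d$ with $\lambda_1>\dots>\lambda_d$; logs are base 2 and $\chi_j:=-\log\lambda_j$; $\lambda^t:=(\lambda_1^t,\dots,\lambda_d^t)$. $\mathcal{M}(\mathbb{R}^d)$ is the set of compactly supported Borel probability measures on $\mathbb{R}^d$. Average entropy: for a bounded random vector $X$ with law $\mu$ and $r\in\mathbb{R}^d_{>0}$, $H(\mu;r):=\int_{[0,1)^d}H(\lfloor X/r+x\rfloor)\,dx$, with division and floor taken coordinatewise and $H(\cdot)$ Shannon entropy; $H(\mu;r\mid r'):=H(\mu;r)-H(\mu;r')$. For $n\in\mathbb{Z}$, $\mathcal{E}_n$ is the partition of $\mathbb{R}^d$ into boxes $D_1\times\dots\times D_d$ with $D_j\in\{[k2^{-\lfloor\chi_j n\rfloor},(k+1)2^{-\lfloor\chi_jn\rfloor}):k\in\mathbb{Z}\}$.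 For $J\subset[d]$, $\pi_J$ is the orthogonal projection onto $\mathrm{span}\{e_j:j\in J\}$ and $\pi_J^{-1}\mathcal{E}_n:=\{\pi_J^{-1}(E):E\in\mathcal{E}_n\}$. For partitions, $H(\mu,\mathcal{C}\mid\mathcal{D}):=\sum_{D\in\mathcal{D}}\mu(D)H(\mu_D,\mathcal{C})$ with $\mu_D=\mu|_D/\mu(D)$, and $\vee$ denotes common refinement. $\mu$ is $(\epsilon,m)$-non-saturated if for all $1\le j\le d$ and $n\ge0$, $\frac1m H(\mu,\mathcal{E}_{n+m}\mid\mathcal{E}_n\vee\pi^{-1}_{[d]\setminus\{j\}}\mathcal{E}_{n+m})<\chi_j-\epsilon$. *)

theory Defs
  imports "HOL-Probability.Probability"
begin

text \<open>Points of R^d are vectors of type real^'d; the coordinate index type 'd is finite and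
linearly ordered (playing the role of [d] = {1,...,d}).\<close>

definition cpt_prob :: "('a::euclidean_space) measure \<Rightarrow> bool" where
  "cpt_prob mu \<longleftrightarrow> prob_space mu \<and> sets mu = sets borel \<and>
     (\<exists>K. compact K \<and> measure mu K = 1)"

definition shannon_h :: "real \<Rightarrow> real" where
  "shannon_h p = (if p = 0 then 0 else p * log 2 p)"

definition ent :: "'a measure \<Rightarrow> ('a \<Rightarrow> 'b) \<Rightarrow> real" where
  "ent mu f = - (\<Sum>\<^sub>\<infinity> v\<in>UNIV. shannon_h (measure mu (f -` {v} \<inter> space mu)))"

text \<open>Conditional entropy H(mu, C | D) = sum over D of mu(D) H(mu_D, C), partitions given
by their cell-index functions f (for C) and g (for D).\<close>
definition cond_ent :: "'a measure \<Rightarrow> ('a \<Rightarrow> 'b) \<Rightarrow> ('a \<Rightarrow> 'c) \<Rightarrow> real" where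
  "cond_ent mu f g = (\<Sum>\<^sub>\<infinity> w\<in>UNIV. measure mu (g -` {w} \<inter> space mu) *
     (- (\<Sum>\<^sub>\<infinity> v\<in>UNIV. shannon_h (measure mu (f -` {v} \<inter> g -` {w} \<inter> space mu)
                                  / measure mu (g -` {w} \<inter> space mu)))))"

definition avg_ent :: "(real^'d) measure \<Rightarrow> real^'d \<Rightarrow> real" where
  "avg_ent mu r = integral {x::real^'d. \<forall>j. 0 \<le> x$j \<and> x$j < 1}
     (\<lambda>x. ent mu (\<lambda>X. (\<chi> j. \<lfloor>X$j / r$j + x$j\<rfloor>) :: int^'d))"

definition avg_ent_cond :: "(real^'d) measure \<Rightarrow> real^'d \<Rightarrow> real^'d \<Rightarrow> real" where
  "avg_ent_cond mu r r' = avg_ent mu r - avg_ent mu r'"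

definition lam_pow :: "real^'d \<Rightarrow> real \<Rightarrow> real^'d" where
  "lam_pow lam t = (\<chi> j. lam$j powr t)"

definition chi :: "real^'d \<Rightarrow> 'd \<Rightarrow> real" where
  "chi lam j = - log 2 (lam$j)"

definition E_idx :: "real^'d \<Rightarrow> int \<Rightarrow> real^'d \<Rightarrow> int^'d" where
  "E_idx lam n x = (\<chi> j. \<lfloor>x$j * 2 powr (real_of_int \<lfloor>chi lam j * real_of_int n\<rfloor>)\<rfloor>)"

text \<open>Cell index of x in pi_J^{-1} E_n: only coordinates in J matter.\<close>
definition E_proj_idx :: "real^'d \<Rightarrow> 'd set \<Rightarrow> int \<Rightarrow> real^'d \<Rightarrow> int^'d" where
  "E_proj_idx lam J n x = (\<chi> j. if j \<in> J then E_idx lam n x $ j else 0)"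

definition non_saturated :: "real^'d \<Rightarrow> real \<Rightarrow> nat \<Rightarrow> (real^'d) measure \<Rightarrow> bool" where
  "non_saturated lam eps m mu \<longleftrightarrow>
     (\<forall>j. \<forall>n::nat.
        1 / real m * cond_ent mu (E_idx lam (int n + int m))
           (\<lambda>x. (E_idx lam (int n) x, E_proj_idx lam (UNIV - {j}) (int n + int m) x))
        < chi lam j - eps)"

end

theory Submission
  imports Defs
begin

text \<open>The convolution by nu is compared, scale by scale, with convolution by two-point measures.
Rounding everything to the finest scale \<open>N = \<lfloor>t2\<rfloor>\<close> turns nu and mu into finitely supported laws
X and Y on \<open>\<int>^d\<close>, at the price of bounded errors, and \<open>Y \<oplus> U (kap N l)\<close>, the convolution of Y with
the uniform law on a box of scale l, plays the role of mu at scale l.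

By submodularity, \<open>G l = H (X \<oplus> Y \<oplus> U (kap N l)) - H (Y \<oplus> U (kap N l))\<close> is nondecreasing in l, and its
increments are concave in X. If X is split into fair choices between two points at distance v of
scale l, the increment of G near l is therefore at least the probability of the split times the
increment for the two points.
For two points the lower value of G is small, since the large box hardly changes under translation
by v. The higher one is bounded below because \<open>2^L\<close> multiples of v fill a box that is long in one
coordinate direction only, non-saturation makes Y gain entropy under such a box, and
each doubling of v costs at most a factor 4.

The pairs of points come from independent resampling of X inside its cell of level n. The entropy of
X between levels n and n + 1 is controlled by the probability that the resampled point
lies in a different subcell, up to the factor \<open>log (1 / \<beta>)\<close>, and for a given point and a given scale l
of the distance only boundedly many n occur.\<close>

section \<open>Entropy of finitely supported laws\<close>

text \<open>The gain has to be added up over about \<open>t2 - t1\<close> scales, and a bounded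
  error at every scale would swallow it. This is why increments of the single function
  \<open>G\<close> are used: they are nonnegative and telescope, so the errors of rounding enter
  only at the two end levels. Within one scale bounded errors are harmless: they are beaten by
  \<open>eps * m\<close> once the block length \<open>m\<close> is large, and this fixes the choice
  of \<open>m\<close>.

  The factor \<open>log (1 / \<beta>)\<close> has its origin in the passage from entropy to
  splitting probabilities. If a subcell has conditional probability \<open>r\<close>, its
  contribution \<open>- log r\<close> is not bounded by a multiple of \<open>1 - r\<close> as
  \<open>r\<close> tends to 0. It is cut off at a threshold \<open>t\<close> proportional to
  \<open>\<beta>\<close>: what lies beyond the threshold costs O(t) per level, because a cell has
  boundedly many subcells, and is absorbed by half of the entropy that nu is assumed to have; what
  remains costs a factor \<open>log (1 / t)\<close>.

  The splitting into pairs must reproduce X exactly. A coupling of X with itself does so, and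
  bounded overlap of the levels n is what keeps the weights of the pairs within the mass of
  X.\<close>

definition H :: "'a pmf \<Rightarrow> real" where
  "H p = - (\<Sum>x\<in>set_pmf p. pmf p x * log 2 (pmf p x))"

lemma pmf_map_sum:
  assumes "finite (set_pmf P)"
  shows "pmf (map_pmf f P) y = (\<Sum>w\<in>{w\<in>set_pmf P. f w = y}. pmf P w)"
proof -
  have "pmf (map_pmf f P) y = measure (measure_pmf P) (f -` {y} \<inter> set_pmf P)"
    by (simp add: pmf_map measure_Int_set_pmf)
  also have "\<dots> = (\<Sum>w\<in>f -` {y} \<inter> set_pmf P. pmf P w)"
    using assms by (intro measure_measure_pmf_finite) auto
  also have "f -` {y} \<inter> set_pmf P = {w\<in>set_pmf P. f w = y}" by auto
  finally show ?thesis .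
qed

lemma sum_map_pmf:
  assumes "finite (set_pmf P)"
  shows "(\<Sum>y\<in>f ` set_pmf P. pmf (map_pmf f P) y * G y) = (\<Sum>w\<in>set_pmf P. pmf P w * G (f w))"
proof -
  have "(\<Sum>w\<in>set_pmf P. pmf P w * G (f w)) =
      (\<Sum>y\<in>f ` set_pmf P. \<Sum>w\<in>{w\<in>set_pmf P. f w = y}. pmf P w * G (f w))"
    using assms by (rule sum.image_gen)
  also have "\<dots> = (\<Sum>y\<in>f ` set_pmf P. pmf (map_pmf f P) y * G y)"
    by (intro sum.cong refl) (simp add: pmf_map_sum[OF assms] sum_distrib_right)
  finally show ?thesis ..
qed

lemma H_map:
  assumes "finite (set_pmf P)"
  shows "H (map_pmf f P) = - (\<Sum>w\<in>set_pmf P. pmf P w * log 2 (pmf (map_pmf f P) (f w)))"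
  unfolding H_def using sum_map_pmf[OF assms, of f "\<lambda>y. log 2 (pmf (map_pmf f P) y)"] by simp

lemma pmf_map_pos: "w \<in> set_pmf P \<Longrightarrow> pmf (map_pmf f P) (f w) > 0"
  by (simp add: pmf_positive_iff)

lemma pmf_map_neq_0: "w \<in> set_pmf P \<Longrightarrow> pmf (map_pmf f P) (f w) \<noteq> 0"
  using pmf_map_pos[of w P f] by simp

text \<open>Jensen's inequality in the form \<open>ln r \<le> r - 1\<close>. The cardinality bound
  for conditional entropy and submodularity both arise from it, with \<open>r\<close> the ratio of a
  comparison weight of mass at most 1 to the true weight.\<close>

lemma sum_pmf_log_le_0:
  assumes "finite (set_pmf P)" "\<And>w. w \<in> set_pmf P \<Longrightarrow> r w > 0"
    and "(\<Sum>w\<in>set_pmf P. pmf P w * r w) \<le> 1"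
  shows "(\<Sum>w\<in>set_pmf P. pmf P w * log 2 (r w)) \<le> 0"
proof -
  have "(\<Sum>w\<in>set_pmf P. pmf P w * ln (r w)) \<le> (\<Sum>w\<in>set_pmf P. pmf P w * (r w - 1))"
    by (intro sum_mono mult_left_mono ln_le_minus_one assms) auto
  also have "\<dots> = (\<Sum>w\<in>set_pmf P. pmf P w * r w) - (\<Sum>w\<in>set_pmf P. pmf P w)"
    by (simp add: algebra_simps sum_subtractf)
  also have "(\<Sum>w\<in>set_pmf P. pmf P w) = 1"
    using assms(1) by (rule sum_pmf_eq_1) simp
  finally have "(\<Sum>w\<in>set_pmf P. pmf P w * ln (r w)) \<le> 0" using assms(3) by simp
  then have "(\<Sum>w\<in>set_pmf P. pmf P w * ln (r w)) / ln 2 \<le> 0"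
    by (simp add: divide_nonpos_pos)
  then show ?thesis by (simp add: log_def sum_divide_distrib)
qed

lemma H_map_inj:
  assumes "inj_on f (set_pmf P)" "finite (set_pmf P)"
  shows "H (map_pmf f P) = H P"
proof -
  have "pmf (map_pmf f P) (f w) = pmf P w" if "w \<in> set_pmf P" for w
    using that assms by (simp add: pmf_map_inj)
  then show ?thesis unfolding H_map[OF assms(2)] by (simp add: H_def)
qed

lemma pmf_map_comp_ge:
  assumes "finite (set_pmf P)"
  shows "pmf (map_pmf f P) (f w) \<le> pmf (map_pmf (\<lambda>w. g (f w)) P) (g (f w))"
  unfolding pmf_map by (intro measure_pmf.finite_measure_mono) auto

lemma H_map_le:
  assumes "finite (set_pmf P)"
  shows "H (map_pmf f P) \<le> H P"
proof -
  have "pmf P w * log 2 (pmf P w) \<le> pmf P w * log 2 (pmf (map_pmf f P) (f w))"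
    if "w \<in> set_pmf P" for w
    using pmf_map_comp_ge[OF assms, of "\<lambda>x. x" w f] pmf_positive[OF that] that
    by (intro mult_left_mono log_mono) auto
  then show ?thesis unfolding H_map[OF assms] by (simp add: H_def sum_mono)
qed

lemma H_map_comp_le:
  assumes "finite (set_pmf P)"
  shows "H (map_pmf (\<lambda>w. g (f w)) P) \<le> H (map_pmf f P)"
  using H_map_le[of "map_pmf f P" g] assms by (simp add: map_pmf_comp)

text \<open>Entropy sees only the partition into fibres. Changes of variables are done in this form
  because no bijection between the values has to be named.\<close>

lemma H_map_equiv:
  assumes "finite (set_pmf P)" "\<And>x y. f x = f y \<longleftrightarrow> g x = g y"
  shows "H (map_pmf f P) = H (map_pmf g P)"
proof -
  have "f -` {f w} = g -` {g w}" for w using assms(2) by auto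
  then show ?thesis unfolding H_map[OF assms(1)] pmf_map by simp
qed

text \<open>The mean of the reciprocal conditional probability of \<open>f\<close> given
  \<open>g\<close> counts the values of \<open>f\<close> on each fibre of \<open>g\<close> and
  averages over the fibres. It serves for conditional entropy and again for the mean of
  \<open>1 / r\<close> over subcells.\<close>

lemma sum_pmf_ratio_le:
  assumes fin: "finite (set_pmf P)"
    and card: "\<And>w. w \<in> set_pmf P \<Longrightarrow> card (f ` {w' \<in> set_pmf P. g w' = g w}) \<le> K"
  shows "(\<Sum>w\<in>set_pmf P. pmf P w * (pmf (map_pmf g P) (g w) / pmf (map_pmf (\<lambda>w. (f w, g w)) P) (f w, g w))) \<le> K"
proof -
  let ?S = "set_pmf P" and ?fg = "\<lambda>w. (f w, g w)"
  let ?r = "\<lambda>w. pmf (map_pmf g P) (g w) / pmf (map_pmf ?fg P) (?fg w)"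
  have "(\<Sum>w\<in>?S. pmf P w * ?r w) = (\<Sum>y\<in>?fg ` ?S. pmf (map_pmf ?fg P) y *
      (pmf (map_pmf g P) (snd y) / pmf (map_pmf ?fg P) y))"
    using sum_map_pmf[OF fin, of ?fg "\<lambda>y. pmf (map_pmf g P) (snd y) / pmf (map_pmf ?fg P) y"]
    by simp
  also have "\<dots> = (\<Sum>y\<in>?fg ` ?S. pmf (map_pmf g P) (snd y))"
    using pmf_map_neq_0[of _ P ?fg] by (intro sum.cong) auto
  also have "\<dots> = (\<Sum>c\<in>g ` ?S. \<Sum>y\<in>{y\<in>?fg ` ?S. snd y = c}. pmf (map_pmf g P) (snd y))"
    using fin sum.image_gen[of "?fg ` ?S" "\<lambda>y. pmf (map_pmf g P) (snd y)" snd]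
    by (simp add: image_image)
  also have "\<dots> \<le> (\<Sum>c\<in>g ` ?S. K * pmf (map_pmf g P) c)"
  proof (rule sum_mono)
    fix c assume "c \<in> g ` ?S"
    then obtain w where w: "w \<in> ?S" "c = g w" by auto
    have "{y\<in>?fg ` ?S. snd y = c} = (\<lambda>a. (a, c)) ` f ` {w' \<in> ?S. g w' = g w}"
      using w by auto
    then have "card {y\<in>?fg ` ?S. snd y = c} \<le> K"
      using card[OF w(1)] card_image[of "\<lambda>a. (a, c)" "f ` {w' \<in> ?S. g w' = g w}"]
      by (simp add: inj_on_def)
    then have "card {y\<in>?fg ` ?S. snd y = c} * pmf (map_pmf g P) c \<le> K * pmf (map_pmf g P) c"
      by (intro mult_right_mono) auto
    then show "(\<Sum>y\<in>{y\<in>?fg ` ?S. snd y = c}. pmf (map_pmf g P) (snd y)) \<le> K * pmf (map_pmf g P) c"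
      by simp
  qed
  also have "\<dots> = K" using fin sum_pmf_eq_1[of "g ` ?S" "map_pmf g P"] by (simp add: sum_distrib_left[symmetric])
  finally show ?thesis .
qed

text \<open>Jensen's inequality for the reciprocal conditional probability divided by
  \<open>K\<close>, whose mean is at most 1. The bounded errors of rounding below come from
  here.\<close>

lemma H_cond_card:
  assumes fin: "finite (set_pmf P)" and "K > 0"
    and card: "\<And>w. w \<in> set_pmf P \<Longrightarrow> card (f ` {w' \<in> set_pmf P. g w' = g w}) \<le> K"
  shows "H (map_pmf f P) \<le> H (map_pmf g P) + log 2 K"
proof -
  let ?S = "set_pmf P" and ?fg = "\<lambda>w. (f w, g w)"
  let ?r = "\<lambda>w. pmf (map_pmf g P) (g w) / (K * pmf (map_pmf ?fg P) (?fg w))"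
  have pos: "?r w > 0" if "w \<in> ?S" for w
    using pmf_map_pos[OF that, of g] pmf_map_pos[OF that, of ?fg] \<open>K > 0\<close> by simp
  have "(\<Sum>w\<in>?S. pmf P w * ?r w)
      = (\<Sum>w\<in>?S. pmf P w * (pmf (map_pmf g P) (g w) / pmf (map_pmf ?fg P) (?fg w))) / K"
    by (simp add: sum_divide_distrib mult.commute)
  also have "\<dots> \<le> 1"
    using sum_pmf_ratio_le[of P f g K, OF fin card] \<open>K > 0\<close> by (simp add: divide_le_eq_1)
  finally have "(\<Sum>w\<in>?S. pmf P w * log 2 (?r w)) \<le> 0"
    by (intro sum_pmf_log_le_0 fin pos)
  also have "(\<Sum>w\<in>?S. pmf P w * log 2 (?r w)) = (\<Sum>w\<in>?S. pmf P w * log 2 (pmf (map_pmf g P) (g w))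
      - pmf P w * log 2 (pmf (map_pmf ?fg P) (?fg w)) - pmf P w * log 2 K)"
  proof (rule sum.cong[OF refl])
    fix w assume w: "w \<in> ?S"
    show "pmf P w * log 2 (?r w) = pmf P w * log 2 (pmf (map_pmf g P) (g w))
      - pmf P w * log 2 (pmf (map_pmf ?fg P) (?fg w)) - pmf P w * log 2 K"
      using pmf_map_pos[OF w, of g] pmf_map_pos[OF w, of ?fg] \<open>K > 0\<close>
      by (simp add: log_divide log_mult algebra_simps)
  qed
  also have "\<dots> = H (map_pmf ?fg P) - H (map_pmf g P) - log 2 K"
    using sum_pmf_eq_1[OF fin, of P]
    unfolding H_map[OF fin] sum_subtractf sum_distrib_right[symmetric] by simp
  finally show ?thesis using H_map_comp_le[OF fin, of fst ?fg] by simp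
qed

lemma sum_marginal:
  assumes "finite (set_pmf P)"
  shows "(\<Sum>a\<in>f ` set_pmf P. pmf (map_pmf (\<lambda>w. (f w, h w)) P) (a, c)) = pmf (map_pmf h P) c"
proof -
  have "pmf (map_pmf h P) c = (\<Sum>a\<in>f ` {w\<in>set_pmf P. h w = c}. \<Sum>w\<in>{w\<in>{w\<in>set_pmf P. h w = c}. f w = a}. pmf P w)"
    unfolding pmf_map_sum[OF assms] using assms by (intro sum.image_gen) auto
  also have "\<dots> = (\<Sum>a\<in>f ` {w\<in>set_pmf P. h w = c}. pmf (map_pmf (\<lambda>w. (f w, h w)) P) (a, c))"
    unfolding pmf_map_sum[OF assms] by (intro sum.cong) auto
  also have "\<dots> = (\<Sum>a\<in>f ` set_pmf P. pmf (map_pmf (\<lambda>w. (f w, h w)) P) (a, c))"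
    using assms by (intro sum.mono_neutral_left) (auto simp: pmf_eq_0_set_pmf)
  finally show ?thesis ..
qed

text \<open>\<open>F\<close> is the law with the same pairs \<open>(f, h)\<close> and
  \<open>(g, h)\<close> under which \<open>f\<close> and \<open>g\<close> are conditionally
  independent given \<open>h\<close>. It has mass 1, and the right side minus the left side is the
  relative entropy of the true law with respect to it.\<close>

lemma H_submodular:
  assumes fin: "finite (set_pmf P)"
  shows "H (map_pmf (\<lambda>w. (f w, g w, h w)) P) + H (map_pmf h P)
    \<le> H (map_pmf (\<lambda>w. (f w, h w)) P) + H (map_pmf (\<lambda>w. (g w, h w)) P)"
proof -
  let ?S = "set_pmf P" and ?fgh = "\<lambda>w. (f w, g w, h w)"
  let ?fh = "\<lambda>w. (f w, h w)" and ?gh = "\<lambda>w. (g w, h w)"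
  define F where "F = (\<lambda>(a, b, c). pmf (map_pmf ?fh P) (a, c) * pmf (map_pmf ?gh P) (b, c) / pmf (map_pmf h P) c)"
  let ?r = "\<lambda>w. F (?fgh w) / pmf (map_pmf ?fgh P) (?fgh w)"
  note p = pmf_map_pos[of _ P h] pmf_map_pos[of _ P ?fh] pmf_map_pos[of _ P ?gh] pmf_map_pos[of _ P ?fgh]
  have "(\<Sum>w\<in>?S. pmf P w * ?r w) = (\<Sum>y\<in>?fgh ` ?S. pmf (map_pmf ?fgh P) y * (F y / pmf (map_pmf ?fgh P) y))"
    using sum_map_pmf[OF fin, of ?fgh "\<lambda>y. F y / pmf (map_pmf ?fgh P) y"] by simp
  also have "\<dots> = (\<Sum>y\<in>?fgh ` ?S. F y)" using pmf_map_neq_0[of _ P ?fgh] by (intro sum.cong) auto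
  also have "\<dots> \<le> (\<Sum>y\<in>f ` ?S \<times> g ` ?S \<times> h ` ?S. F y)"
    using fin by (intro sum_mono2) (auto simp: F_def)
  also have "\<dots> = (\<Sum>a\<in>f ` ?S. \<Sum>b\<in>g ` ?S. \<Sum>c\<in>h ` ?S. F (a, b, c))"
    by (simp add: sum.cartesian_product)
  also have "\<dots> = (\<Sum>a\<in>f ` ?S. \<Sum>c\<in>h ` ?S. \<Sum>b\<in>g ` ?S. F (a, b, c))"
    by (rule sum.cong[OF refl]) (rule sum.swap)
  also have "\<dots> = (\<Sum>c\<in>h ` ?S. \<Sum>a\<in>f ` ?S. \<Sum>b\<in>g ` ?S. F (a, b, c))"
    by (rule sum.swap)
  also have "\<dots> = (\<Sum>c\<in>h ` ?S. (\<Sum>a\<in>f ` ?S. pmf (map_pmf ?fh P) (a, c)) * (\<Sum>b\<in>g ` ?S. pmf (map_pmf ?gh P) (b, c))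
      / pmf (map_pmf h P) c)"
    by (simp add: F_def sum_product sum_divide_distrib)
  also have "\<dots> = (\<Sum>c\<in>h ` ?S. pmf (map_pmf h P) c)"
    using p(1) by (intro sum.cong) (auto simp: sum_marginal[OF fin])
  also have "\<dots> = 1" using fin sum_pmf_eq_1[of "h ` ?S" "map_pmf h P"] by simp
  finally have "(\<Sum>w\<in>?S. pmf P w * log 2 (?r w)) \<le> 0"
    using p by (intro sum_pmf_log_le_0 fin) (auto simp: F_def)
  also have "(\<Sum>w\<in>?S. pmf P w * log 2 (?r w)) = (\<Sum>w\<in>?S. pmf P w * log 2 (pmf (map_pmf ?fh P) (?fh w))
     + pmf P w * log 2 (pmf (map_pmf ?gh P) (?gh w)) - pmf P w * log 2 (pmf (map_pmf h P) (h w))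
      - pmf P w * log 2 (pmf (map_pmf ?fgh P) (?fgh w)))"
  proof (rule sum.cong[OF refl])
    fix w assume w: "w \<in> ?S"
    show "pmf P w * log 2 (?r w) = pmf P w * log 2 (pmf (map_pmf ?fh P) (?fh w))
     + pmf P w * log 2 (pmf (map_pmf ?gh P) (?gh w)) - pmf P w * log 2 (pmf (map_pmf h P) (h w))
      - pmf P w * log 2 (pmf (map_pmf ?fgh P) (?fgh w))"
      using p[OF w] by (simp add: F_def log_divide log_mult algebra_simps)
  qed
  also have "\<dots> = H (map_pmf ?fgh P) + H (map_pmf h P) - H (map_pmf ?fh P) - H (map_pmf ?gh P)"
    unfolding H_map[OF fin] sum_subtractf sum.distrib by simp
  finally show ?thesis by simp
qed

lemma H_subadditive:
  assumes fin: "finite (set_pmf P)"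
  shows "H (map_pmf (\<lambda>w. (f w, g w)) P) \<le> H (map_pmf f P) + H (map_pmf g P)"
proof -
  have [simp]: "H (return_pmf ()) = 0"
    by (simp add: H_def)
  have "H (map_pmf (\<lambda>w. (f w, g w, ())) P) = H (map_pmf (\<lambda>w. (f w, g w)) P)"
    "H (map_pmf (\<lambda>w. (f w, ())) P) = H (map_pmf f P)" "H (map_pmf (\<lambda>w. (g w, ())) P) = H (map_pmf g P)"
    by (rule H_map_equiv[OF fin]; auto)+
  then show ?thesis using H_submodular[OF fin, of f g "\<lambda>_. ()"] by simp
qed

lemma H_bind_Pair:
  assumes fin: "finite (set_pmf W)" "\<And>i. i \<in> set_pmf W \<Longrightarrow> finite (set_pmf (k i))"
  shows "H (bind_pmf W (\<lambda>i. map_pmf (Pair i) (k i))) = H W + (\<Sum>i\<in>set_pmf W. pmf W i * H (k i))"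
proof -
  let ?B = "bind_pmf W (\<lambda>i. map_pmf (Pair i) (k i))"
  have set: "set_pmf ?B = Sigma (set_pmf W) (\<lambda>i. set_pmf (k i))" by auto
  have pmf: "pmf ?B (i, x) = pmf W i * pmf (k i) x" if "i \<in> set_pmf W" for i x
  proof -
    have "pmf ?B (i, x) = (\<Sum>j\<in>set_pmf W. pmf (map_pmf (Pair j) (k j)) (i, x) * pmf W j)"
      unfolding pmf_bind using fin by (subst integral_measure_pmf[of "set_pmf W"]) (auto simp: mult.commute)
    also have "\<dots> = (\<Sum>j\<in>set_pmf W. if j = i then pmf W i * pmf (k i) x else 0)"
    proof (intro sum.cong refl)
      fix j
      have "pmf (map_pmf (Pair i) (k i)) (i, x) = pmf (k i) x"
        by (rule pmf_map_inj') (simp add: inj_on_def)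
      moreover have "pmf (map_pmf (Pair j) (k j)) (i, x) = 0" if "j \<noteq> i"
        using that by (auto simp: pmf_eq_0_set_pmf)
      ultimately show "pmf (map_pmf (Pair j) (k j)) (i, x) * pmf W j = (if j = i then pmf W i * pmf (k i) x else 0)"
        by auto
    qed
    also have "\<dots> = pmf W i * pmf (k i) x" using fin that by simp
    finally show ?thesis .
  qed
  have "H ?B = - (\<Sum>i\<in>set_pmf W. \<Sum>x\<in>set_pmf (k i). pmf ?B (i, x) * log 2 (pmf ?B (i, x)))"
    unfolding H_def set using fin by (subst sum.Sigma) (auto intro!: sum.cong)
  also have "(\<Sum>i\<in>set_pmf W. \<Sum>x\<in>set_pmf (k i). pmf ?B (i, x) * log 2 (pmf ?B (i, x))) =
    (\<Sum>i\<in>set_pmf W. pmf W i * log 2 (pmf W i) - pmf W i * H (k i))"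
  proof (rule sum.cong[OF refl])
    fix i assume i: "i \<in> set_pmf W"
    have "(\<Sum>x\<in>set_pmf (k i). pmf ?B (i, x) * log 2 (pmf ?B (i, x))) =
      (\<Sum>x\<in>set_pmf (k i). pmf W i * log 2 (pmf W i) * pmf (k i) x + pmf W i * (pmf (k i) x * log 2 (pmf (k i) x)))"
      using i by (intro sum.cong refl) (auto simp: pmf log_mult pmf_positive algebra_simps set_pmf_iff)
    also have "\<dots> = pmf W i * log 2 (pmf W i) - pmf W i * H (k i)"
      using sum_pmf_eq_1[OF fin(2)[OF i], of "k i"]
      by (simp add: sum.distrib sum_distrib_left[symmetric] H_def)
    finally show "(\<Sum>x\<in>set_pmf (k i). pmf ?B (i, x) * log 2 (pmf ?B (i, x))) = \<dots>" .
  qed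
  finally show ?thesis by (simp add: sum_subtractf) (simp add: H_def)
qed

lemma H_pair_pmf:
  assumes "finite (set_pmf p)" "finite (set_pmf q)"
  shows "H (pair_pmf p q) = H p + H q"
proof -
  have "pair_pmf p q = bind_pmf p (\<lambda>i. map_pmf (Pair i) q)"
    by (simp add: pair_pmf_def map_pmf_def)
  then show ?thesis
    using H_bind_Pair[of p "\<lambda>_. q"] assms sum_pmf_eq_1[of "set_pmf p" p]
    by (simp add: sum_distrib_right[symmetric])
qed

text \<open>Concavity of entropy. Keeping the index of the mixture gives \<open>H W\<close> plus the
  mean entropy, and forgetting it loses at most \<open>H W\<close>.\<close>

lemma H_bind_ge:
  assumes fin: "finite (set_pmf W)" "\<And>i. i \<in> set_pmf W \<Longrightarrow> finite (set_pmf (k i))"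
  shows "(\<Sum>i\<in>set_pmf W. pmf W i * H (k i)) \<le> H (bind_pmf W k)"
proof -
  let ?B = "bind_pmf W (\<lambda>i. map_pmf (Pair i) (k i))"
  have "finite (set_pmf ?B)" using fin by auto
  then have "H (map_pmf (\<lambda>w. (fst w, snd w)) ?B) \<le> H (map_pmf fst ?B) + H (map_pmf snd ?B)"
    by (rule H_subadditive)
  moreover have "map_pmf fst ?B = W"
    by (simp add: map_bind_pmf map_pmf_comp map_pmf_const bind_return_pmf')
  moreover have "map_pmf snd ?B = bind_pmf W k"
    by (simp add: map_bind_pmf map_pmf_comp)
  ultimately show ?thesis using H_bind_Pair[OF fin] by simp
qed

lemma H_pmf_of_set:
  assumes "finite S" "S \<noteq> {}"
  shows "H (pmf_of_set S) = log 2 (card S)"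
  using assms by (simp add: H_def log_divide card_gt_0_iff)

section \<open>Convolution and two-point gains\<close>

definition conv :: "'a::ab_group_add pmf \<Rightarrow> 'a pmf \<Rightarrow> 'a pmf" (infixl "\<oplus>" 65) where
  "p \<oplus> q = bind_pmf p (\<lambda>x. bind_pmf q (\<lambda>y. return_pmf (x + y)))"

lemma set_conv: "set_pmf (p \<oplus> q) = (\<lambda>(x, y). x + y) ` (set_pmf p \<times> set_pmf q)"
  by (auto simp: conv_def)

lemma finite_conv: "finite (set_pmf p) \<Longrightarrow> finite (set_pmf q) \<Longrightarrow> finite (set_pmf (p \<oplus> q))"
  by (simp add: set_conv)

lemma conv_commute: "p \<oplus> q = q \<oplus> p"
  unfolding conv_def by (subst bind_commute_pmf) (simp add: add.commute)

lemma conv_assoc: "p \<oplus> q \<oplus> r = p \<oplus> (q \<oplus> r)"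
  by (simp add: conv_def bind_assoc_pmf bind_return_pmf add.assoc)

lemma conv_return: "return_pmf a \<oplus> q = map_pmf ((+) a) q"
  by (simp add: conv_def bind_return_pmf map_pmf_def)

lemma conv_return_0: "p \<oplus> return_pmf 0 = p"
proof -
  have "(+) (0::'a) = (\<lambda>x. x)" by auto
  then show ?thesis by (simp add: conv_commute[of p] conv_return)
qed

lemma conv_bind: "bind_pmf W k \<oplus> q = bind_pmf W (\<lambda>i. k i \<oplus> q)"
  by (simp add: conv_def bind_assoc_pmf)

lemma conv_pair: "p \<oplus> q = map_pmf (\<lambda>(x, y). x + y) (pair_pmf p q)"
  by (simp add: conv_def pair_pmf_def map_bind_pmf)

lemma H_conv_return: "finite (set_pmf q) \<Longrightarrow> H (return_pmf a \<oplus> q) = H q"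
  unfolding conv_return by (rule H_map_inj) auto

text \<open>The Kaimanovich-Vershik inequality. For independent x, y, z it is submodularity of x and
  x + y given x + y + z: the triple and the two pairs are equivalent to tuples of independent
  variables, and the entropies of \<open>p\<close> and \<open>r\<close> cancel.\<close>

lemma H_conv_submodular:
  assumes fin: "finite (set_pmf p)" "finite (set_pmf q)" "finite (set_pmf r)"
  shows "H (p \<oplus> q \<oplus> r) + H q \<le> H (p \<oplus> q) + H (q \<oplus> r)"
proof -
  let ?P = "pair_pmf p (pair_pmf q r)"
  let ?f = "\<lambda>(x, y, z). x" and ?g = "\<lambda>(x, y, z). x + y" and ?h = "\<lambda>(x, y, z). x + y + z"
  have finP: "finite (set_pmf ?P)" using fin by simp
  have "H (map_pmf (\<lambda>w. (?f w, ?g w, ?h w)) ?P) = H (map_pmf (\<lambda>w. w) ?P)"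
    by (rule H_map_equiv[OF finP]) auto
  also have "\<dots> = H p + H q + H r" using fin by (simp add: H_pair_pmf)
  finally have 1: "H (map_pmf (\<lambda>w. (?f w, ?g w, ?h w)) ?P) = H p + H q + H r" .
  have "H (map_pmf (\<lambda>w. (?f w, ?h w)) ?P) = H (map_pmf (\<lambda>(x, y, z). (x, y + z)) ?P)"
    by (rule H_map_equiv[OF finP]) auto
  also have "map_pmf (\<lambda>(x, y, z). (x, y + z)) ?P = pair_pmf p (q \<oplus> r)"
    by (simp add: pair_pmf_def conv_def map_bind_pmf bind_assoc_pmf bind_return_pmf)
  finally have 2: "H (map_pmf (\<lambda>w. (?f w, ?h w)) ?P) = H p + H (q \<oplus> r)"
    using fin by (simp add: H_pair_pmf finite_conv case_prod_unfold)
  have "H (map_pmf (\<lambda>w. (?g w, ?h w)) ?P) = H (map_pmf (\<lambda>(x, y, z). (x + y, z)) ?P)"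
    by (rule H_map_equiv[OF finP]) auto
  also have "map_pmf (\<lambda>(x, y, z). (x + y, z)) ?P = pair_pmf (p \<oplus> q) r"
    by (simp add: pair_pmf_def conv_def map_bind_pmf bind_assoc_pmf bind_return_pmf)
  finally have 3: "H (map_pmf (\<lambda>w. (?g w, ?h w)) ?P) = H (p \<oplus> q) + H r"
    using fin by (simp add: H_pair_pmf finite_conv)
  have 4: "map_pmf ?h ?P = p \<oplus> q \<oplus> r"
    by (simp add: pair_pmf_def conv_def map_bind_pmf bind_assoc_pmf bind_return_pmf)
  show ?thesis using H_submodular[OF finP, of ?f ?g ?h] 1 2 3 4 by simp
qed

lemma H_conv_gain_antimono:
  assumes "finite (set_pmf p)" "finite (set_pmf a)" "finite (set_pmf d)"
  shows "H (p \<oplus> (a \<oplus> d)) - H (a \<oplus> d) \<le> H (p \<oplus> a) - H a"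
  using H_conv_submodular[OF assms] by (simp add: conv_assoc)

text \<open>Data processing: the index i has no more mutual information with x + y + z than with x +
  y. Written out, this is concavity of
  \<open>H (p \<oplus> a) - H (p \<oplus> (a \<oplus> d))\<close> in \<open>p\<close>.\<close>

lemma H_conv_gain_concave:
  assumes fin: "finite (set_pmf W)" "\<And>i. i \<in> set_pmf W \<Longrightarrow> finite (set_pmf (k i))"
    "finite (set_pmf a)" "finite (set_pmf d)"
  shows "(\<Sum>i\<in>set_pmf W. pmf W i * (H (k i \<oplus> a) - H (k i \<oplus> (a \<oplus> d))))
    \<le> H (bind_pmf W k \<oplus> a) - H (bind_pmf W k \<oplus> (a \<oplus> d))"
proof -
  let ?P = "bind_pmf W (\<lambda>i. map_pmf (Pair i) (pair_pmf (k i) (pair_pmf a d)))"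
  let ?f = "\<lambda>(i, x, y, z). i" and ?g = "\<lambda>(i, x, y, z). x + y" and ?h = "\<lambda>(i, x, y, z). x + y + z"
  let ?S = "set_pmf W"
  have finP: "finite (set_pmf ?P)" using fin by auto
  have "H (map_pmf (\<lambda>w. (?f w, ?g w, ?h w)) ?P) = H (map_pmf (\<lambda>(i, x, y, z). (i, x + y, z)) ?P)"
    by (rule H_map_equiv[OF finP]) auto
  also have "map_pmf (\<lambda>(i, x, y, z). (i, x + y, z)) ?P
      = bind_pmf W (\<lambda>i. map_pmf (Pair i) (pair_pmf (k i \<oplus> a) d))"
    by (simp add: pair_pmf_def conv_def map_bind_pmf bind_assoc_pmf bind_return_pmf)
  also have "H \<dots> = H W + (\<Sum>i\<in>?S. pmf W i * H (pair_pmf (k i \<oplus> a) d))"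
    using fin by (intro H_bind_Pair) (auto simp: finite_conv)
  also have "(\<Sum>i\<in>?S. pmf W i * H (pair_pmf (k i \<oplus> a) d)) = (\<Sum>i\<in>?S. pmf W i * H (k i \<oplus> a) + pmf W i * H d)"
    using fin by (intro sum.cong) (auto simp: H_pair_pmf finite_conv algebra_simps)
  also have "\<dots> = (\<Sum>i\<in>?S. pmf W i * H (k i \<oplus> a)) + H d"
    using sum_pmf_eq_1[OF fin(1), of W] by (simp add: sum.distrib sum_distrib_right[symmetric])
  finally have 1: "H (map_pmf (\<lambda>w. (?f w, ?g w, ?h w)) ?P) = H W + ((\<Sum>i\<in>?S. pmf W i * H (k i \<oplus> a)) + H d)" .
  have "map_pmf (\<lambda>w. (?f w, ?h w)) ?P = bind_pmf W (\<lambda>i. map_pmf (Pair i) (k i \<oplus> (a \<oplus> d)))"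
    by (simp add: pair_pmf_def conv_def map_bind_pmf bind_assoc_pmf bind_return_pmf add.assoc)
  also have "H \<dots> = H W + (\<Sum>i\<in>?S. pmf W i * H (k i \<oplus> (a \<oplus> d)))"
    using fin by (intro H_bind_Pair) (auto simp: finite_conv)
  finally have 2: "H (map_pmf (\<lambda>w. (?f w, ?h w)) ?P) = H W + (\<Sum>i\<in>?S. pmf W i * H (k i \<oplus> (a \<oplus> d)))" .
  have "H (map_pmf (\<lambda>w. (?g w, ?h w)) ?P) = H (map_pmf (\<lambda>(i, x, y, z). (x + y, z)) ?P)"
    by (rule H_map_equiv[OF finP]) auto
  also have "map_pmf (\<lambda>(i, x, y, z). (x + y, z)) ?P = pair_pmf (bind_pmf W k \<oplus> a) d"
    by (simp add: pair_pmf_def conv_def map_bind_pmf bind_assoc_pmf bind_return_pmf)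
  also have "H \<dots> = H (bind_pmf W k \<oplus> a) + H d"
    using fin by (intro H_pair_pmf finite_conv) auto
  finally have 3: "H (map_pmf (\<lambda>w. (?g w, ?h w)) ?P) = H (bind_pmf W k \<oplus> a) + H d" .
  have 4: "map_pmf ?h ?P = bind_pmf W k \<oplus> (a \<oplus> d)"
    by (simp add: pair_pmf_def conv_def map_bind_pmf bind_assoc_pmf bind_return_pmf add.assoc)
  show ?thesis using H_submodular[OF finP, of ?f ?g ?h] 1 2 3 4
    by (simp add: right_diff_distrib sum_subtractf)
qed

section \<open>Fair two-point laws and the entropy they add\<close>

abbreviation coin :: "bool pmf" where "coin \<equiv> bernoulli_pmf (1/2)"

definition half :: "'a \<Rightarrow> 'a \<Rightarrow> 'a pmf" where
  "half x y = map_pmf (\<lambda>b. if b then y else x) coin"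

lemma finite_half: "finite (set_pmf (half x y))"
  by (simp add: half_def)

lemma pmf_bind_coin: "pmf (bind_pmf coin f) x = (pmf (f True) x + pmf (f False) x) / 2"
  by (simp add: pmf_bind add_divide_distrib)

lemma set_coin: "set_pmf coin = UNIV"
  by (auto simp: set_pmf_bernoulli UNIV_bool)

lemma H_coin: "H coin = 1"
  by (simp add: H_def set_coin UNIV_bool log_divide)

lemma half_conv: "half x y \<oplus> p = bind_pmf coin (\<lambda>b. return_pmf (if b then y else x) \<oplus> p)"
  by (simp add: half_def map_pmf_def conv_bind)

text \<open>A fair choice between two variables of equal law has that law again, however they are
  coupled. The coupling may therefore be adapted to the scale under study.\<close>

lemma bind_half_coupling:
  assumes "map_pmf fst W = p" "map_pmf snd W = p"
  shows "bind_pmf W (\<lambda>(x, y). half x y) = p"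
proof -
  have "bind_pmf W (\<lambda>(x, y). half x y)
      = bind_pmf W (\<lambda>z. bind_pmf coin (\<lambda>b. return_pmf (if b then snd z else fst z)))"
    by (simp add: half_def map_pmf_def case_prod_unfold)
  also have "\<dots> = bind_pmf coin (\<lambda>b. bind_pmf W (\<lambda>z. return_pmf (if b then snd z else fst z)))"
    by (rule bind_commute_pmf)
  also have "\<dots> = bind_pmf coin (\<lambda>b. p)"
  proof (rule bind_pmf_cong[OF refl])
    fix b show "bind_pmf W (\<lambda>z. return_pmf (if b then snd z else fst z)) = p"
      using assms by (cases b) (simp_all add: map_pmf_def)
  qed
  finally show ?thesis by simp
qed

definition gain :: "'a::ab_group_add pmf \<Rightarrow> 'a \<Rightarrow> real" where
  "gain a v = H (half 0 v \<oplus> a) - H a"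

lemma H_conv_half:
  assumes "finite (set_pmf a)"
  shows "H (half x y \<oplus> a) = H a + gain a (y - x)"
proof -
  have "half x y \<oplus> a = return_pmf x \<oplus> (half 0 (y - x) \<oplus> a)"
    unfolding half_conv conv_return map_bind_pmf
    by (intro bind_pmf_cong refl) (simp add: map_pmf_comp add.assoc[symmetric])
  then show ?thesis using assms by (simp add: gain_def H_conv_return finite_conv finite_half)
qed

lemma H_conv_ge:
  assumes "finite (set_pmf p)" "finite (set_pmf q)"
  shows "H q \<le> H (p \<oplus> q)"
proof -
  have "p \<oplus> q = bind_pmf p (\<lambda>x. return_pmf x \<oplus> q)"
    by (simp add: conv_bind[symmetric] bind_return_pmf')
  moreover have "(\<Sum>x\<in>set_pmf p. pmf p x * H (return_pmf x \<oplus> q)) = H q"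
    using sum_pmf_eq_1[OF assms(1), of p] assms by (simp add: H_conv_return sum_distrib_right[symmetric])
  ultimately show ?thesis
    using H_bind_ge[of p "\<lambda>x. return_pmf x \<oplus> q"] assms by (simp add: finite_conv)
qed

lemma gain_nonneg: "finite (set_pmf a) \<Longrightarrow> 0 \<le> gain a v"
  using H_conv_ge[of "half 0 v" a] by (simp add: gain_def finite_half)

text \<open>The law of the sum of two fair choices from 0 and v is half a point mass at v and half a
fair choice from 0 and 2v.\<close>

lemma gain_double:
  assumes fin: "finite (set_pmf a)"
  shows "gain a (v + v) \<le> 4 * gain a v"
proof -
  let ?h = "half 0 v" and ?k = "\<lambda>b. if b then return_pmf v \<oplus> a else half 0 (v + v) \<oplus> a"
  have plus: "(\<lambda>x. v + (v + x)) = (+) (v + v)" by (simp add: fun_eq_iff add.assoc)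
  have eq: "?h \<oplus> ?h \<oplus> a = bind_pmf coin ?k"
    unfolding conv_assoc[of ?h ?h a] unfolding half_conv
    by (rule pmf_eqI) (simp add: pmf_bind_coin conv_return map_bind_pmf map_pmf_comp plus add_divide_distrib)
  have "(\<Sum>b\<in>UNIV. pmf coin b * H (?k b)) \<le> H (bind_pmf coin ?k)"
    using H_bind_ge[of coin ?k] fin by (simp add: set_coin finite_conv finite_half)
  then have "H a / 2 + H (half 0 (v + v) \<oplus> a) / 2 \<le> H (?h \<oplus> ?h \<oplus> a)"
    unfolding eq using fin by (simp add: UNIV_bool H_conv_return)
  \<comment> \<open>Two convolutions with \<open>?h\<close> gain at most twice what one gains, while
    half of the gain for \<open>v + v\<close> is contained in them; hence the factor 4.\<close>
  moreover have "H (?h \<oplus> a \<oplus> ?h) + H a \<le> H (?h \<oplus> a) + H (a \<oplus> ?h)"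
    using fin by (intro H_conv_submodular) (auto simp: finite_half)
  moreover have "?h \<oplus> a \<oplus> ?h = ?h \<oplus> ?h \<oplus> a" "a \<oplus> ?h = ?h \<oplus> a"
    by (simp_all add: conv_assoc conv_commute[of a])
  ultimately show ?thesis unfolding gain_def by simp
qed

lemma gain_conv_le:
  assumes "finite (set_pmf a)" "finite (set_pmf d)"
  shows "gain (a \<oplus> d) v \<le> gain a v"
  unfolding gain_def using assms by (intro H_conv_gain_antimono) (auto simp: finite_half)

section \<open>Uniform multiples of a vector, built from binary digits\<close>

primrec binary_pmf :: "nat \<Rightarrow> nat pmf" where
  "binary_pmf 0 = return_pmf 0"
| "binary_pmf (Suc L) = map_pmf (\<lambda>(k, b). if b then k + 2 ^ L else k) (pair_pmf (binary_pmf L) coin)"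

lemma set_binary_pmf: "set_pmf (binary_pmf L) \<subseteq> {..<2 ^ L}"
  by (induction L) (fastforce split: if_splits)+

lemma finite_binary_pmf: "finite (set_pmf (binary_pmf L))"
  using set_binary_pmf by (rule finite_subset) simp

lemma H_binary_pmf: "H (binary_pmf L) = real L"
proof (induction L)
  case 0
  show ?case by (simp add: H_def)
next
  case (Suc L)
  have "inj_on (\<lambda>(k, b). if b then k + 2 ^ L else k) (set_pmf (pair_pmf (binary_pmf L) coin))"
    using set_binary_pmf[of L] by (auto simp: inj_on_def subset_eq split: if_splits)
  then have "H (binary_pmf (Suc L)) = H (pair_pmf (binary_pmf L) coin)"
    by (simp only: binary_pmf.simps) (intro H_map_inj; simp add: finite_binary_pmf)
  then show ?case using Suc by (simp add: H_pair_pmf finite_binary_pmf H_coin)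
qed

text \<open>The multiplier is uniform on the numbers below \<open>2 ^ L\<close>. Generating it digit
  by digit makes the law a convolution of \<open>L\<close> two-point laws with steps
  \<open>2 ^ i *s v\<close>.\<close>

definition segment_pmf :: "int^'d::finite \<Rightarrow> nat \<Rightarrow> (int^'d) pmf" where
  "segment_pmf v L = map_pmf (\<lambda>k. int k *s v) (binary_pmf L)"

lemma finite_segment_pmf: "finite (set_pmf (segment_pmf v L))"
  by (simp add: segment_pmf_def finite_binary_pmf)

lemma segment_pmf_Suc: "segment_pmf v (Suc L) = segment_pmf v L \<oplus> half 0 (2 ^ L *s v)"
proof -
  have "(\<lambda>(k, b). int (if b then k + 2 ^ L else k) *s v)
      = (\<lambda>(k, b). int k *s v + (if b then 2 ^ L *s v else 0))"
    by (auto simp: fun_eq_iff vec_eq_iff distrib_right)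
  then show ?thesis
    by (simp add: segment_pmf_def half_def conv_pair map_pair map_pmf_comp case_prod_unfold pair_map_pmf1 pair_map_pmf2 del: of_nat_add)
qed

lemma gain_pow: "finite (set_pmf a) \<Longrightarrow> gain a (2 ^ i *s v) \<le> 4 ^ i * gain a v" for v :: "int^'d::finite"
proof (induction i)
  case (Suc i)
  have "2 ^ Suc i *s v = 2 ^ i *s v + 2 ^ i *s v" by (simp add: vec_eq_iff)
  then show ?case using gain_double[of a "2 ^ i *s v"] Suc by simp
qed simp

text \<open>The digits are convolved one at a time. Each adds at most the gain of
  \<open>2 ^ i *s v\<close>, that is \<open>4 ^ i * gain a v\<close>, and these terms for
  \<open>i < L\<close> sum to at most \<open>4 ^ L * gain a v\<close>.\<close>

lemma H_conv_seg_le: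
  assumes fin: "finite (set_pmf a)"
  shows "H (segment_pmf v L \<oplus> a) - H a \<le> 4 ^ L * gain a v"
proof (induction L)
  case 0
  show ?case using fin gain_nonneg[of a v] by (simp add: segment_pmf_def H_conv_return)
next
  case (Suc L)
  have "H (segment_pmf v L \<oplus> a \<oplus> half 0 (2 ^ L *s v)) + H a \<le> H (segment_pmf v L \<oplus> a) + H (a \<oplus> half 0 (2 ^ L *s v))"
    using fin by (intro H_conv_submodular) (auto simp: finite_half finite_segment_pmf)
  moreover have "segment_pmf v L \<oplus> a \<oplus> half 0 (2 ^ L *s v) = segment_pmf v (Suc L) \<oplus> a"
    by (simp add: segment_pmf_Suc conv_assoc conv_commute[of a])
  moreover have "H (a \<oplus> half 0 (2 ^ L *s v)) - H a \<le> 4 ^ L * gain a v"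
    using gain_pow[OF fin, of L v] by (simp add: gain_def conv_commute[of a])
  moreover have "0 \<le> 4 ^ L * gain a v" using gain_nonneg[OF fin] by simp
  ultimately show ?case using Suc by simp
qed

section \<open>Boxes and rounding on the integer lattice\<close>

lemma vec_set_eq: "{x::'a^'d::finite. \<forall>j. x$j \<in> S j} = vec_lambda ` Pi\<^sub>E UNIV S"
proof (intro set_eqI iffI)
  fix x :: "'a^'d" assume "x \<in> {x. \<forall>j. x$j \<in> S j}"
  then have "vec_nth x \<in> Pi\<^sub>E UNIV S" by (simp add: PiE_def extensional_def)
  then have "vec_lambda (vec_nth x) \<in> vec_lambda ` Pi\<^sub>E UNIV S" by (rule imageI)
  then show "x \<in> vec_lambda ` Pi\<^sub>E UNIV S" by simp
qed (auto simp: PiE_def)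

lemma finite_vec_set: "(\<And>j. finite (S j)) \<Longrightarrow> finite {x::'a^'d::finite. \<forall>j. x$j \<in> S j}"
  unfolding vec_set_eq by (intro finite_imageI finite_PiE) auto

lemma card_vec_set: "card {x::'a^'d::finite. \<forall>j. x$j \<in> S j} = (\<Prod>j\<in>UNIV. card (S j))"
  unfolding vec_set_eq by (subst card_image) (auto simp: inj_on_def vec_lambda_inject card_PiE)

definition ibox :: "('d::finite \<Rightarrow> nat) \<Rightarrow> (int^'d) set" where
  "ibox k = {x. \<forall>j. x$j \<in> {0..<2 ^ k j}}"

definition coarsen :: "('d::finite \<Rightarrow> nat) \<Rightarrow> int^'d \<Rightarrow> int^'d" where
  "coarsen k x = (\<chi> j. x$j div 2 ^ k j)"

abbreviation U :: "('d::finite \<Rightarrow> nat) \<Rightarrow> (int^'d) pmf" where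
  "U k \<equiv> pmf_of_set (ibox k)"

lemma finite_ibox: "finite (ibox k)"
  unfolding ibox_def by (rule finite_vec_set) simp

lemma card_ibox: "card (ibox k) = 2 ^ (\<Sum>j\<in>UNIV. k j)"
  unfolding ibox_def card_vec_set by (simp add: nat_power_eq power_sum)

lemma ibox_ne: "ibox k \<noteq> {}"
  using card_ibox[of k] by auto

lemma set_U: "set_pmf (U k) = ibox k"
  by (simp add: finite_ibox ibox_ne)

lemma finite_U: "finite (set_pmf (U k))"
  by (simp add: set_U finite_ibox)

lemma H_U: "H (U k) = (\<Sum>j\<in>UNIV. real (k j))"
  by (simp add: H_pmf_of_set finite_ibox ibox_ne card_ibox log_nat_power)

text \<open>A dyadic box is tiled by the translates of a smaller one, with offsets in the set
  \<open>G\<close> of multiples of the smaller sides. Thus smoothing at a coarse scale is a further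
  smoothing of that at a fine scale, which is the source of all monotonicity in the scale.\<close>

lemma U_factor:
  fixes k :: "'d::finite \<Rightarrow> nat"
  assumes "\<And>j. k j \<le> k' j"
  shows "\<exists>D. finite (set_pmf D) \<and> U k' = U k \<oplus> D"
proof -
  define G where "G = {x \<in> ibox k'. \<forall>j. 2 ^ k j dvd x$j}"
  have G: "finite G" "G \<noteq> {}"
  proof -
    show "finite G" unfolding G_def by (rule finite_subset[OF _ finite_ibox[of k']]) auto
    have "0 \<in> G" by (simp add: G_def ibox_def)
    then show "G \<noteq> {}" by auto
  qed
  have pow: "(2::int) ^ k' j = 2 ^ (k' j - k j) * 2 ^ k j" for j
    using assms[of j] by (simp add: power_add[symmetric])
  have "bij_betw (\<lambda>(x, y). x + y) (ibox k \<times> G) (ibox k')"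
  proof (rule bij_betwI[where g = "\<lambda>z. (\<chi> j. z$j mod 2 ^ k j, \<chi> j. z$j - z$j mod 2 ^ k j)"])
    show "(\<lambda>(x, y). x + y) \<in> ibox k \<times> G \<rightarrow> ibox k'"
    proof clarsimp
      fix x y assume x: "x \<in> ibox k" and y: "y \<in> G"
      show "x + y \<in> ibox k'" unfolding ibox_def
      proof clarsimp
        fix j
        obtain c where c: "y$j = c * 2 ^ k j" using y by (auto simp: G_def dvd_def mult.commute)
        have "y$j < 2 ^ (k' j - k j) * 2 ^ k j" using y by (simp add: G_def ibox_def pow)
        then have "c < 2 ^ (k' j - k j)" unfolding c by (simp add: mult_less_cancel_right)
        then have "(c + 1) * 2 ^ k j \<le> 2 ^ (k' j - k j) * 2 ^ k j" by (intro mult_right_mono) auto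
        then show "0 \<le> x$j + y$j \<and> x$j + y$j < 2 ^ k' j"
          using x y c by (auto simp: G_def ibox_def pow algebra_simps intro: add_nonneg_nonneg dest!: spec[of _ j])
      qed
    qed
    show "(\<lambda>z. (\<chi> j. z$j mod 2 ^ k j, \<chi> j. z$j - z$j mod 2 ^ k j)) \<in> ibox k' \<rightarrow> ibox k \<times> G"
    proof clarsimp
      fix z :: "int^'d" assume z: "z \<in> ibox k'"
      have "z$j - z$j mod 2 ^ k j < 2 ^ k' j \<and> 0 \<le> z$j - z$j mod 2 ^ k j" for j
        using z by (auto simp: ibox_def dest!: spec[of _ j] intro: le_less_trans[of _ "z$j"] zmod_le_nonneg_dividend)
      moreover have "2 ^ k j dvd z$j - z$j mod 2 ^ k j" for j
        by (simp add: minus_mod_eq_div_mult)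
      ultimately show "(\<chi> j. z$j mod 2 ^ k j) \<in> ibox k \<and> (\<chi> j. z$j - z$j mod 2 ^ k j) \<in> G"
        by (simp add: ibox_def G_def)
    qed
    fix p assume "p \<in> ibox k \<times> G"
    then obtain x y where p: "p = (x, y)" and x: "x \<in> ibox k" and y: "y \<in> G" by auto
    have "(x$j + y$j) mod 2 ^ k j = x$j" for j
      using x y by (auto simp: ibox_def G_def dvd_def dest!: spec[of _ j])
    then show "(\<lambda>z. (\<chi> j. z$j mod 2 ^ k j, \<chi> j. z$j - z$j mod 2 ^ k j)) ((\<lambda>(x, y). x + y) p) = p"
      by (simp add: p vec_eq_iff)
  next
    fix z :: "int^'d"
    show "(\<lambda>(x, y). x + y) (\<chi> j. z$j mod 2 ^ k j, \<chi> j. z$j - z$j mod 2 ^ k j) = z"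
      by (simp add: vec_eq_iff)
  qed
  then have "map_pmf (\<lambda>(x, y). x + y) (pmf_of_set (ibox k \<times> G)) = U k'"
    using G by (intro map_pmf_of_set_bij_betw) (auto simp: finite_ibox ibox_ne)
  moreover have "pmf_of_set (ibox k \<times> G) = pair_pmf (U k) (pmf_of_set G)"
    using G by (intro pmf_eqI) (auto simp: pmf_pair indicator_def card_cartesian_product finite_ibox ibox_ne pmf_of_set[OF G(2,1)])
  ultimately have "U k' = U k \<oplus> pmf_of_set G" by (simp add: conv_pair)
  then show ?thesis using G by (metis set_pmf_of_set)
qed

text \<open>Given the cell of x, the sum x + y lies in a box of sides \<open>2 * 2 ^ k j\<close>.
  Its volume accounts for the entropy of \<open>U k\<close> and one more bit per coordinate.\<close>

lemma H_conv_U_le: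
  fixes k :: "'d::finite \<Rightarrow> nat"
  assumes fin: "finite (set_pmf p)"
  shows "H (p \<oplus> U k) \<le> H (map_pmf (coarsen k) p) + (\<Sum>j\<in>UNIV. real (k j)) + CARD('d)"
proof -
  let ?P = "pair_pmf p (U k)"
  let ?K = "2 ^ ((\<Sum>j\<in>UNIV. k j) + CARD('d))"
  have "H (map_pmf (\<lambda>(x, y). x + y) ?P) \<le> H (map_pmf (\<lambda>w. coarsen k (fst w)) ?P) + log 2 (real ?K)"
  proof (rule H_cond_card)
    show "finite (set_pmf ?P)" using fin by (simp add: finite_U)
    fix w
    let ?S = "\<lambda>j. {coarsen k (fst w) $ j * 2 ^ k j ..< coarsen k (fst w) $ j * 2 ^ k j + 2 * 2 ^ k j}"
    have "(\<lambda>(x, y). x + y) ` {w' \<in> set_pmf ?P. coarsen k (fst w') = coarsen k (fst w)} \<subseteq> {z. \<forall>j. z$j \<in> ?S j}"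
    proof clarsimp
      fix x y j assume *: "coarsen k x = coarsen k (fst w)" and "y \<in> set_pmf (U k)"
      then have "y \<in> ibox k" by (simp only: set_U)
      then have "0 \<le> y$j \<and> y$j < 2 ^ k j" by (simp add: ibox_def)
      moreover have "x$j = coarsen k x $ j * 2 ^ k j + x$j mod 2 ^ k j"
        unfolding coarsen_def vec_lambda_beta by (rule div_mult_mod_eq[symmetric])
      moreover have "0 \<le> x$j mod 2 ^ k j" "x$j mod 2 ^ k j < 2 ^ k j" by simp_all
      ultimately show "coarsen k (fst w) $ j * 2 ^ k j \<le> x $ j + y $ j \<and>
          x $ j + y $ j < coarsen k (fst w) $ j * 2 ^ k j + 2 * 2 ^ k j"
        unfolding * by linarith
    qed
    then have "card ((\<lambda>(x, y). x + y) ` {w' \<in> set_pmf ?P. coarsen k (fst w') = coarsen k (fst w)})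
      \<le> card {z::int^'d. \<forall>j. z$j \<in> ?S j}"
      by (intro card_mono finite_vec_set) auto
    also have "\<dots> = (\<Prod>j\<in>UNIV. 2 * 2 ^ k j)" unfolding card_vec_set by (simp add: nat_mult_distrib nat_power_eq)
    also have "\<dots> = ?K" by (simp add: prod.distrib power_add power_sum)
    finally show "card ((\<lambda>(x, y). x + y) ` {w' \<in> set_pmf ?P. coarsen k (fst w') = coarsen k (fst w)}) \<le> ?K" .
  qed simp
  also have "map_pmf (\<lambda>w. coarsen k (fst w)) ?P = map_pmf (coarsen k) p"
    using map_pmf_comp[of "coarsen k" fst ?P] by (simp add: map_fst_pair_pmf)
  also have "log 2 (real ?K) = (\<Sum>j\<in>UNIV. real (k j)) + CARD('d)"
    unfolding of_nat_power by (simp only: log_nat_power of_nat_numeral) (simp add: log_nat_power)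
  finally show ?thesis by (simp add: conv_pair)
qed

text \<open>Submodularity of x and x + y given the cell of x. From x + y the cell of x is known up
  to five choices per coordinate, since y reaches at most two cells to either side.\<close>

lemma H_conv_ge_floor:
  fixes k :: "'d::finite \<Rightarrow> nat"
  assumes fin: "finite (set_pmf p)" "finite (set_pmf t)"
    and t: "\<And>z j. z \<in> set_pmf t \<Longrightarrow> \<bar>z$j\<bar> \<le> 2 * 2 ^ k j"
  shows "H (map_pmf (coarsen k) p) + H t - CARD('d) * log 2 5 \<le> H (p \<oplus> t)"
proof -
  let ?P = "pair_pmf p t"
  let ?s = "\<lambda>w::(int^'d) \<times> (int^'d). fst w + snd w" and ?f = "\<lambda>w::(int^'d) \<times> (int^'d). coarsen k (fst w)"
  have finP: "finite (set_pmf ?P)" using fin by simp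
  have "H (map_pmf (\<lambda>w. (fst w, ?s w, ?f w)) ?P) = H (map_pmf (\<lambda>w. w) ?P)"
    by (rule H_map_equiv[OF finP]) (auto simp: prod_eq_iff)
  then have 1: "H (map_pmf (\<lambda>w. (fst w, ?s w, ?f w)) ?P) = H p + H t" using fin by (simp add: H_pair_pmf)
  have "H (map_pmf (\<lambda>w. (fst w, ?f w)) ?P) = H (map_pmf fst ?P)"
    by (rule H_map_equiv[OF finP]) auto
  then have 2: "H (map_pmf (\<lambda>w. (fst w, ?f w)) ?P) = H p" by (simp add: map_fst_pair_pmf)
  have 3: "map_pmf ?f ?P = map_pmf (coarsen k) p"
    using map_pmf_comp[of "coarsen k" fst ?P] by (simp add: map_fst_pair_pmf)
  have "H (map_pmf (\<lambda>w. (?s w, ?f w)) ?P) \<le> H (map_pmf ?s ?P) + log 2 (real (5 ^ CARD('d)))"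
  proof (rule H_cond_card[OF finP])
    fix w assume "w \<in> set_pmf ?P"
    let ?S = "\<lambda>j. {?s w $ j div 2 ^ k j - 2 .. ?s w $ j div 2 ^ k j + 2}"
    have "(\<lambda>w. (?s w, ?f w)) ` {w' \<in> set_pmf ?P. ?s w' = ?s w} \<subseteq> Pair (?s w) ` {z. \<forall>j. z$j \<in> ?S j}"
    proof clarsimp
      fix x y assume *: "x + y = ?s w" and y: "y \<in> set_pmf t"
      have "coarsen k x $ j \<in> ?S j" for j
      proof -
        have "x$j = ?s w $ j - y$j" using * by (metis add_diff_cancel_right' vector_minus_component)
        moreover have "\<bar>y$j\<bar> \<le> 2 * 2 ^ k j" using t[OF y] .
        ultimately have "?s w $ j + (-2) * 2 ^ k j \<le> x$j" "x$j \<le> ?s w $ j + 2 * 2 ^ k j" by auto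
        then have "(?s w $ j + (-2) * 2 ^ k j) div 2 ^ k j \<le> x$j div 2 ^ k j"
          "x$j div 2 ^ k j \<le> (?s w $ j + 2 * 2 ^ k j) div 2 ^ k j"
          by (intro zdiv_mono1; simp)+
        moreover have "(a + c * 2 ^ k j) div 2 ^ k j = c + a div 2 ^ k j" for a c :: int by simp
        ultimately show ?thesis by (simp only: coarsen_def vec_lambda_beta atLeastAtMost_iff) linarith
      qed
      then show "(fst w + snd w, coarsen k x) \<in> Pair (fst w + snd w) ` {z. \<forall>j. (fst w $ j + snd w $ j) div 2 ^ k j - 2 \<le> z $ j \<and> z $ j \<le> (fst w $ j + snd w $ j) div 2 ^ k j + 2}"
        by simp
    qed
    then have "card ((\<lambda>w. (?s w, ?f w)) ` {w' \<in> set_pmf ?P. ?s w' = ?s w}) \<le> card (Pair (?s w) ` {z. \<forall>j. z$j \<in> ?S j})"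
      by (intro card_mono finite_imageI finite_vec_set) auto
    also have "\<dots> \<le> card {z::int^'d. \<forall>j. z$j \<in> ?S j}" by (intro card_image_le finite_vec_set) auto
    also have "\<dots> = 5 ^ CARD('d)" unfolding card_vec_set by simp
    finally show "card ((\<lambda>w. (?s w, ?f w)) ` {w' \<in> set_pmf ?P. ?s w' = ?s w}) \<le> 5 ^ CARD('d)" .
  qed simp
  then have "H (map_pmf (\<lambda>w. (?s w, ?f w)) ?P) \<le> H (p \<oplus> t) + CARD('d) * log 2 5"
    by (simp add: conv_pair case_prod_unfold log_nat_power)
  then show ?thesis using H_submodular[OF finP, of fst ?s ?f] 1 2 3 by simp
qed

text \<open>The sum of a multiple of \<open>v\<close> and a point of the box determines both once
  the multiplier is known. Coordinate \<open>j\<close> alone confines the multiplier to an interval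
  of length \<open>2 ^ k j div \<bar>v$j\<bar>\<close>, so little entropy is lost.\<close>

lemma H_seg_conv_U_ge:
  fixes k :: "'d::finite \<Rightarrow> nat"
  assumes v: "v$j \<noteq> 0" "\<bar>v$j\<bar> \<le> 2 ^ k j"
  shows "(\<Sum>j\<in>UNIV. real (k j)) + real L - (k j + 1 - log 2 \<bar>v$j\<bar>) \<le> H (segment_pmf v L \<oplus> U k)"
proof -
  let ?P = "pair_pmf (binary_pmf L) (U k)"
  let ?s = "\<lambda>w. int (fst w) *s v + snd w"
  let ?q = "nat (2 ^ k j div \<bar>v$j\<bar>)"
  let ?K = "?q + 1"
  have finP: "finite (set_pmf ?P)" by (simp add: finite_U finite_binary_pmf)
  have "H (map_pmf (\<lambda>w. w) ?P) \<le> H (map_pmf ?s ?P) + log 2 (real ?K)"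
  proof (rule H_cond_card[OF finP])
    fix w
    let ?W = "{w' \<in> set_pmf ?P. ?s w' = ?s w}"
    have finW: "finite ?W" using finP by simp
    have "inj_on fst ?W" by (auto simp: inj_on_def) (metis add_left_cancel)
    then have "card ((\<lambda>w. w) ` ?W) = card (fst ` ?W)" by (simp add: card_image)
    also have "\<dots> \<le> card {Min (fst ` ?W)..Min (fst ` ?W) + ?q}"
    proof (cases "?W = {}")
      case False
      have "Min (fst ` ?W) \<in> fst ` ?W" using False finW by (intro Min_in) auto
      then obtain w1 where w1: "w1 \<in> ?W" "fst w1 = Min (fst ` ?W)" by auto
      have "fst w2 \<le> Min (fst ` ?W) + ?q" if w2: "w2 \<in> ?W" for w2
      proof -
        have eq: "int (fst w2) * v$j + snd w2 $ j = int (fst w1) * v$j + snd w1 $ j"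
        proof -
          have "?s w2 = ?s w1" using w1 w2 by auto
          then have "?s w2 $ j = ?s w1 $ j" by simp
          then show ?thesis by simp
        qed
        have "snd w1 \<in> ibox k" "snd w2 \<in> ibox k" using w1 w2 by (auto simp: set_U)
        then have "snd w1 $ j \<in> {0..<2 ^ k j}" "snd w2 $ j \<in> {0..<2 ^ k j}"
          by (auto simp: ibox_def)
        then have "\<bar>(int (fst w2) - int (fst w1)) * v$j\<bar> < 2 ^ k j"
          using eq unfolding left_diff_distrib by auto
        moreover have "(int (fst w2) - int (fst w1)) * \<bar>v$j\<bar> \<le> \<bar>(int (fst w2) - int (fst w1)) * v$j\<bar>"
          unfolding abs_mult by (intro mult_right_mono abs_ge_self) simp
        ultimately have "(int (fst w2) - int (fst w1)) * \<bar>v$j\<bar> \<le> 2 ^ k j" by linarith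
        then have "int (fst w2) - int (fst w1) \<le> 2 ^ k j div \<bar>v$j\<bar>"
          using zdiv_mono1[of "(int (fst w2) - int (fst w1)) * \<bar>v$j\<bar>" "2 ^ k j" "\<bar>v$j\<bar>"] v(1) by simp
        then show ?thesis using w1(2) by linarith
      qed
      moreover have "Min (fst ` ?W) \<le> fst w2" if "w2 \<in> ?W" for w2
        using finW that by (intro Min_le finite_imageI imageI)
      ultimately have "fst ` ?W \<subseteq> {Min (fst ` ?W)..Min (fst ` ?W) + ?q}"
        by (intro image_subsetI) (simp only: atLeastAtMost_iff)
      then show ?thesis by (intro card_mono) auto
    next
      case True
      show ?thesis unfolding True by simp
    qed
    finally show "card ((\<lambda>w. w) ` ?W) \<le> ?K" by simp
  qed simp
  moreover have "H (map_pmf (\<lambda>w. w) ?P) = real L + (\<Sum>j\<in>UNIV. real (k j))"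
    by (simp add: H_pair_pmf finite_U finite_binary_pmf H_binary_pmf H_U)
  moreover have "map_pmf ?s ?P = segment_pmf v L \<oplus> U k"
    by (simp add: conv_pair segment_pmf_def pair_map_pmf1 map_pmf_comp case_prod_unfold)
  moreover have "log 2 (real ?K) \<le> k j + 1 - log 2 \<bar>v$j\<bar>"
  proof -
    have p: "0 < \<bar>v$j\<bar>" using v by simp
    have "real ?q = of_int (2 ^ k j div \<bar>v$j\<bar>)" using p by (simp add: pos_imp_zdiv_nonneg_iff)
    also have "\<dots> \<le> 2 ^ k j / real_of_int \<bar>v$j\<bar>" using real_of_int_div4[of "2 ^ k j" "\<bar>v$j\<bar>"] by simp
    finally have "real ?K \<le> 2 ^ k j / real_of_int \<bar>v$j\<bar> + 1" by simp
    also have "1 \<le> 2 ^ k j / real_of_int \<bar>v$j\<bar>"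
    proof -
      have "real_of_int \<bar>v$j\<bar> \<le> real_of_int (2 ^ k j)" using v(2) by (simp only: of_int_le_iff)
      then show ?thesis using p by simp
    qed
    finally have "real ?K \<le> 2 ^ (k j + 1) / real_of_int \<bar>v$j\<bar>" by simp
    then have "log 2 (real ?K) \<le> log 2 (2 ^ (k j + 1) / real_of_int \<bar>v$j\<bar>)"
      by (intro log_mono) auto
    then show ?thesis using p by (simp add: log_divide log_mult log_nat_power)
  qed
  ultimately show ?thesis by simp
qed

text \<open>The segment thickened by \<open>U k\<close> has, up to a factor 2, the extent
  \<open>2 ^ k i\<close> in the directions other than \<open>j\<close> and \<open>2 ^ kj\<close> in
  direction \<open>j\<close>. Convolution with it therefore adds its full entropy to that of the
  cells \<open>k(j := kj)\<close> of Y, whereas \<open>U k\<close> adds its entropy to that of the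
  cells \<open>k\<close>. The difference of the two cell entropies is the quantity that
  non-saturation bounds.\<close>

lemma gain_lower:
  fixes k :: "'d::finite \<Rightarrow> nat"
  assumes fin: "finite (set_pmf Y)"
    and v: "v$j \<noteq> 0" "\<bar>v$j\<bar> \<le> 2 ^ k j" "2 ^ L * \<bar>v$j\<bar> \<le> 2 ^ kj" "k j \<le> kj"
    and vi: "\<And>i. i \<noteq> j \<Longrightarrow> 2 ^ L * \<bar>v$i\<bar> \<le> 2 ^ k i"
  shows "H (map_pmf (coarsen (k(j := kj))) Y) - H (map_pmf (coarsen k) Y) + real L + log 2 \<bar>v$j\<bar> - k j - 1
      - CARD('d) * (1 + log 2 5) \<le> 4 ^ L * gain (U k \<oplus> Y) v"
proof -
  let ?t = "segment_pmf v L \<oplus> U k"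
  have "\<bar>z$i\<bar> \<le> 2 * 2 ^ (k(j := kj)) i" if zt: "z \<in> set_pmf ?t" for z i
  proof -
    obtain a u where z: "z = int a *s v + u" and a: "a \<in> set_pmf (binary_pmf L)" and u: "u \<in> ibox k"
      using zt by (auto simp: set_conv segment_pmf_def set_U)
    have "a < 2 ^ L" using a set_binary_pmf by auto
    then have "int a \<le> 2 ^ L" by (metis of_nat_less_iff of_nat_numeral of_nat_power less_imp_le)
    then have "int a * \<bar>v$i\<bar> \<le> 2 ^ L * \<bar>v$i\<bar>" by (intro mult_right_mono) auto
    also have "\<dots> \<le> 2 ^ (k(j := kj)) i" using v(3) vi[of i] by auto
    finally have 1: "\<bar>int a * v$i\<bar> \<le> 2 ^ (k(j := kj)) i" by (simp add: abs_mult)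
    have "(2::int) ^ k i \<le> 2 ^ (k(j := kj)) i" using v(4) by simp
    moreover have "0 \<le> u$i \<and> u$i < 2 ^ k i" using u by (simp add: ibox_def)
    ultimately have "\<bar>u$i\<bar> \<le> 2 ^ (k(j := kj)) i" by linarith
    then show ?thesis using 1 unfolding z by (simp only: vector_add_component vector_smult_component)
  qed
  then have 1: "H (map_pmf (coarsen (k(j := kj))) Y) + H ?t - CARD('d) * log 2 5 \<le> H (Y \<oplus> ?t)"
    using fin by (intro H_conv_ge_floor) (auto simp: finite_conv finite_segment_pmf finite_U)
  have 2: "(\<Sum>j\<in>UNIV. real (k j)) + real L - (k j + 1 - log 2 \<bar>v$j\<bar>) \<le> H ?t"
    by (rule H_seg_conv_U_ge) fact+
  have 3: "H (Y \<oplus> U k) \<le> H (map_pmf (coarsen k) Y) + (\<Sum>j\<in>UNIV. real (k j)) + CARD('d)"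
    by (rule H_conv_U_le[OF fin])
  have 4: "H (segment_pmf v L \<oplus> (U k \<oplus> Y)) - H (U k \<oplus> Y) \<le> 4 ^ L * gain (U k \<oplus> Y) v"
    using fin by (intro H_conv_seg_le finite_conv finite_U)
  have "segment_pmf v L \<oplus> (U k \<oplus> Y) = Y \<oplus> ?t" "U k \<oplus> Y = Y \<oplus> U k"
    by (simp_all add: conv_assoc conv_commute[of Y])
  then show ?thesis using 1 2 3 4 by (simp add: algebra_simps)
qed

section \<open>Translates of a box and the gain over a uniform law\<close>

lemma card_ibox_slab:
  "card {x \<in> ibox k. x$i + c \<notin> {0..<2 ^ k i}} \<le> real_of_int \<bar>c\<bar> / 2 ^ k i * card (ibox k)"
  for k :: "'d::finite \<Rightarrow> nat"
proof -
  let ?T = "{t \<in> {0..<2 ^ k i}. t + c \<notin> {0..<2 ^ k i}}"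
  let ?S = "\<lambda>j. if j = i then ?T else {0..<2 ^ k j}"
  have "{x \<in> ibox k. x$i + c \<notin> {0..<2 ^ k i}} = {x. \<forall>j. x$j \<in> ?S j}"
    by (auto simp: ibox_def split: if_splits)
  then have "card {x \<in> ibox k. x$i + c \<notin> {0..<2 ^ k i}} = (\<Prod>j\<in>UNIV. card (?S j))"
    by (simp only: card_vec_set)
  also have "\<dots> = card ?T * (\<Prod>j\<in>UNIV - {i}. card (?S j))"
    by (subst prod.remove[of _ i]) auto
  also have "(\<Prod>j\<in>UNIV - {i}. card (?S j)) = (\<Prod>j\<in>UNIV - {i}. 2 ^ k j)"
    by (intro prod.cong) (auto simp: nat_power_eq)
  finally have 1: "card {x \<in> ibox k. x$i + c \<notin> {0..<2 ^ k i}} = card ?T * (\<Prod>j\<in>UNIV - {i}. 2 ^ k j)" .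
  have "card (ibox k) = 2 ^ k i * (\<Prod>j\<in>UNIV - {i}. 2 ^ k j)"
    unfolding card_ibox power_sum by (rule prod.remove) auto
  moreover have "card ?T \<le> nat \<bar>c\<bar>"
  proof -
    have "?T \<subseteq> (if 0 \<le> c then {2 ^ k i - c..<2 ^ k i} else {0..<-c})" by auto
    then have "card ?T \<le> card (if 0 \<le> c then {2 ^ k i - c..<2 ^ k i} else {0..<-c})"
      by (intro card_mono) auto
    then show ?thesis by (auto split: if_splits)
  qed
  then have "real (card ?T) \<le> real_of_int \<bar>c\<bar>" by linarith
  ultimately show ?thesis unfolding 1 by (simp add: mult_right_mono prod_nonneg)
qed

lemma measure_U_shift:
  "measure (measure_pmf (U k)) {x. x + v \<notin> ibox k} \<le> (\<Sum>i\<in>UNIV. real_of_int \<bar>v$i\<bar> / 2 ^ k i)"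
  for k :: "'d::finite \<Rightarrow> nat"
proof -
  have "measure (measure_pmf (U k)) {x. x + v \<notin> ibox k} = card (ibox k \<inter> {x. x + v \<notin> ibox k}) / card (ibox k)"
    by (simp add: measure_pmf_of_set finite_ibox ibox_ne)
  also have "ibox k \<inter> {x. x + v \<notin> ibox k} = (\<Union>i. {x \<in> ibox k. x$i + v$i \<notin> {0..<2 ^ k i}})"
    by (auto simp: ibox_def)
  also have "real (card \<dots>) \<le> (\<Sum>i\<in>UNIV. real (card {x \<in> ibox k. x$i + v$i \<notin> {0..<2 ^ k i}}))"
    using card_UN_le[of UNIV "\<lambda>i. {x \<in> ibox k. x$i + v$i \<notin> {0..<2 ^ k i}}"]
    unfolding of_nat_sum[symmetric] of_nat_le_iff by simp
  also have "\<dots> \<le> (\<Sum>i\<in>UNIV. real_of_int \<bar>v$i\<bar> / 2 ^ k i * card (ibox k))"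
    by (intro sum_mono card_ibox_slab)
  also have "\<dots> / card (ibox k) = (\<Sum>i\<in>UNIV. real_of_int \<bar>v$i\<bar> / 2 ^ k i)"
    by (simp add: sum_divide_distrib card_ibox)
  finally show ?thesis by (simp add: divide_right_mono)
qed

text \<open>The mixture of the box and its translate has density \<open>1 / ?N\<close> on their
  overlap and half of that elsewhere. The entropy beyond \<open>log 2 ?N\<close> is thus the
  probability of missing the overlap, which is at most the relative volume of slabs of width
  \<open>\<bar>v$i\<bar>\<close>.\<close>

lemma gain_U_le: "gain (U k) v \<le> (\<Sum>i\<in>UNIV. real_of_int \<bar>v$i\<bar> / 2 ^ k i)"
  for k :: "'d::finite \<Rightarrow> nat"
proof -
  let ?P = "pair_pmf coin (U k)" and ?B = "ibox k" and ?N = "real (card (ibox k))"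
  let ?s = "\<lambda>w. (if fst w then v else 0) + snd w"
  let ?bad = "\<lambda>z. z \<notin> ?B \<or> z - v \<notin> ?B"
  let ?w = "(\<Sum>i\<in>UNIV. real_of_int \<bar>v$i\<bar> / 2 ^ k i)"
  have N: "?N > 0" using finite_ibox[of k] ibox_ne[of k] by (simp add: card_gt_0_iff)
  have finP: "finite (set_pmf ?P)" by (simp add: finite_U)
  have conv: "half 0 v \<oplus> U k = map_pmf ?s ?P"
    by (simp add: conv_pair half_def pair_map_pmf1 map_pmf_comp case_prod_unfold)
  have pmf: "pmf (half 0 v \<oplus> U k) z = (indicator ?B (z - v) + indicator ?B z) / (2 * ?N)" for z
  proof -
    have "pmf (map_pmf ((+) v) (U k)) z = pmf (U k) (z - v)"
      using pmf_map_inj'[of "(+) v" "U k" "z - v"] by simp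
    then show ?thesis
      by (simp add: half_conv pmf_bind_coin conv_return finite_ibox ibox_ne add_divide_distrib[symmetric] divide_divide_eq_left'
          pmf_map_inj'[of "(+) 0" "U k" z, simplified])
  qed
  have le: "- log 2 (pmf (half 0 v \<oplus> U k) (?s w)) \<le> log 2 ?N + (if ?bad (?s w) then 1 else 0)"
    if "w \<in> set_pmf ?P" for w
  proof -
    have "?s w \<in> ?B \<or> ?s w - v \<in> ?B" using that by (auto simp: set_U)
    then show ?thesis using N by (auto simp: pmf indicator_def log_divide log_mult)
  qed
  have "H (half 0 v \<oplus> U k) = (\<Sum>w\<in>set_pmf ?P. pmf ?P w * (- log 2 (pmf (half 0 v \<oplus> U k) (?s w))))"
    unfolding conv H_map[OF finP] by (simp add: sum_negf)
  also have "\<dots> \<le> (\<Sum>w\<in>set_pmf ?P. pmf ?P w * (log 2 ?N + (if ?bad (?s w) then 1 else 0)))"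
    by (intro sum_mono mult_left_mono le) auto
  also have "\<dots> = log 2 ?N + (\<Sum>w\<in>set_pmf ?P. pmf ?P w * (if ?bad (?s w) then 1 else 0))"
    using sum_pmf_eq_1[OF finP, of ?P] by (simp only: distrib_left sum.distrib sum_distrib_right[symmetric])
  also have "(\<Sum>w\<in>set_pmf ?P. pmf ?P w * (if ?bad (?s w) then 1 else 0)) =
    (\<Sum>b\<in>UNIV. \<Sum>u\<in>?B. pmf coin b * (pmf (U k) u * (if ?bad (?s (b, u)) then 1 else 0)))"
    unfolding set_pair_pmf set_coin set_U sum.cartesian_product
    by (intro sum.cong refl) (clarsimp simp: pmf_pair)
  also have "\<dots> = (\<Sum>b\<in>UNIV. measure (measure_pmf (U k)) {u. ?bad (?s (b, u))} / 2)"
  proof (rule sum.cong[OF refl])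
    fix b
    have "measure (measure_pmf (U k)) {u. ?bad (?s (b, u))} = measure (measure_pmf (U k)) ({u. ?bad (?s (b, u))} \<inter> ?B)"
      using measure_Int_set_pmf[of "U k" "{u. ?bad (?s (b, u))}"] by (simp add: set_U)
    also have "\<dots> = (\<Sum>u\<in>{u. ?bad (?s (b, u))} \<inter> ?B. pmf (U k) u)"
      by (intro measure_measure_pmf_finite) (simp add: finite_ibox)
    also have "\<dots> = (\<Sum>u\<in>?B. pmf (U k) u * (if ?bad (?s (b, u)) then 1 else 0))"
      using finite_ibox[of k] by (intro sum.mono_neutral_cong_left) auto
    moreover have "pmf coin b = 1 / 2" by (cases b) simp_all
    ultimately show "(\<Sum>u\<in>?B. pmf coin b * (pmf (U k) u * (if ?bad (?s (b, u)) then 1 else 0)))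
        = measure (measure_pmf (U k)) {u. ?bad (?s (b, u))} / 2"
      unfolding sum_distrib_left[symmetric] by simp
  qed
  also have "\<dots> \<le> (\<Sum>b\<in>(UNIV::bool set). ?w / 2)"
  proof (intro sum_mono divide_right_mono)
    fix b :: bool
    show "measure (measure_pmf (U k)) {u. ?bad (?s (b, u))} \<le> ?w"
    proof (cases b)
      case True
      have "measure (measure_pmf (U k)) {u. ?bad (?s (b, u))} = measure (measure_pmf (U k)) {u. u + v \<notin> ?B}"
        using True by (intro measure_eq_AE) (auto simp: AE_measure_pmf_iff set_U add.commute)
      then show ?thesis using measure_U_shift[of k v] by simp
    next
      case False
      have "measure (measure_pmf (U k)) {u. ?bad (?s (b, u))} = measure (measure_pmf (U k)) {u. u + (-v) \<notin> ?B}"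
        using False by (intro measure_eq_AE) (auto simp: AE_measure_pmf_iff set_U)
      then show ?thesis using measure_U_shift[of k "-v"] by simp
    qed
  qed simp
  also have "\<dots> = ?w" by (simp add: UNIV_bool)
  finally have "H (half 0 v \<oplus> U k) \<le> log 2 ?N + ?w" by simp
  then show ?thesis by (simp add: gain_def H_pmf_of_set finite_ibox ibox_ne)
qed

section \<open>Scales and the gain of a two-point law\<close>

text \<open>Pigeonhole. The difference belonging to a pair \<open>(i, i')\<close> moves by at least
  \<open>2 * m\<close> from one \<open>q\<close> to the next, so each pair spoils at most one
  \<open>q\<close>; there are \<open>CARD('d) ^ 2\<close> pairs and one more value of
  \<open>q\<close>.\<close>

lemma scale_factor_gap:
  fixes x s :: "'d::finite \<Rightarrow> real"
  assumes R: "\<And>i i'. i \<noteq> i' \<Longrightarrow> 2 * m \<le> R * \<bar>x i - x i'\<bar>"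
  shows "\<exists>q \<le> CARD('d) ^ 2. \<forall>i i'. i \<noteq> i' \<longrightarrow> m \<le> \<bar>(s i - (L0 + real q * R) * x i) - (s i' - (L0 + real q * R) * x i')\<bar>"
proof (rule ccontr)
  let ?g = "\<lambda>q i i'. (s i - (L0 + real q * R) * x i) - (s i' - (L0 + real q * R) * x i')"
  assume neg: "\<not> ?thesis"
  have "\<forall>q \<in> {..CARD('d) ^ 2}. \<exists>p. fst p \<noteq> snd p \<and> \<bar>?g q (fst p) (snd p)\<bar> < m"
  proof (intro ballI)
    fix q assume "q \<in> {..CARD('d) ^ 2}"
    then have "\<not> (\<forall>i i'. i \<noteq> i' \<longrightarrow> m \<le> \<bar>?g q i i'\<bar>)" using neg by blast
    then obtain i i' where "i \<noteq> i'" "\<bar>?g q i i'\<bar> < m" by (auto simp: not_le)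
    then show "\<exists>p. fst p \<noteq> snd p \<and> \<bar>?g q (fst p) (snd p)\<bar> < m"
      by (intro exI[of _ "(i, i')"]) simp
  qed
  then obtain f where f: "\<And>q. q \<le> CARD('d) ^ 2 \<Longrightarrow> fst (f q) \<noteq> snd (f q) \<and> \<bar>?g q (fst (f q)) (snd (f q))\<bar> < m"
    by (metis atMost_iff)
  have "inj_on f {..CARD('d) ^ 2}"
  proof (intro inj_onI, rule ccontr)
    fix q q' assume q: "q \<in> {..CARD('d) ^ 2}" "q' \<in> {..CARD('d) ^ 2}" "f q = f q'" "q \<noteq> q'"
    obtain i i' where p: "f q = (i, i')" by fastforce
    have ii: "i \<noteq> i'" "\<bar>?g q i i'\<bar> < m" "\<bar>?g q' i i'\<bar> < m"
      using f[of q] f[of q'] q(1,2) unfolding q(3)[symmetric] p by auto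
    have "?g q' i i' - ?g q i i' = (real q - real q') * (R * (x i - x i'))"
      by (simp add: algebra_simps)
    then have "\<bar>real q - real q'\<bar> * \<bar>R * (x i - x i')\<bar> < 2 * m"
      using ii unfolding abs_mult[symmetric] by auto
    moreover have "1 \<le> \<bar>real q - real q'\<bar>" using q(4) by linarith
    moreover have "2 * m \<le> \<bar>R * (x i - x i')\<bar>"
      using R[OF ii(1)] mult_right_mono[OF abs_ge_self[of R], of "\<bar>x i - x i'\<bar>"] by (simp add: abs_mult)
    ultimately show False
      using mult_right_mono[of 1 "\<bar>real q - real q'\<bar>" "\<bar>R * (x i - x i')\<bar>"] by linarith
  qed
  then have "card {..CARD('d) ^ 2} \<le> card (UNIV :: ('d \<times> 'd) set)"
    by (intro card_inj_on_le) auto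
  then show False by (simp add: card_cartesian_product power2_eq_square flip: UNIV_Times_UNIV)
qed

lemma nat_bound_finite: "\<exists>R::nat. \<forall>i::'a::finite. f i \<le> real R"
proof (intro exI allI)
  fix i
  have "nat \<lceil>f i\<rceil> \<le> (\<Sum>i\<in>UNIV. nat \<lceil>f i\<rceil>)" by (rule member_le_sum) auto
  then show "f i \<le> real (\<Sum>i\<in>UNIV. nat \<lceil>f i\<rceil>)" by linarith
qed

section \<open>Levels with a different rate in each coordinate\<close>

locale levels =
  fixes ch :: "'d::finite \<Rightarrow> real"
  assumes ch_pos: "0 < ch j" and ch_inj: "inj ch"
begin

definition lev :: "'d \<Rightarrow> nat \<Rightarrow> nat" where
  "lev j n = nat \<lfloor>ch j * real n\<rfloor>"

text \<open>Lattice points are measured in units of the finest level N, so that a cell of level n has side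
\<open>2 ^ kap N n j\<close> in direction j.\<close>

definition kap :: "nat \<Rightarrow> nat \<Rightarrow> 'd \<Rightarrow> nat" where
  "kap N n j = lev j N - lev j n"

lemma lev_le: "real (lev j n) \<le> ch j * real n"
  using ch_pos[of j] by (simp add: lev_def)

lemma lev_gt: "ch j * real n - 1 < real (lev j n)"
  unfolding lev_def by linarith

lemma lev_mono: "n \<le> n' \<Longrightarrow> lev j n \<le> lev j n'"
  using ch_pos[of j] unfolding lev_def by (intro nat_mono floor_mono mult_left_mono) auto

lemma kap_real: "n \<le> N \<Longrightarrow> real (kap N n j) = real (lev j N) - real (lev j n)"
  using lev_mono[of n N j] by (simp add: kap_def of_nat_diff)

lemma kap_antimono: "n \<le> n' \<Longrightarrow> kap N n' j \<le> kap N n j"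
  using lev_mono[of n n' j] by (simp add: kap_def)

lemma log_le_iff_pow: "v \<noteq> 0 \<Longrightarrow> log 2 (real_of_int \<bar>v\<bar>) \<le> real k \<longleftrightarrow> \<bar>v\<bar> \<le> 2 ^ k"
proof -
  assume "v \<noteq> 0"
  then have "log 2 (real_of_int \<bar>v\<bar>) \<le> real k \<longleftrightarrow> real_of_int \<bar>v\<bar> \<le> 2 ^ k"
    by (subst log_le_iff) (auto simp: powr_realpow)
  also have "\<dots> \<longleftrightarrow> real_of_int \<bar>v\<bar> \<le> real_of_int (2 ^ k)" by simp
  finally show ?thesis by (simp only: of_int_le_iff)
qed

text \<open>Both bounds are weak, so a vector may have several scales. This does no harm, since
  pairs of points are estimated from above by a sum over all scales.\<close>

definition of_scale :: "nat \<Rightarrow> nat \<Rightarrow> int^'d \<Rightarrow> bool" where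
  "of_scale N l v \<longleftrightarrow> l < N \<and> (\<forall>i. \<bar>v$i\<bar> \<le> 2 ^ kap N l i) \<and> (\<exists>i. \<bar>v$i\<bar> \<ge> 2 ^ kap N (l + 1) i)"

text \<open>With \<open>\<bar>v$i\<bar> = 2 ^ (lev i N - ch i * s i)\<close>, multiplying v by \<open>2 ^ L\<close> lowers the scale \<open>s i\<close> of
coordinate i by \<open>L / ch i\<close>. The slopes are distinct, so for one of boundedly many L the coordinate
of least scale is m levels ahead of all others.\<close>

lemma exists_dominant_direction:
  "\<exists>Lm R. \<forall>N l v. of_scale N l v \<and> R \<le> l \<longrightarrow> (\<exists>L j n. L \<le> Lm \<and> n + m \<le> l \<and> v$j \<noteq> 0 \<and>
     \<bar>v$j\<bar> \<le> 2 ^ kap N (n + m) j \<and> 2 ^ L * \<bar>v$j\<bar> \<le> 2 ^ kap N n j \<and>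
     kap N n j - ch j - 1 \<le> L + log 2 \<bar>v$j\<bar> \<and> (\<forall>i. i \<noteq> j \<longrightarrow> 2 ^ L * \<bar>v$i\<bar> \<le> 2 ^ kap N (n + m) i))"
proof -
  let ?d2 = "CARD('d) ^ 2"
  \<comment> \<open>Raising \<open>L\<close> by \<open>R'\<close> changes the distance between the
    scales of any two coordinates by at least \<open>2 * m\<close>, as the pigeonhole argument
    requires. Distinctness of the rates makes \<open>R'\<close> finite.\<close>
  obtain R' :: nat where R': "\<And>p. 2 * m / \<bar>1 / ch (fst p) - 1 / ch (snd p)\<bar> \<le> real R'"
    using nat_bound_finite[of "\<lambda>p. 2 * m / \<bar>1 / ch (fst p) - 1 / ch (snd p)\<bar>"] by auto
  \<comment> \<open>Every coordinate is lowered by at least \<open>m + 1\<close> levels. A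
    coordinate \<open>i0\<close> of scale at most \<open>l + 1\<close> then arrives at
    \<open>l - m\<close> or below, which yields \<open>n + m \<le> l\<close>.\<close>
  obtain L0 :: nat where L0: "\<And>j. (m + 1) * ch j \<le> real L0"
    using nat_bound_finite[of "\<lambda>j. (m + 1) * ch j"] by auto
  define Lm where "Lm = L0 + ?d2 * R'"
  \<comment> \<open>For \<open>l\<close> beyond \<open>R\<close> no nonzero coordinate is moved
    below level 0, so \<open>n\<close> is a natural number.\<close>
  obtain R :: nat where R: "\<And>j. (Lm + 1) / ch j \<le> real R"
    using nat_bound_finite[of "\<lambda>j. (Lm + 1) / ch j"] by auto
  have gapR: "2 * real m \<le> R' * \<bar>1 / ch i - 1 / ch i'\<bar>" if "i \<noteq> i'" for i i'
  proof -
    have "ch i \<noteq> ch i'" using that ch_inj by (auto dest: injD)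
    then have "0 < \<bar>1 / ch i - 1 / ch i'\<bar>" using ch_pos[of i] ch_pos[of i'] by (simp add: field_simps)
    then show ?thesis using R'[of "(i, i')"] by (simp add: pos_divide_le_eq)
  qed
  show ?thesis
  proof (rule exI[of _ Lm], rule exI[of _ R], intro allI impI)
    fix N l v assume as: "of_scale N l v \<and> R \<le> l"
    then have lN: "l < N" and fit: "\<And>i. \<bar>v$i\<bar> \<le> 2 ^ kap N l i" and Rl: "R \<le> l" by (auto simp: of_scale_def)
    from as obtain i0 where i0: "\<bar>v$i0\<bar> \<ge> 2 ^ kap N (l + 1) i0" by (auto simp: of_scale_def)
    \<comment> \<open>For a zero coordinate the convention \<open>log 2 0 = 0\<close> makes
      \<open>s i\<close> a meaningless number. The gap holds for it all the same, and the minimum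
      below is taken over nonzero coordinates only.\<close>
    define s where "s i = (real (lev i N) - log 2 \<bar>v$i\<bar>) / ch i" for i
    obtain q where q: "q \<le> ?d2" "\<And>i i'. i \<noteq> i' \<Longrightarrow>
        real m \<le> \<bar>(s i - (real L0 + real q * R') * (1 / ch i)) - (s i' - (real L0 + real q * R') * (1 / ch i'))\<bar>"
      using scale_factor_gap[of m "real R'" "\<lambda>i. 1 / ch i" s "real L0"] gapR by blast
    define L where "L = L0 + q * R'"
    define t where "t i = s i - real L / ch i" for i
    have gap: "real m \<le> \<bar>t i - t i'\<bar>" if "i \<noteq> i'" for i i'
      using q(2)[OF that] by (simp add: t_def L_def)
    have LLm: "L \<le> Lm" using q(1) by (simp add: L_def Lm_def)
    have log_t: "log 2 \<bar>v$i\<bar> + L = lev i N - ch i * t i" for i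
      using ch_pos[of i] by (simp add: t_def s_def field_simps)
    have log_v: "log 2 \<bar>v$i\<bar> = lev i N - ch i * s i" for i
      using ch_pos[of i] by (simp add: s_def field_simps)
    have s_ge: "real l - 1 / ch i \<le> s i" if "v$i \<noteq> 0" for i
    proof -
      have "log 2 \<bar>v$i\<bar> \<le> real (kap N l i)" using fit[of i] log_le_iff_pow[OF that] by blast
      then have "real (lev i l) \<le> ch i * s i" using lN unfolding log_v by (simp add: kap_real)
      then have "ch i * real l - 1 \<le> ch i * s i" using lev_gt[of i l] by linarith
      then show ?thesis using ch_pos[of i] by (simp add: field_simps)
    qed
    have vi0: "v$i0 \<noteq> 0"
    proof
      assume "v$i0 = 0"
      then have "(2::int) ^ kap N (l + 1) i0 \<le> 0" using i0 by simp
      then show False by (simp add: not_le[symmetric])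
    qed
    have L_ch: "real m + 1 \<le> real L / ch i" for i
    proof -
      have "(real m + 1) * ch i \<le> real L0" using L0[of i] by (simp add: add.commute)
      also have "\<dots> \<le> real L" by (simp add: L_def)
      finally have "(real m + 1) * ch i \<le> real L" .
      then show ?thesis using ch_pos[of i] by (simp add: pos_le_divide_eq)
    qed
    have "s i0 \<le> real l + 1"
    proof -
      have "real_of_int (2 ^ kap N (l + 1) i0) \<le> real_of_int \<bar>v$i0\<bar>" using i0 by (simp only: of_int_le_iff)
      then have "log 2 (2 ^ kap N (l + 1) i0) \<le> log 2 \<bar>v$i0\<bar>" using vi0 by (intro log_mono) auto
      then have "real (kap N (l + 1) i0) \<le> log 2 \<bar>v$i0\<bar>" by (simp add: log_nat_power)
      then have "ch i0 * s i0 \<le> lev i0 (l + 1)" using lN unfolding log_v by (simp add: kap_real)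
      also have "\<dots> \<le> ch i0 * real (l + 1)" by (rule lev_le)
      finally show ?thesis using ch_pos[of i0] by (simp add: mult_le_cancel_left)
    qed
    then have t_i0: "t i0 \<le> real l - real m" using L_ch[of i0] by (simp add: t_def)
    let ?I = "{i. v$i \<noteq> 0}"
    have "finite ?I" "?I \<noteq> {}" using vi0 by auto
    then obtain j where j: "j \<in> ?I" "\<And>i. i \<in> ?I \<Longrightarrow> t j \<le> t i"
      using arg_min_if_finite[of ?I t] by (metis linorder_not_le)
    \<comment> \<open>Rounding down makes the lengthened coordinate \<open>j\<close> fit a cell of
      level \<open>n\<close>. It falls short of filling the cell by at most one level and the
      rounding in \<open>lev\<close>, hence the loss of \<open>ch j + 1\<close> bits.\<close>
    define n where "n = nat \<lfloor>t j\<rfloor>"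
    have "0 \<le> t j"
    proof -
      have "(real L + 1) / ch j \<le> (Lm + 1) / ch j" using LLm ch_pos[of j] by (intro divide_right_mono) auto
      also have "\<dots> \<le> real l" using R[of j] Rl by linarith
      finally show ?thesis using s_ge[of j] j(1) by (simp add: t_def add_divide_distrib)
    qed
    then have n: "real n \<le> t j" "t j < real n + 1" by (simp_all add: n_def)
    have nml: "n + m \<le> l" using n(1) j(2)[of i0] vi0 t_i0 by simp
    then have nN: "n + m \<le> N" "n \<le> N" using lN by auto
    have lev_nm: "lev i (n + m) \<le> ch i * x" if "real n + real m \<le> x" for i x
      using order_trans[OF lev_le[of i "n + m"], of "ch i * x"] that ch_pos[of i] by simp
    have two_pow: "2 ^ L * \<bar>w\<bar> \<le> 2 ^ k" if "log 2 \<bar>w\<bar> + L \<le> real k" "w \<noteq> 0" for w :: int and k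
    proof -
      have "log 2 \<bar>2 ^ L * w\<bar> = log 2 \<bar>w\<bar> + L" using that(2) by (simp add: abs_mult log_mult log_nat_power)
      then show ?thesis using that log_le_iff_pow[of "2 ^ L * w" k] by (simp add: abs_mult)
    qed
    show "\<exists>L j n. L \<le> Lm \<and> n + m \<le> l \<and> v$j \<noteq> 0 \<and>
     \<bar>v$j\<bar> \<le> 2 ^ kap N (n + m) j \<and> 2 ^ L * \<bar>v$j\<bar> \<le> 2 ^ kap N n j \<and>
     kap N n j - ch j - 1 \<le> L + log 2 \<bar>v$j\<bar> \<and> (\<forall>i. i \<noteq> j \<longrightarrow> 2 ^ L * \<bar>v$i\<bar> \<le> 2 ^ kap N (n + m) i)"
    proof (rule exI[of _ L], rule exI[of _ j], rule exI[of _ n], intro conjI allI impI)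
      show "L \<le> Lm" "n + m \<le> l" "v$j \<noteq> 0" using LLm nml j(1) by auto
      have "real n + real m \<le> s j" using n(1) L_ch[of j] by (simp add: t_def)
      then have "log 2 \<bar>v$j\<bar> \<le> real (kap N (n + m) j)"
        using lev_nm[of "s j" j] nN unfolding log_v by (simp add: kap_real)
      then show "\<bar>v$j\<bar> \<le> 2 ^ kap N (n + m) j" using j(1) log_le_iff_pow by simp
      have "lev j n \<le> ch j * t j"
        using order_trans[OF lev_le[of j n], of "ch j * t j"] n(1) ch_pos[of j] by simp
      then show "2 ^ L * \<bar>v$j\<bar> \<le> 2 ^ kap N n j"
        using j(1) nN log_t[of j] by (intro two_pow) (auto simp: kap_real)
      have "ch j * t j \<le> ch j * (real n + 1)" using n(2) ch_pos[of j] by (intro mult_left_mono) auto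
      then have "ch j * t j \<le> lev j n + ch j + 1" using lev_gt[of j n] by (simp add: distrib_left)
      then show "kap N n j - ch j - 1 \<le> L + log 2 \<bar>v$j\<bar>" using log_t[of j] nN by (simp add: kap_real)
      fix i assume ij: "i \<noteq> j"
      show "2 ^ L * \<bar>v$i\<bar> \<le> 2 ^ kap N (n + m) i"
      proof (cases "v$i = 0")
        case False
        then have "t j \<le> t i" using j(2) by simp
        then have "t j + m \<le> t i" using gap[OF ij] by linarith
        then have "lev i (n + m) \<le> ch i * t i" using n(1) by (intro lev_nm) linarith
        then show ?thesis using False nN log_t[of i] by (intro two_pow) (auto simp: kap_real)
      qed simp
    qed
  qed
qed

text \<open>The difference is a conditional entropy: the second partition is the first one coarsened
  to level \<open>n\<close> in coordinate \<open>j\<close> alone.\<close>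

definition nonsat :: "real \<Rightarrow> nat \<Rightarrow> nat \<Rightarrow> (int^'d) pmf \<Rightarrow> bool" where
  "nonsat eps m N Y \<longleftrightarrow> (\<forall>j n. n + m \<le> N \<longrightarrow>
     H (map_pmf (coarsen (kap N (n + m))) Y) - H (map_pmf (coarsen ((kap N (n + m))(j := kap N n j))) Y) \<le> (ch j - eps) * m)"

lemma U_kap_factor: "n \<le> n' \<Longrightarrow> \<exists>D. finite (set_pmf D) \<and> U (kap N n) = U (kap N n') \<oplus> D"
  by (intro U_factor kap_antimono)

lemma gain_kap_mono:
  assumes "n \<le> n'" "finite (set_pmf Y)"
  shows "gain (U (kap N n) \<oplus> Y) v \<le> gain (U (kap N n') \<oplus> Y) v"
proof -
  obtain D where D: "finite (set_pmf D)" "U (kap N n) = U (kap N n') \<oplus> D"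
    using U_kap_factor[OF assms(1)] by blast
  have "U (kap N n) \<oplus> Y = (U (kap N n') \<oplus> Y) \<oplus> D"
    unfolding D by (simp add: conv_assoc conv_commute[of D])
  then show ?thesis using gain_conv_le[of "U (kap N n') \<oplus> Y" D] assms D by (simp add: finite_conv finite_U)
qed

text \<open>Besides the term with \<open>CARD('d)\<close>, the lower bound loses 1 bit in
  \<open>gain_lower\<close>, \<open>ch j + 1\<close> bits because the box is not quite filled, and 1
  bit in rounding \<open>ch j * m\<close>. The 4 in the hypothesis leaves one full bit for
  \<open>4 ^ L * gain\<close>. At scale \<open>l - W\<close> the gain is small because the box is
  much longer than \<open>v\<close>.\<close>

lemma gain_at_scale:
  assumes m: "\<And>j. ch j + 4 + CARD('d) * (1 + log 2 5) \<le> eps * m"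
  shows "\<exists>c>0. \<exists>W\<ge>1. \<forall>N l Y v. of_scale N l v \<and> W \<le> l \<and> finite (set_pmf Y) \<and> nonsat eps m N Y \<longrightarrow>
     c \<le> gain (U (kap N l) \<oplus> Y) v - gain (U (kap N (l - W)) \<oplus> Y) v"
proof -
  let ?d = "CARD('d)"
  obtain Lm R where LR: "\<forall>N l v. of_scale N l v \<and> R \<le> l \<longrightarrow> (\<exists>L j n. L \<le> Lm \<and> n + m \<le> l \<and> v$j \<noteq> 0 \<and>
     \<bar>v$j\<bar> \<le> 2 ^ kap N (n + m) j \<and> 2 ^ L * \<bar>v$j\<bar> \<le> 2 ^ kap N n j \<and>
     kap N n j - ch j - 1 \<le> L + log 2 \<bar>v$j\<bar> \<and> (\<forall>i. i \<noteq> j \<longrightarrow> 2 ^ L * \<bar>v$i\<bar> \<le> 2 ^ kap N (n + m) i))"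
    using exists_dominant_direction[of m] by blast
  \<comment> \<open>After \<open>W0\<close> levels each of the \<open>CARD('d)\<close> slabs has
    relative volume at most \<open>c / 2 ^ CARD('d)\<close>, so together they stay below
    \<open>c\<close>.\<close>
  obtain W0 :: nat where W0: "\<And>i. (2 * Lm + 2 + ?d) / ch i \<le> real W0"
    using nat_bound_finite[of "\<lambda>i. (2 * Lm + 2 + ?d) / ch i"] by auto
  define W where "W = W0 + R + 1"
  \<comment> \<open>Half of the lower bound \<open>1 / 4 ^ Lm\<close> at scale \<open>l\<close>; the
    other half pays for the gain at scale \<open>l - W\<close>.\<close>
  define c :: real where "c = 1 / (2 * 4 ^ Lm)"
  show ?thesis
  proof (intro exI[of _ c] exI[of _ W] conjI allI impI)
    show "c > 0" by (simp add: c_def)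
    show "W \<ge> 1" by (simp add: W_def)
    fix N l Y v assume as: "of_scale N l v \<and> W \<le> l \<and> finite (set_pmf Y) \<and> nonsat eps m N Y"
    then have lN: "l < N" and fit: "\<And>i. \<bar>v$i\<bar> \<le> 2 ^ kap N l i" and Wl: "W \<le> l"
      and fin: "finite (set_pmf Y)" and ns: "nonsat eps m N Y" by (auto simp: of_scale_def)
    obtain L j n where L: "L \<le> Lm" "n + m \<le> l" "v$j \<noteq> 0"
      "\<bar>v$j\<bar> \<le> 2 ^ kap N (n + m) j" "2 ^ L * \<bar>v$j\<bar> \<le> 2 ^ kap N n j"
      "kap N n j - ch j - 1 \<le> L + log 2 \<bar>v$j\<bar>" "\<forall>i. i \<noteq> j \<longrightarrow> 2 ^ L * \<bar>v$i\<bar> \<le> 2 ^ kap N (n + m) i"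
    proof -
      have "of_scale N l v \<and> R \<le> l" using as by (simp add: W_def)
      then show thesis using LR[rule_format, of N l v] that by blast
    qed
    let ?k = "kap N (n + m)"
    have "H (map_pmf (coarsen (?k(j := kap N n j))) Y) - H (map_pmf (coarsen ?k) Y) + real L + log 2 \<bar>v$j\<bar> - ?k j - 1
      - ?d * (1 + log 2 5) \<le> 4 ^ L * gain (U ?k \<oplus> Y) v"
      using L fin by (intro gain_lower) (auto intro: kap_antimono)
    moreover have "H (map_pmf (coarsen ?k) Y) - H (map_pmf (coarsen (?k(j := kap N n j))) Y) \<le> (ch j - eps) * m"
      using ns L(2) lN unfolding nonsat_def by auto
    moreover have "real (kap N n j) - ?k j = real (lev j (n + m)) - lev j n"
      using L(2) lN by (simp add: kap_real)
    moreover have "ch j * m - 1 \<le> real (lev j (n + m)) - lev j n"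
      using lev_gt[of j "n + m"] lev_le[of j n] by (simp add: distrib_left)
    ultimately have "1 \<le> 4 ^ L * gain (U ?k \<oplus> Y) v"
      using L(6) m[of j] by (simp add: left_diff_distrib)
    also have "\<dots> \<le> 4 ^ Lm * gain (U (kap N l) \<oplus> Y) v"
      using L(1,2) fin by (intro mult_mono gain_kap_mono power_increasing gain_nonneg finite_conv finite_U) auto
    finally have big: "2 * c \<le> gain (U (kap N l) \<oplus> Y) v" by (simp add: c_def field_simps)
    have "gain (U (kap N (l - W)) \<oplus> Y) v \<le> gain (U (kap N (l - W))) v"
      using fin by (intro gain_conv_le finite_U)
    also have "\<dots> \<le> (\<Sum>i\<in>UNIV. real_of_int \<bar>v$i\<bar> / 2 ^ kap N (l - W) i)" by (rule gain_U_le)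
    also have "\<dots> \<le> (\<Sum>i\<in>(UNIV::'d set). c / ?d)"
    proof (rule sum_mono)
      fix i :: 'd
      have "real_of_int \<bar>v$i\<bar> \<le> real_of_int (2 ^ kap N l i)" using fit[of i] by (simp only: of_int_le_iff)
      then have "real_of_int \<bar>v$i\<bar> / 2 ^ kap N (l - W) i \<le> 2 ^ kap N l i / 2 ^ kap N (l - W) i"
        by (intro divide_right_mono) auto
      also have "\<dots> = 2 powr (real (kap N l i) - real (kap N (l - W) i))"
        by (simp add: powr_diff powr_realpow)
      also have "real (kap N l i) - real (kap N (l - W) i) = real (lev i (l - W)) - lev i l"
        using lN by (simp add: kap_real)
      also have "\<dots> \<le> 1 - ch i * W"
        using lev_gt[of i l] lev_le[of i "l - W"] Wl by (simp add: of_nat_diff right_diff_distrib)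
      also have "\<dots> \<le> - real (2 * Lm + 1 + ?d)"
      proof -
        have "2 * Lm + 2 + ?d \<le> ch i * W0" using W0[of i] ch_pos[of i] by (simp add: pos_divide_le_eq mult.commute)
        also have "\<dots> \<le> ch i * W" using ch_pos[of i] by (simp add: W_def)
        finally show ?thesis by simp
      qed
      finally have "real_of_int \<bar>v$i\<bar> / 2 ^ kap N (l - W) i \<le> 2 powr (- real (2 * Lm + 1 + ?d))" by simp
      also have "\<dots> = 1 / (2 ^ (2 * Lm + 1) * 2 ^ ?d)"
        by (simp only: powr_minus powr_realpow[OF zero_less_numeral] inverse_eq_divide power_add)
      also have "\<dots> = c / 2 ^ ?d" by (simp add: c_def power_mult)
      also have "\<dots> \<le> c / ?d" using less_exp[of ?d]
        by (intro divide_left_mono) (auto simp: c_def zero_less_card_finite of_nat_less_two_power less_imp_le)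
      finally show "real_of_int \<bar>v$i\<bar> / 2 ^ kap N (l - W) i \<le> c / ?d" .
    qed
    also have "\<dots> = c" by simp
    finally show "c \<le> gain (U (kap N l) \<oplus> Y) v - gain (U (kap N (l - W)) \<oplus> Y) v" using big by simp
  qed
qed

end

section \<open>Splitting a law into pairs of points\<close>

text \<open>The kernel gives the mass off the diagonal, and the diagonal is filled up until each row
  sums to \<open>pmf X x\<close>; the bound on the rows leaves room for this. By symmetry the
  columns have the same sums.\<close>

lemma symmetric_kernel_coupling:
  assumes fin: "finite (set_pmf X)"
    and nonneg: "\<And>x y. 0 \<le> k x y" and sym: "\<And>x y. x \<in> set_pmf X \<Longrightarrow> y \<in> set_pmf X \<Longrightarrow> k x y = k y x"
    and row: "\<And>x. x \<in> set_pmf X \<Longrightarrow> (\<Sum>y\<in>set_pmf X - {x}. k x y) \<le> pmf X x"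
  obtains W where "set_pmf W \<subseteq> set_pmf X \<times> set_pmf X" "map_pmf fst W = X" "map_pmf snd W = X"
    "\<And>x y. x \<in> set_pmf X \<Longrightarrow> y \<in> set_pmf X \<Longrightarrow> x \<noteq> y \<Longrightarrow> pmf W (x, y) = k x y"
proof -
  let ?S = "set_pmf X"
  define f where "f z = (if z \<notin> ?S \<times> ?S then 0 else if fst z \<noteq> snd z then k (fst z) (snd z)
    else pmf X (fst z) - (\<Sum>y\<in>?S - {fst z}. k (fst z) y))" for z
  have f0: "0 \<le> f z" for z using nonneg row[of "fst z"] by (auto simp: f_def)
  have row_f: "(\<Sum>y\<in>?S. f (x, y)) = pmf X x" if "x \<in> ?S" for x
  proof -
    have "(\<Sum>y\<in>?S. f (x, y)) = f (x, x) + (\<Sum>y\<in>?S - {x}. f (x, y))"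
      using fin that by (rule sum.remove)
    also have "(\<Sum>y\<in>?S - {x}. f (x, y)) = (\<Sum>y\<in>?S - {x}. k x y)"
      using that by (intro sum.cong) (auto simp: f_def)
    finally show ?thesis using that by (simp add: f_def)
  qed
  have f_sym: "f (x, y) = f (y, x)" for x y using sym by (auto simp: f_def)
  have "(\<integral>\<^sup>+z. ennreal (f z) \<partial>count_space UNIV) = (\<Sum>z\<in>?S \<times> ?S. ennreal (f z))"
    using fin by (intro nn_integral_count_space') (auto simp: f_def)
  also have "\<dots> = ennreal (\<Sum>z\<in>?S \<times> ?S. f z)" using f0 by (simp add: sum_ennreal)
  also have "(\<Sum>z\<in>?S \<times> ?S. f z) = (\<Sum>x\<in>?S. \<Sum>y\<in>?S. f (x, y))"
    by (simp add: sum.cartesian_product)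
  also have "\<dots> = 1" using sum_pmf_eq_1[OF fin, of X] by (simp add: row_f)
  finally have int: "(\<integral>\<^sup>+z. ennreal (f z) \<partial>count_space UNIV) = 1" by simp
  define W where "W = embed_pmf f"
  have pmfW: "pmf W z = f z" for z unfolding W_def by (rule pmf_embed_pmf[OF f0 int])
  have setW: "set_pmf W \<subseteq> ?S \<times> ?S" by (auto simp: set_pmf_iff pmfW f_def split: if_splits)
  then have finW: "finite (set_pmf W)" using fin finite_subset by blast
  have marg: "map_pmf h W = X" if h: "\<And>x. x \<in> ?S \<Longrightarrow> (\<Sum>z\<in>{z\<in>?S \<times> ?S. h z = x}. f z) = pmf X x"
    "h ` (?S \<times> ?S) \<subseteq> ?S" for h
  proof (rule pmf_eqI)
    fix x
    have "pmf (map_pmf h W) x = (\<Sum>z\<in>{z\<in>?S \<times> ?S. h z = x}. f z)"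
      unfolding pmf_map_sum[OF finW] pmfW using fin setW
      by (intro sum.mono_neutral_left) (auto simp: set_pmf_iff pmfW)
    moreover have "pmf (map_pmf h W) x = 0 \<and> pmf X x = 0" if "x \<notin> ?S"
      using that setW h(2) by (fastforce simp: pmf_eq_0_set_pmf)
    ultimately show "pmf (map_pmf h W) x = pmf X x" using h(1)[of x] by (cases "x \<in> ?S") auto
  qed
  show ?thesis
  proof
    show "set_pmf W \<subseteq> ?S \<times> ?S" by fact
    show "map_pmf fst W = X"
    proof (rule marg)
      fix x assume x: "x \<in> ?S"
      have "{z\<in>?S \<times> ?S. fst z = x} = Pair x ` ?S" using x by auto
      then show "(\<Sum>z\<in>{z\<in>?S \<times> ?S. fst z = x}. f z) = pmf X x"
        using row_f[OF x] by (simp add: sum.reindex inj_on_def)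
    qed auto
    show "map_pmf snd W = X"
    proof (rule marg)
      fix x assume x: "x \<in> ?S"
      have "{z\<in>?S \<times> ?S. snd z = x} = (\<lambda>y. (y, x)) ` ?S" using x by auto
      then show "(\<Sum>z\<in>{z\<in>?S \<times> ?S. snd z = x}. f z) = pmf X x"
        using row_f[OF x] by (simp add: sum.reindex inj_on_def f_sym[of _ x])
    qed auto
    show "pmf W (x, y) = k x y" if "x \<in> ?S" "y \<in> ?S" "x \<noteq> y" for x y
      using that by (simp add: pmfW f_def)
  qed
qed

text \<open>For \<open>r\<close> at least 1/2, \<open>- log 2 r\<close> is comparable with
  \<open>1 - r\<close>. For smaller \<open>r\<close> it splits as
  \<open>log 2 (1 / t) + log 2 (t / r)\<close>: the first summand is covered because
  \<open>1 - r\<close> exceeds 1/2, the second by \<open>ln x \<le> x\<close>. The last term is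
  affordable since \<open>1 / r\<close> has bounded mean.\<close>

lemma neg_log_le:
  assumes "0 < r" "r \<le> 1" "0 < t" "t < 1"
  shows "- log 2 r \<le> 3 * (1 + log 2 (1 / t)) * (1 - r) + 3 * (t / r)"
proof -
  have l2: "2/3 \<le> ln (2::real)" by (rule ln2_ge_two_thirds)
  have lt: "0 \<le> log 2 (1 / t)" using assms by simp
  have tr: "0 < t / r" using assms by simp
  show ?thesis
  proof (cases "r \<ge> 1 / 2")
    case True
    have "- ln r = ln (1 / r)" using assms by (simp add: ln_div)
    also have "\<dots> \<le> 1 / r - 1" using assms by (intro ln_le_minus_one) simp
    also have "\<dots> = (1 - r) * (1 / r)" using assms by (simp add: field_simps)
    also have "\<dots> \<le> (1 - r) * 2" using assms True by (intro mult_left_mono) (auto simp: field_simps)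
    finally have "- ln r / ln 2 \<le> (1 - r) * 2 / ln 2" by (intro divide_right_mono) auto
    also have "\<dots> \<le> (1 - r) * 2 / (2/3)" using l2 assms by (intro divide_left_mono) auto
    also have "\<dots> = 3 * (1 - r)" by simp
    finally have "- ln r / ln 2 \<le> 3 * (1 - r)" .
    then have "- log 2 r \<le> 3 * 1 * (1 - r)" by (simp add: log_def)
    also have "\<dots> \<le> 3 * (1 + log 2 (1 / t)) * (1 - r)" using lt assms by (intro mult_right_mono) auto
    finally show ?thesis using tr by linarith
  next
    case False
    have "ln (t / r) \<le> t / r" using ln_le_minus_one[OF tr] by linarith
    then have "ln (t / r) / ln 2 \<le> t / r / ln 2" by (intro divide_right_mono) auto
    also have "\<dots> \<le> t / r / (2/3)" using l2 tr by (intro divide_left_mono) auto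
    finally have "log 2 (t / r) \<le> 3 * (t / r)" using tr by (simp add: log_def)
    moreover have "- log 2 r = log 2 (1 / t) + log 2 (t / r)" using assms by (simp add: log_divide)
    moreover have "log 2 (1 / t) \<le> 3 * (1 + log 2 (1 / t)) * (1 - r)"
    proof -
      have "(1 + log 2 (1 / t)) * 1 \<le> (1 + log 2 (1 / t)) * (3 * (1 - r))"
        using lt False by (intro mult_left_mono) auto
      also have "\<dots> = 3 * (1 + log 2 (1 / t)) * (1 - r)" by (simp only: mult_ac)
      finally show ?thesis by simp
    qed
    ultimately show ?thesis by linarith
  qed
qed

text \<open>A difference with lag \<open>W\<close> is a sum of \<open>W\<close> unit differences,
  each of which telescopes over \<open>l\<close>. Starting at \<open>a + W\<close> or later keeps
  all arguments at \<open>a\<close> or above.\<close>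

lemma sum_lag_le:
  fixes G :: "nat \<Rightarrow> real"
  assumes mono: "\<And>l l'. a \<le> l \<Longrightarrow> l \<le> l' \<Longrightarrow> l' \<le> N \<Longrightarrow> G l \<le> G l'"
    and "a + W \<le> b" "a \<le> N"
  shows "(\<Sum>l=b..<N. G l - G (l - W)) \<le> W * (G N - G a)"
  using \<open>a + W \<le> b\<close>
proof (induction W)
  case (Suc W)
  have "(\<Sum>l=b..<N. G l - G (l - Suc W)) = (\<Sum>l=b..<N. (G l - G (l - W)) + (G (Suc l - Suc W) - G (l - Suc W)))"
    by (intro sum.cong) auto
  also have "\<dots> = (\<Sum>l=b..<N. G l - G (l - W)) + (\<Sum>l=b..<N. G (Suc l - Suc W) - G (l - Suc W))"
    by (rule sum.distrib)
  also have "(\<Sum>l=b..<N. G (Suc l - Suc W) - G (l - Suc W)) \<le> G N - G a"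
  proof (cases "b \<le> N")
    case True
    have "(\<Sum>l=b..<N. G (Suc l - Suc W) - G (l - Suc W)) = G (N - Suc W) - G (b - Suc W)"
      using sum_Suc_diff'[OF True, of "\<lambda>l. G (l - Suc W)"] by simp
    also have "\<dots> \<le> G N - G a" using True Suc.prems by (intro diff_mono mono) auto
    finally show ?thesis .
  next
    case False
    then show ?thesis using mono[of a N] \<open>a \<le> N\<close> by simp
  qed
  finally show ?case using Suc by (simp add: algebra_simps)
qed simp

section \<open>Nested cells and the entropy gained from one level to the next\<close>

context levels
begin

abbreviation cell :: "nat \<Rightarrow> nat \<Rightarrow> int^'d \<Rightarrow> int^'d" where
  "cell N n \<equiv> coarsen (kap N n)"

lemma coarsen_coarsen:
  assumes "\<And>j. k j \<le> k' j"
  shows "coarsen k' x = coarsen (\<lambda>j. k' j - k j) (coarsen k x)"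
proof -
  have "x$j div 2 ^ k' j = x$j div 2 ^ k j div 2 ^ (k' j - k j)" for j
    using assms[of j] zdiv_zmult2_eq[of "2 ^ (k' j - k j)" "x$j" "2 ^ k j"]
    by (simp add: power_add[symmetric])
  then show ?thesis by (simp add: coarsen_def vec_eq_iff)
qed

lemma cell_cell: "n \<le> n' \<Longrightarrow> cell N n x = coarsen (\<lambda>j. kap N n j - kap N n' j) (cell N n' x)"
  by (intro coarsen_coarsen kap_antimono)

lemma cell_eq_mono: "n \<le> n' \<Longrightarrow> cell N n' x = cell N n' y \<Longrightarrow> cell N n x = cell N n y"
  by (simp add: cell_cell[of n n'])

lemma kap_self: "kap N N j = 0"
  by (simp add: kap_def)

lemma cell_self: "cell N N x = x"
  by (simp add: coarsen_def kap_self vec_eq_iff)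

text \<open>A bound, uniform in the level, for the number of subcells of a cell. The
  \<open>+ 1\<close> in each exponent is there because consecutive values of \<open>lev j\<close>
  can differ by more than \<open>ch j\<close> through rounding.\<close>

definition subcell_bound :: nat where "subcell_bound = 2 ^ (\<Sum>j\<in>UNIV. nat \<lceil>ch j\<rceil> + 1)"

lemma lev_Suc_le: "lev j (n + 1) - lev j n \<le> nat \<lceil>ch j\<rceil> + 1"
proof -
  have "real (lev j (n + 1)) < real (lev j n) + ch j + 1"
    using lev_le[of j "n + 1"] lev_gt[of j n] by (simp add: distrib_left)
  then show ?thesis using ch_pos[of j] by linarith
qed

lemma card_subcells:
  assumes "n < N"
  shows "card (cell N (n + 1) ` {y\<in>A. cell N n y = cell N n x}) \<le> subcell_bound"
proof -
  let ?\<delta> = "\<lambda>j. kap N n j - kap N (n + 1) j"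
  let ?S = "\<lambda>j. {cell N n x $ j * 2 ^ ?\<delta> j ..< (cell N n x $ j + 1) * 2 ^ ?\<delta> j}"
  have "cell N (n + 1) ` {y\<in>A. cell N n y = cell N n x} \<subseteq> {z. \<forall>j. z$j \<in> ?S j}"
  proof clarify
    fix y j assume "cell N n y = cell N n x"
    then have "cell N n x = coarsen ?\<delta> (cell N (n + 1) y)" using cell_cell[of n "n + 1" N y] by simp
    then have "cell N n x $ j = cell N (n + 1) y $ j div 2 ^ ?\<delta> j" unfolding coarsen_def[of ?\<delta>] by simp
    moreover have "z div p * p \<le> z \<and> z < (z div p + 1) * p" if "0 < p" for z p :: int
      using div_mult_mod_eq[of z p] pos_mod_sign[OF that, of z] pos_mod_bound[OF that, of z]
      unfolding distrib_right by linarith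
    ultimately show "cell N (n + 1) y $ j \<in> ?S j" by auto
  qed
  then have "card (cell N (n + 1) ` {y\<in>A. cell N n y = cell N n x}) \<le> card {z::int^'d. \<forall>j. z$j \<in> ?S j}"
    by (intro card_mono finite_vec_set) auto
  also have "\<dots> = 2 ^ (\<Sum>j\<in>UNIV. ?\<delta> j)"
    unfolding card_vec_set by (simp add: distrib_right nat_power_eq power_sum)
  also have "\<dots> \<le> subcell_bound" unfolding subcell_bound_def
  proof (intro power_increasing sum_mono)
    fix j
    have "?\<delta> j \<le> lev j (n + 1) - lev j n" by (auto simp: kap_def)
    then show "?\<delta> j \<le> nat \<lceil>ch j\<rceil> + 1" using lev_Suc_le[of j n] by linarith
  qed simp
  finally show ?thesis .
qed

definition mass :: "nat \<Rightarrow> (int^'d) pmf \<Rightarrow> nat \<Rightarrow> int^'d \<Rightarrow> real" where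
  "mass N X n x = pmf (map_pmf (cell N n) X) (cell N n x)"

text \<open>With y drawn from \<open>X\<close> conditioned on the level \<open>n\<close> cell of x,
  this is the probability that x and y lie in different cells of level \<open>n + 1\<close>.\<close>

definition split_prob :: "nat \<Rightarrow> (int^'d) pmf \<Rightarrow> nat \<Rightarrow> real" where
  "split_prob N X n = (\<Sum>x\<in>set_pmf X. pmf X x * (1 - mass N X (n + 1) x / mass N X n x))"

lemma mass_pos: "x \<in> set_pmf X \<Longrightarrow> 0 < mass N X n x"
  unfolding mass_def by (rule pmf_map_pos)

lemma mass_sum: "finite (set_pmf X) \<Longrightarrow> mass N X n x = (\<Sum>y\<in>{y\<in>set_pmf X. cell N n y = cell N n x}. pmf X y)"
  unfolding mass_def by (rule pmf_map_sum)

lemma mass_antimono: "finite (set_pmf X) \<Longrightarrow> mass N X (n + 1) x \<le> mass N X n x"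
  unfolding mass_sum by (intro sum_mono2) (auto intro: cell_eq_mono[of n "n + 1"])

text \<open>The difference is the mean of \<open>- log 2 r\<close>, where \<open>r\<close> is the
  conditional probability of the subcell. In the bound of \<open>neg_log_le\<close> the mean of
  \<open>1 - r\<close> is the splitting probability, and the mean of \<open>1 / r\<close> is at most
  the number of subcells.\<close>

lemma H_level_step:
  assumes fin: "finite (set_pmf X)" and "n < N" and t: "0 < t" "t < 1"
  shows "H (map_pmf (cell N (n + 1)) X) - H (map_pmf (cell N n) X)
    \<le> 3 * (1 + log 2 (1 / t)) * split_prob N X n + 3 * t * subcell_bound"
proof -
  let ?S = "set_pmf X" and ?r = "\<lambda>x. mass N X (n + 1) x / mass N X n x"
  have r: "0 < ?r x" "?r x \<le> 1" if "x \<in> ?S" for x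
    using mass_pos[OF that] mass_antimono[OF fin, of N n x] by (simp_all add: divide_le_eq_1)
  have "H (map_pmf (cell N (n + 1)) X) - H (map_pmf (cell N n) X) =
      (\<Sum>x\<in>?S. pmf X x * log 2 (mass N X n x) - pmf X x * log 2 (mass N X (n + 1) x))"
    unfolding H_map[OF fin] mass_def by (simp add: sum_subtractf)
  also have "\<dots> = (\<Sum>x\<in>?S. pmf X x * (- log 2 (?r x)))"
  proof (intro sum.cong refl)
    fix x assume "x \<in> ?S"
    then show "pmf X x * log 2 (mass N X n x) - pmf X x * log 2 (mass N X (n + 1) x) = pmf X x * (- log 2 (?r x))"
      using mass_pos[of x X N n] mass_pos[of x X N "n + 1"] by (simp add: log_divide algebra_simps)
  qed
  also have "\<dots> \<le> (\<Sum>x\<in>?S. pmf X x * (3 * (1 + log 2 (1 / t)) * (1 - ?r x) + 3 * (t / ?r x)))"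
    by (intro sum_mono mult_left_mono neg_log_le r t) auto
  also have "\<dots> = (\<Sum>x\<in>?S. 3 * (1 + log 2 (1 / t)) * (pmf X x * (1 - ?r x)) + 3 * t * (pmf X x * (1 / ?r x)))"
    by (intro sum.cong refl) (simp only: distrib_left, simp add: mult_ac)
  also have "\<dots> = 3 * (1 + log 2 (1 / t)) * split_prob N X n + 3 * t * (\<Sum>x\<in>?S. pmf X x * (1 / ?r x))"
    unfolding sum.distrib sum_distrib_left[symmetric] split_prob_def by simp
  also have "(\<Sum>x\<in>?S. pmf X x * (1 / ?r x)) \<le> subcell_bound"
  proof -
    let ?f = "cell N (n + 1)" and ?g = "cell N n"
    have eq: "pmf (map_pmf (\<lambda>w. (?f w, ?g w)) X) (?f x, ?g x) = mass N X (n + 1) x" for x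
    proof -
      have "(\<lambda>w. (?f w, ?g w)) -` {(?f x, ?g x)} = ?f -` {?f x}"
      proof (rule set_eqI)
        show "w \<in> (\<lambda>w. (?f w, ?g w)) -` {(?f x, ?g x)} \<longleftrightarrow> w \<in> ?f -` {?f x}" for w
          using cell_eq_mono[of n "n + 1" N w x] by auto
      qed
      then show ?thesis by (simp add: mass_def pmf_map)
    qed
    have "(\<Sum>x\<in>?S. pmf X x * (1 / ?r x)) = (\<Sum>x\<in>?S. pmf X x * (pmf (map_pmf ?g X) (?g x) /
        pmf (map_pmf (\<lambda>w. (?f w, ?g w)) X) (?f x, ?g x)))"
      unfolding eq by (simp add: mass_def)
    also have "\<dots> \<le> subcell_bound" by (intro sum_pmf_ratio_le fin card_subcells \<open>n < N\<close>)
    finally show ?thesis .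
  qed
  finally show ?thesis using t by (simp add: mult_left_mono)
qed

lemma H_levels:
  assumes fin: "finite (set_pmf X)" and "a \<le> N" and t: "0 < t" "t < 1"
  shows "H X - H (map_pmf (cell N a) X)
    \<le> 3 * (1 + log 2 (1 / t)) * (\<Sum>n=a..<N. split_prob N X n) + 3 * t * subcell_bound * (real N - real a)"
proof -
  have "cell N N = (\<lambda>x. x)" by (simp add: fun_eq_iff cell_self)
  then have "H X - H (map_pmf (cell N a) X) = (\<Sum>n=a..<N. H (map_pmf (cell N (Suc n)) X) - H (map_pmf (cell N n) X))"
    using sum_Suc_diff'[OF \<open>a \<le> N\<close>, of "\<lambda>n. H (map_pmf (cell N n) X)"] by simp
  also have "\<dots> \<le> (\<Sum>n=a..<N. 3 * (1 + log 2 (1 / t)) * split_prob N X n + 3 * t * subcell_bound)"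
    using H_level_step[OF fin _ t] by (intro sum_mono) auto
  also have "\<dots> = 3 * (1 + log 2 (1 / t)) * (\<Sum>n=a..<N. split_prob N X n) + 3 * t * subcell_bound * (real N - real a)"
    using \<open>a \<le> N\<close> by (simp add: sum.distrib sum_distrib_left[symmetric] of_nat_diff)
  finally show ?thesis .
qed

section \<open>Pairs separated at a level, and the scale of their difference\<close>

definition split_at :: "nat \<Rightarrow> nat \<Rightarrow> nat \<Rightarrow> int^'d \<Rightarrow> int^'d \<Rightarrow> bool" where
  "split_at N l n x y \<longleftrightarrow> cell N n x = cell N n y \<and> cell N (n + 1) x \<noteq> cell N (n + 1) y \<and> of_scale N l (y - x)"

lemma of_scale_uminus: "of_scale N l (y - x) \<longleftrightarrow> of_scale N l (x - y)"
  by (simp add: of_scale_def abs_minus_commute)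

lemma split_at_sym: "split_at N l n x y \<longleftrightarrow> split_at N l n y x"
  unfolding split_at_def using of_scale_uminus by metis

lemma cell_eq_dist:
  assumes "cell N n x = cell N n y"
  shows "\<bar>(y - x)$i\<bar> < 2 ^ kap N n i"
proof -
  let ?p = "2 ^ kap N n i :: int"
  have "x$i div ?p = y$i div ?p" using assms by (simp add: coarsen_def vec_eq_iff)
  then have "x$i = y$i div ?p * ?p + x$i mod ?p" using div_mult_mod_eq[of "x$i" ?p] by simp
  moreover have "y$i = y$i div ?p * ?p + y$i mod ?p" by (rule div_mult_mod_eq[symmetric])
  moreover have "0 \<le> x$i mod ?p" "x$i mod ?p < ?p" "0 \<le> y$i mod ?p" "y$i mod ?p < ?p" by simp_all
  ultimately show ?thesis unfolding vector_minus_component by linarith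
qed

text \<open>The finest admissible level whose cells are as large as the difference in every
  coordinate. If it is \<open>N - 1\<close>, the lower bound holds because cells of level
  \<open>N\<close> have side 1 and distinct lattice points differ by at least 1.\<close>

lemma exists_scale:
  assumes "n < N" "cell N n x = cell N n y" "x \<noteq> y"
  shows "\<exists>l. n \<le> l \<and> of_scale N l (y - x)"
proof -
  let ?fit = "\<lambda>l. l < N \<and> (\<forall>i. \<bar>(y - x)$i\<bar> \<le> 2 ^ kap N l i)"
  have fn: "?fit n" using cell_eq_dist[OF assms(2)] assms(1) by (auto intro: less_imp_le)
  define l where "l = (GREATEST l. ?fit l)"
  have l: "?fit l" unfolding l_def by (rule GreatestI_nat[of ?fit n N]) (use fn in auto)
  have "n \<le> l" unfolding l_def by (rule Greatest_le_nat[of ?fit n N]) (use fn in auto)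
  moreover have "\<exists>i. 2 ^ kap N (l + 1) i \<le> \<bar>(y - x)$i\<bar>"
  proof (cases "l + 1 < N")
    case True
    have "\<not> ?fit (l + 1)"
    proof
      assume "?fit (l + 1)"
      then have "l + 1 \<le> l" unfolding l_def by (intro Greatest_le_nat[of ?fit _ N]) auto
      then show False by simp
    qed
    then show ?thesis using True by (auto simp: not_le intro: less_imp_le)
  next
    case False
    then have "l + 1 = N" using l by simp
    moreover obtain i where "x$i \<noteq> y$i" using \<open>x \<noteq> y\<close> by (auto simp: vec_eq_iff)
    then have "1 \<le> \<bar>(y - x)$i\<bar>" by simp
    ultimately show ?thesis by (intro exI[of _ i]) (simp add: kap_self)
  qed
  ultimately show ?thesis using l by (auto simp: of_scale_def)
qed

lemma split_at_le: "split_at N l n x y \<Longrightarrow> n \<le> l"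
proof (rule ccontr)
  assume s: "split_at N l n x y" and "\<not> n \<le> l"
  then obtain i where "2 ^ kap N (l + 1) i \<le> \<bar>(y - x)$i\<bar>" by (auto simp: split_at_def of_scale_def)
  also have "\<dots> < 2 ^ kap N n i" using s by (intro cell_eq_dist) (simp add: split_at_def)
  also have "\<dots> \<le> 2 ^ kap N (l + 1) i" using \<open>\<not> n \<le> l\<close> by (intro power_increasing kap_antimono) auto
  finally show False by simp
qed

text \<open>The left end of the cell of side \<open>2 ^ b\<close> that contains the larger point
  lies between the two points. If it were a multiple of \<open>2 ^ a\<close>, the grid of step
  \<open>2 ^ a\<close> would separate them as well.\<close>

lemma boundary_point:
  fixes x y :: int
  assumes "x div 2 ^ a = y div 2 ^ a" "x div 2 ^ b \<noteq> y div 2 ^ b" "\<bar>y - x\<bar> \<le> 2 ^ e"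
  shows "\<exists>z. 2 ^ b dvd z \<and> \<not> 2 ^ a dvd z \<and> \<bar>x - z\<bar> \<le> 2 ^ e"
proof -
  have *: "\<exists>z. 2 ^ b dvd z \<and> \<not> 2 ^ a dvd z \<and> x < z \<and> z \<le> y"
    if "x div 2 ^ a = y div 2 ^ a" "x div 2 ^ b < y div 2 ^ b" for x y :: int
  proof (intro exI conjI)
    let ?z = "y div 2 ^ b * 2 ^ b"
    show "2 ^ b dvd ?z" by simp
    have "0 \<le> y mod 2 ^ b" by simp
    then show zy: "?z \<le> y" using div_mult_mod_eq[of y "2 ^ b"] by linarith
    show xz: "x < ?z"
    proof (rule ccontr)
      assume "\<not> x < ?z"
      then have "?z div 2 ^ b \<le> x div 2 ^ b" by (intro zdiv_mono1) auto
      then show False using that by simp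
    qed
    show "\<not> 2 ^ a dvd ?z"
    proof
      assume "2 ^ a dvd ?z"
      then obtain c where c: "?z = c * 2 ^ a" by (auto simp: dvd_def mult.commute)
      have "?z div 2 ^ a \<le> y div 2 ^ a" using zy by (intro zdiv_mono1) auto
      then have "c \<le> x div 2 ^ a" using that unfolding c by simp
      then have "c * 2 ^ a \<le> x div 2 ^ a * 2 ^ a" by (intro mult_right_mono) auto
      also have "\<dots> \<le> x"
      proof -
        have "0 \<le> x mod 2 ^ a" by simp
        then show ?thesis using div_mult_mod_eq[of x "2 ^ a"] by linarith
      qed
      finally show False using xz c by simp
    qed
  qed
  show ?thesis
  proof (cases "x div 2 ^ b < y div 2 ^ b")
    case True
    from *[OF assms(1) True] assms(3) show ?thesis by auto
  next
    case False
    from *[of y x] False assms obtain z where "2 ^ b dvd z" "\<not> 2 ^ a dvd z" "y < z" "z \<le> x" by auto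
    then show ?thesis using assms(3) by (intro exI[of _ z]) auto
  qed
qed

text \<open>Boundary points of the dyadic grids that are new at distinct coarse levels are far apart,
so a given point is close to few of them.\<close>

lemma card_split_levels:
  "\<exists>Mc\<ge>1. \<forall>N l x. card {n. \<exists>y. split_at N l n x y} \<le> Mc"
proof -
  \<comment> \<open>\<open>K1\<close> levels add at least 3 digits in every coordinate before
    rounding, hence at least 2 after it: a factor 4 in the side length.\<close>
  obtain K1 :: nat where K1: "\<And>i. 3 / ch i \<le> real K1"
    using nat_bound_finite[of "\<lambda>i. 3 / ch i"] by auto
  have drop: "kap N l i + 2 \<le> kap N n i" if "n + K1 \<le> l" "l < N" for N l n i
  proof -
    have "3 \<le> ch i * K1" using K1[of i] ch_pos[of i] by (simp add: pos_divide_le_eq mult.commute)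
    moreover have "ch i * n + ch i * K1 \<le> ch i * l"
      using that(1) ch_pos[of i] unfolding distrib_left[symmetric] by (intro mult_left_mono) auto
    ultimately have "real (lev i n) + 2 < real (lev i l)" using lev_gt[of i l] lev_le[of i n] by linarith
    moreover have "real (kap N l i) = real (lev i N) - real (lev i l)" "real (kap N n i) = real (lev i N) - real (lev i n)"
      using that by (simp_all add: kap_real)
    ultimately show ?thesis by linarith
  qed
  have one: "card {n. n + 1 + K1 \<le> l \<and> (\<exists>y. split_at N l n x y \<and> cell N (n + 1) x $ i \<noteq> cell N (n + 1) y $ i)} \<le> 1"
    (is "card (?T i) \<le> 1") for N l x i
  proof (rule ccontr)
    assume "\<not> ?thesis"
    moreover have finT: "finite (?T i)" by (rule finite_subset[of _ "{..l}"]) auto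
    ultimately obtain n n' where nn: "n \<in> ?T i" "n' \<in> ?T i" "n \<noteq> n'"
      using card_le_Suc0_iff_eq[OF finT] unfolding One_nat_def by blast
    have contra: "False" if n: "n \<in> ?T i" "n' \<in> ?T i" "n < n'" for n n'
    proof -
      have bp: "\<exists>z. 2 ^ kap N (n + 1) i dvd z \<and> \<not> 2 ^ kap N n i dvd z \<and> \<bar>x$i - z\<bar> \<le> 2 ^ kap N l i"
        if n: "n \<in> ?T i" for n
      proof -
        from n obtain y where y: "split_at N l n x y" "cell N (n + 1) x $ i \<noteq> cell N (n + 1) y $ i" by auto
        then have "cell N n x $ i = cell N n y $ i" "\<bar>(y - x)$i\<bar> \<le> 2 ^ kap N l i"
          unfolding split_at_def of_scale_def by auto
        then show ?thesis using y(2) by (intro boundary_point[of _ _ "y$i"]) (auto simp: coarsen_def)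
      qed
      obtain z where z: "2 ^ kap N (n + 1) i dvd z" "\<not> 2 ^ kap N n i dvd z" "\<bar>x$i - z\<bar> \<le> 2 ^ kap N l i"
        using bp[OF n(1)] by blast
      obtain z' where z': "2 ^ kap N (n' + 1) i dvd z'" "\<not> 2 ^ kap N n' i dvd z'" "\<bar>x$i - z'\<bar> \<le> 2 ^ kap N l i"
        using bp[OF n(2)] by blast
      have "l < N" using n(1) by (auto simp: split_at_def of_scale_def)
      have "kap N l i + 2 \<le> kap N (n' + 1) i" using n(2) \<open>l < N\<close> by (intro drop) auto
      then have "(2::int) ^ (kap N l i + 2) \<le> 2 ^ kap N (n' + 1) i" by (intro power_increasing) auto
      then have small: "4 * (2::int) ^ kap N l i \<le> 2 ^ kap N (n' + 1) i" by (simp add: power_add)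
      have "(2::int) ^ kap N (n' + 1) i dvd 2 ^ kap N n' i" "(2::int) ^ kap N n' i dvd 2 ^ kap N (n + 1) i"
        using n(3) by (auto intro!: le_imp_power_dvd kap_antimono)
      then have d: "2 ^ kap N n' i dvd z" "2 ^ kap N (n' + 1) i dvd z" using z(1) by (blast intro: dvd_trans)+
      have "2 ^ kap N (n' + 1) i dvd z - z'" using d(2) z'(1) by simp
      moreover have "\<bar>z - z'\<bar> \<le> 2 * 2 ^ kap N l i" using z(3) z'(3) by linarith
      moreover have "(0::int) < 2 ^ kap N l i" by simp
      \<comment> \<open>Both points are multiples of the side at level \<open>n' + 1\<close>, which
        is larger than their distance, so they coincide. But \<open>z\<close> lies on the grid of
        level \<open>n'\<close> and \<open>z'\<close> does not.\<close>
      ultimately have "z - z' = 0" using small dvd_imp_le_int[of "z - z'" "2 ^ kap N (n' + 1) i"] by fastforce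
      then show False using d(1) z'(2) by simp
    qed
    show False using contra[OF nn(1,2)] contra[OF nn(2,1)] nn(3) by linarith
  qed
  show ?thesis
  \<comment> \<open>The levels from \<open>l - K1\<close> to \<open>l\<close>, and at most one
    coarser level for each coordinate.\<close>
  proof (intro exI[of _ "K1 + 1 + CARD('d)"] conjI allI)
    fix N l x
    let ?A = "{n. \<exists>y. split_at N l n x y}"
    let ?T = "\<lambda>i. {n. n + 1 + K1 \<le> l \<and> (\<exists>y. split_at N l n x y \<and> cell N (n + 1) x $ i \<noteq> cell N (n + 1) y $ i)}"
    have finT: "finite (?T i)" for i by (rule finite_subset[of _ "{..l}"]) auto
    have "?A \<subseteq> {l - K1..l} \<union> (\<Union>i. ?T i)"
    proof
      fix n assume "n \<in> ?A"
      then obtain y where y: "split_at N l n x y" by auto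
      show "n \<in> {l - K1..l} \<union> (\<Union>i. ?T i)"
      proof (cases "l \<le> n + K1")
        case True
        then show ?thesis using split_at_le[OF y] by auto
      next
        case False
        obtain i where "cell N (n + 1) x $ i \<noteq> cell N (n + 1) y $ i"
          using y by (auto simp: split_at_def vec_eq_iff)
        then have "n \<in> ?T i" using False y by auto
        then show ?thesis by blast
      qed
    qed
    then have "card ?A \<le> card ({l - K1..l} \<union> (\<Union>i. ?T i))" using finT by (intro card_mono) auto
    moreover have "card ({l - K1..l} \<union> (\<Union>i. ?T i)) \<le> card {l - K1..l} + card (\<Union>i. ?T i)" by (rule card_Un_le)
    moreover have "card (\<Union>i. ?T i) \<le> (\<Sum>i\<in>UNIV. card (?T i))" by (rule card_UN_le) simp
    moreover have "(\<Sum>i\<in>UNIV. card (?T i)) \<le> (\<Sum>i\<in>(UNIV::'d set). 1)" by (intro sum_mono one)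
    moreover have "card {l - K1..l} \<le> K1 + 1" by simp
    ultimately show "card ?A \<le> K1 + 1 + CARD('d)" by simp
  qed simp
qed

text \<open>\<open>Q l\<close> is the weight, over all levels, of the resampled pairs of scale
  \<open>l\<close>, so the splitting probabilities sum to at most the sum of \<open>Q\<close>. A
  coupling of X with itself charges these pairs up to the factor \<open>Mc\<close>, and concavity
  turns the gain of each pair into \<open>c * Q l \<le> Mc * (G l - G (l - W))\<close>.\<close>

lemma sum_split_prob_le:
  assumes m: "\<And>j. ch j + 4 + CARD('d) * (1 + log 2 5) \<le> eps * m"
  shows "\<exists>C>0. \<forall>N a X Y. a \<le> N \<and> finite (set_pmf X) \<and> finite (set_pmf Y) \<and> nonsat eps m N Y \<longrightarrow>
    (\<Sum>n=a..<N. split_prob N X n) \<le> C * (1 + ((H (X \<oplus> Y) - H Y)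
       - (H (X \<oplus> (U (kap N a) \<oplus> Y)) - H (U (kap N a) \<oplus> Y))))"
proof -
  obtain c W where c: "c > 0" "W \<ge> 1" and gain: "\<And>N l Y v. of_scale N l v \<Longrightarrow> W \<le> l \<Longrightarrow> finite (set_pmf Y)
      \<Longrightarrow> nonsat eps m N Y \<Longrightarrow> c \<le> gain (U (kap N l) \<oplus> Y) v - gain (U (kap N (l - W)) \<oplus> Y) v"
    using gain_at_scale[OF m] by blast
  obtain Mc :: nat where Mc: "Mc \<ge> 1" "\<And>N l x. card {n. \<exists>y. split_at N l n x y} \<le> Mc"
    using card_split_levels by blast
  \<comment> \<open>The first \<open>W\<close> scales, where the lag would reach below
    \<open>a\<close>, contribute at most \<open>Mc\<close> each; the others contribute at most
    \<open>Mc * W / c\<close> times the total increment of \<open>G\<close>.\<close>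
  define C where "C = W * Mc + Mc * W / c"
  show ?thesis
  proof (intro exI[of _ C] conjI allI impI)
    show "C > 0" using c Mc by (simp add: C_def add_pos_nonneg)
    fix N a and X Y :: "(int^'d) pmf"
    assume as: "a \<le> N \<and> finite (set_pmf X) \<and> finite (set_pmf Y) \<and> nonsat eps m N Y"
    then have aN: "a \<le> N" and finX: "finite (set_pmf X)" and finY: "finite (set_pmf Y)" and ns: "nonsat eps m N Y"
      by auto
    let ?S = "set_pmf X"
    \<comment> \<open>The joint weight of a point and its resampled partner, on pairs in a common
      level \<open>n\<close> cell. There it is symmetric, because both points see the same
      mass.\<close>
    define w where "w n x y = pmf X x * pmf X y / mass N X n x" for n x y
    define f where "f l n x y = (if split_at N l n x y then w n x y else 0)" for l n x y
    define Q where "Q l = (\<Sum>n=a..<N. \<Sum>x\<in>?S. \<Sum>y\<in>?S. f l n x y)" for l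
    \<comment> \<open>One level contributes at most \<open>pmf X x\<close> to the row of
      \<open>x\<close>, and at most \<open>Mc\<close> levels contribute for a given
      \<open>l\<close>. Dividing by \<open>Mc\<close> makes the rows admissible for a
      coupling.\<close>
    define k where "k l x y = (\<Sum>n=a..<N. f l n x y) / Mc" for l x y
    define G where "G l = H (X \<oplus> (U (kap N l) \<oplus> Y)) - H (U (kap N l) \<oplus> Y)" for l
    have w0: "0 \<le> w n x y" for n x y by (simp add: w_def mass_def)
    have f0: "0 \<le> f l n x y" for l n x y by (simp add: f_def w0)
    have k0: "0 \<le> k l x y" for l x y by (simp add: k_def sum_nonneg f0)
    have Q_k: "Q l = Mc * (\<Sum>x\<in>?S. \<Sum>y\<in>?S. k l x y)" for l
    proof -
      have "Q l = (\<Sum>x\<in>?S. \<Sum>n=a..<N. \<Sum>y\<in>?S. f l n x y)" unfolding Q_def by (rule sum.swap)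
      also have "\<dots> = (\<Sum>x\<in>?S. \<Sum>y\<in>?S. \<Sum>n=a..<N. f l n x y)" by (rule sum.cong[OF refl]) (rule sum.swap)
      also have "\<dots> = Mc * (\<Sum>x\<in>?S. \<Sum>y\<in>?S. k l x y)"
        using Mc(1) unfolding sum_distrib_left by (intro sum.cong refl) (simp add: k_def)
      finally show ?thesis .
    qed
    have split_le: "split_prob N X n \<le> (\<Sum>l=a..<N. \<Sum>x\<in>?S. \<Sum>y\<in>?S. f l n x y)" if n: "n \<in> {a..<N}" for n
    proof -
      have "split_prob N X n = (\<Sum>x\<in>?S. \<Sum>y\<in>?S. if cell N n x = cell N n y \<and> cell N (n + 1) x \<noteq> cell N (n + 1) y then w n x y else 0)"
        unfolding split_prob_def
      proof (intro sum.cong refl)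
        fix x assume x: "x \<in> ?S"
        let ?A = "{y\<in>?S. cell N n y = cell N n x}" and ?B = "{y\<in>?S. cell N (n + 1) y = cell N (n + 1) x}"
        have "?B \<subseteq> ?A"
        proof (rule subsetI)
          show "y \<in> ?A" if "y \<in> ?B" for y using that cell_eq_mono[of n "n + 1" N y x] by auto
        qed
        then have "mass N X n x - mass N X (n + 1) x = (\<Sum>y\<in>?A - ?B. pmf X y)"
          unfolding mass_sum[OF finX] using finX by (subst sum_diff) auto
        also have "\<dots> = (\<Sum>y\<in>?S. if cell N n x = cell N n y \<and> cell N (n + 1) x \<noteq> cell N (n + 1) y then pmf X y else 0)"
          using finX by (intro sum.mono_neutral_cong_left) auto
        finally have d: "mass N X n x - mass N X (n + 1) x = \<dots>" .
        have "pmf X x * (1 - mass N X (n + 1) x / mass N X n x) = pmf X x / mass N X n x * (mass N X n x - mass N X (n + 1) x)"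
          using mass_pos[OF x, of N n] by (simp add: field_simps)
        then show "pmf X x * (1 - mass N X (n + 1) x / mass N X n x) = (\<Sum>y\<in>?S. if cell N n x = cell N n y \<and> cell N (n + 1) x \<noteq> cell N (n + 1) y then w n x y else 0)"
          unfolding d sum_distrib_left by (simp add: w_def if_distrib cong: if_cong)
      qed
      also have "\<dots> \<le> (\<Sum>x\<in>?S. \<Sum>y\<in>?S. \<Sum>l=a..<N. f l n x y)"
      proof (intro sum_mono)
        fix x y
        show "(if cell N n x = cell N n y \<and> cell N (n + 1) x \<noteq> cell N (n + 1) y then w n x y else 0) \<le> (\<Sum>l=a..<N. f l n x y)"
        proof (cases "cell N n x = cell N n y \<and> cell N (n + 1) x \<noteq> cell N (n + 1) y")
          case True
          then have "x \<noteq> y" by auto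
          then obtain l where l: "n \<le> l" "of_scale N l (y - x)" using exists_scale[of n N x y] True n by auto
          then have "l \<in> {a..<N}" using n by (auto simp: of_scale_def)
          then have "f l n x y \<le> (\<Sum>l=a..<N. f l n x y)" by (intro member_le_sum f0) auto
          moreover have "f l n x y = w n x y" using True l by (simp add: f_def split_at_def)
          ultimately show ?thesis using True by simp
        next
          case False
          show ?thesis unfolding if_not_P[OF False] by (intro sum_nonneg f0)
        qed
      qed
      also have "\<dots> = (\<Sum>x\<in>?S. \<Sum>l=a..<N. \<Sum>y\<in>?S. f l n x y)" by (rule sum.cong[OF refl]) (rule sum.swap)
      also have "\<dots> = (\<Sum>l=a..<N. \<Sum>x\<in>?S. \<Sum>y\<in>?S. f l n x y)" by (rule sum.swap)
      finally show ?thesis .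
    qed
    have "(\<Sum>n=a..<N. split_prob N X n) \<le> (\<Sum>n=a..<N. \<Sum>l=a..<N. \<Sum>x\<in>?S. \<Sum>y\<in>?S. f l n x y)"
      by (intro sum_mono split_le)
    also have "\<dots> = (\<Sum>l=a..<N. Q l)" unfolding Q_def by (rule sum.swap)
    finally have P_Q: "(\<Sum>n=a..<N. split_prob N X n) \<le> (\<Sum>l=a..<N. Q l)" .
    have row: "(\<Sum>y\<in>?S. k l x y) \<le> pmf X x" if x: "x \<in> ?S" for l x
    proof -
      let ?A = "{n. \<exists>y. split_at N l n x y}"
      have "?A \<subseteq> {..l}" using split_at_le by auto
      then have finA: "finite ?A" by (rule finite_subset) simp
      have "(\<Sum>y\<in>?S. \<Sum>n=a..<N. f l n x y) = (\<Sum>n=a..<N. \<Sum>y\<in>?S. f l n x y)" by (rule sum.swap)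
      also have "\<dots> \<le> (\<Sum>n=a..<N. if n \<in> ?A then pmf X x else 0)"
      proof (rule sum_mono)
        fix n
        show "(\<Sum>y\<in>?S. f l n x y) \<le> (if n \<in> ?A then pmf X x else 0)"
        proof (cases "n \<in> ?A")
          case True
          have "(\<Sum>y\<in>?S. f l n x y) \<le> (\<Sum>y\<in>?S. if cell N n y = cell N n x then w n x y else 0)"
            by (intro sum_mono) (auto simp: f_def split_at_def w0)
          also have "\<dots> = (\<Sum>y\<in>{y\<in>?S. cell N n y = cell N n x}. w n x y)"
            using finX by (intro sum.mono_neutral_cong_right) auto
          also have "\<dots> = pmf X x / mass N X n x * mass N X n x"
            unfolding mass_sum[OF finX, of N n x] sum_distrib_left w_def by (simp add: mass_sum[OF finX])
          also have "\<dots> = pmf X x" using mass_pos[OF x, of N n] by simp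
          finally show ?thesis using True by simp
        next
          case False
          then have "f l n x y = 0" for y by (auto simp: f_def)
          then show ?thesis by simp
        qed
      qed
      also have "\<dots> = (\<Sum>n\<in>{a..<N} \<inter> ?A. pmf X x)"
        by (intro sum.mono_neutral_cong_right) auto
      also have "\<dots> = card ({a..<N} \<inter> ?A) * pmf X x" by simp
      also have "\<dots> \<le> Mc * pmf X x"
      proof (intro mult_right_mono)
        have "card ({a..<N} \<inter> ?A) \<le> card ?A" using finA by (intro card_mono) auto
        then show "real (card ({a..<N} \<inter> ?A)) \<le> real Mc" using Mc(2)[of N l x] by simp
      qed simp
      finally show ?thesis using Mc(1) unfolding k_def sum_divide_distrib[symmetric]
        by (simp add: divide_le_eq mult.commute)
    qed
    have sym: "k l x y = k l y x" if "x \<in> ?S" "y \<in> ?S" for l x y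
    proof -
      have "f l n x y = f l n y x" for n
        unfolding f_def w_def using split_at_sym[of N l n x y]
        by (auto simp: split_at_def mass_def mult.commute)
      then show ?thesis by (simp add: k_def)
    qed
    have Q_le: "Q l \<le> Mc" for l
    proof -
      have "(\<Sum>x\<in>?S. \<Sum>y\<in>?S. k l x y) \<le> (\<Sum>x\<in>?S. pmf X x)" by (intro sum_mono row)
      also have "\<dots> = 1" using finX by (intro sum_pmf_eq_1) auto
      finally show ?thesis unfolding Q_k using mult_left_mono[of "\<Sum>x\<in>?S. \<Sum>y\<in>?S. k l x y" 1 "real Mc"] by simp
    qed
    have G_mono: "G l \<le> G l'" if ll: "l \<le> l'" for l l'
    proof -
      obtain D where D: "finite (set_pmf D)" "U (kap N l) = U (kap N l') \<oplus> D" using U_kap_factor[OF ll] by blast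
      have eq: "U (kap N l) \<oplus> Y = (U (kap N l') \<oplus> Y) \<oplus> D" unfolding D by (simp add: conv_assoc conv_commute[of D])
      show ?thesis unfolding G_def eq using D finX finY
        by (intro H_conv_gain_antimono finite_conv finite_U)
    qed
    have G_step: "c * Q l \<le> Mc * (G l - G (l - W))" if l: "W \<le> l" for l
    proof -
      obtain D where D: "finite (set_pmf D)" "U (kap N (l - W)) = U (kap N l) \<oplus> D"
        using U_kap_factor[of "l - W" l] by auto
      let ?a = "U (kap N l) \<oplus> Y" and ?b = "U (kap N (l - W)) \<oplus> Y"
      have eq: "?b = ?a \<oplus> D" unfolding D by (simp add: conv_assoc conv_commute[of D])
      have fina: "finite (set_pmf ?a)" and finb: "finite (set_pmf ?b)" using finY by (auto intro!: finite_conv finite_U)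
      have offdiag: "(\<Sum>y\<in>?S - {x}. k l x y) \<le> pmf X x" if "x \<in> ?S" for x
      proof -
        have "(\<Sum>y\<in>?S - {x}. k l x y) \<le> (\<Sum>y\<in>?S. k l x y)" using finX k0 by (intro sum_mono2) auto
        then show ?thesis using row[OF that, of l] by linarith
      qed
      obtain V where V: "set_pmf V \<subseteq> ?S \<times> ?S" "map_pmf fst V = X" "map_pmf snd V = X"
        "\<And>x y. x \<in> ?S \<Longrightarrow> y \<in> ?S \<Longrightarrow> x \<noteq> y \<Longrightarrow> pmf V (x, y) = k l x y"
        using symmetric_kernel_coupling[where k = "k l", OF finX k0 sym offdiag] by blast
      have finV: "finite (set_pmf V)" using V(1) finX finite_subset by blast
      let ?g = "\<lambda>z. gain ?a (snd z - fst z) - gain ?b (snd z - fst z)"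
      have g0: "0 \<le> ?g z" for z unfolding eq using gain_conv_le[OF fina D(1)] by simp
      have "(\<Sum>z\<in>set_pmf V. pmf V z * (H ((\<lambda>(x, y). half x y) z \<oplus> ?a) - H ((\<lambda>(x, y). half x y) z \<oplus> (?a \<oplus> D))))
        \<le> H (bind_pmf V (\<lambda>(x, y). half x y) \<oplus> ?a) - H (bind_pmf V (\<lambda>(x, y). half x y) \<oplus> (?a \<oplus> D))"
        using finV fina D(1) by (intro H_conv_gain_concave) (auto simp: finite_half)
      \<comment> \<open>The pairs reassemble to X, so the right side is a difference of values of
        \<open>G\<close> up to \<open>H ?a - H ?b\<close>. The same constant appears on the left and
        cancels.\<close>
      also have "bind_pmf V (\<lambda>(x, y). half x y) = X" using V(2,3) by (rule bind_half_coupling)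
      also have "(\<Sum>z\<in>set_pmf V. pmf V z * (H ((\<lambda>(x, y). half x y) z \<oplus> ?a) - H ((\<lambda>(x, y). half x y) z \<oplus> (?a \<oplus> D))))
        = (\<Sum>z\<in>set_pmf V. pmf V z * ?g z + pmf V z * (H ?a - H ?b))"
        unfolding eq[symmetric] using fina finb
        by (intro sum.cong refl) (auto simp: H_conv_half algebra_simps split: prod.splits)
      also have "\<dots> = (\<Sum>z\<in>set_pmf V. pmf V z * ?g z) + (H ?a - H ?b)"
        using sum_pmf_eq_1[OF finV, of V] by (simp add: sum.distrib sum_distrib_right[symmetric])
      finally have 1: "(\<Sum>z\<in>set_pmf V. pmf V z * ?g z) \<le> G l - G (l - W)" unfolding G_def eq by simp
      have "c / Mc * Q l = (\<Sum>x\<in>?S. \<Sum>y\<in>?S. c * k l x y)"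
        unfolding Q_k using Mc(1) by (simp add: sum_distrib_left)
      also have "\<dots> \<le> (\<Sum>x\<in>?S. \<Sum>y\<in>?S. pmf V (x, y) * ?g (x, y))"
      proof (intro sum_mono)
        fix x y assume xy: "x \<in> ?S" "y \<in> ?S"
        show "c * k l x y \<le> pmf V (x, y) * ?g (x, y)"
        proof (cases "\<exists>n. split_at N l n x y")
          case True
          then have "of_scale N l (y - x)" "x \<noteq> y" by (auto simp: split_at_def)
          then have "c \<le> ?g (x, y)" using gain[of N l "y - x" Y] finY ns l by simp
          then have "k l x y * c \<le> k l x y * ?g (x, y)" using k0 by (rule mult_left_mono)
          then show ?thesis using V(4)[OF xy \<open>x \<noteq> y\<close>] by (simp only: mult.commute[of c])
        next
          case False
          then have "k l x y = 0" by (simp add: k_def f_def)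
          then show ?thesis using g0[of "(x, y)"] by simp
        qed
      qed
      also have "\<dots> = (\<Sum>z\<in>?S \<times> ?S. pmf V z * ?g z)" by (simp add: sum.cartesian_product case_prod_unfold)
      also have "\<dots> = (\<Sum>z\<in>set_pmf V. pmf V z * ?g z)"
        using V(1) finX by (intro sum.mono_neutral_right) (auto simp: set_pmf_iff)
      finally have "c / Mc * Q l \<le> G l - G (l - W)" using 1 by linarith
      then show ?thesis using Mc(1) by (simp add: field_simps)
    qed
    have "(\<Sum>l=a..<N. Q l) \<le> (\<Sum>l\<in>{a..<a + W} \<union> {a + W..<N}. Q l)"
      by (intro sum_mono2) (auto simp: Q_def intro!: sum_nonneg f0)
    also have "\<dots> = (\<Sum>l=a..<a + W. Q l) + (\<Sum>l=a + W..<N. Q l)"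
      by (intro sum.union_disjoint) auto
    also have "(\<Sum>l=a..<a + W. Q l) \<le> W * Mc"
      using sum_bounded_above[of "{a..<a + W}" Q "real Mc"] Q_le by simp
    also have "(\<Sum>l=a + W..<N. Q l) \<le> (\<Sum>l=a + W..<N. Mc / c * (G l - G (l - W)))"
      using G_step c by (intro sum_mono) (auto simp: field_simps)
    also have "\<dots> = Mc / c * (\<Sum>l=a + W..<N. G l - G (l - W))" by (simp only: sum_distrib_left)
    also have "\<dots> \<le> Mc / c * (W * (G N - G a))"
      using c G_mono aN by (intro mult_left_mono sum_lag_le) auto
    finally have "(\<Sum>l=a..<N. Q l) \<le> W * Mc + Mc / c * (W * (G N - G a))" by simp
    \<comment> \<open>Terms that are nonnegative by monotonicity of \<open>G\<close> are added to
      obtain one constant times \<open>1 + (G N - G a)\<close>.\<close>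
    also have "\<dots> \<le> W * Mc + W * Mc * (G N - G a) + (Mc * W / c + Mc / c * (W * (G N - G a)))"
      using G_mono[OF aN] c by simp
    also have "\<dots> = C * (1 + (G N - G a))" by (simp add: C_def algebra_simps add_divide_distrib diff_divide_distrib)
    also have "G N = H (X \<oplus> Y) - H Y"
    proof -
      have "(0 \<le> b \<and> b < 1) = (b = 0)" for b :: int by auto
      \<comment> \<open>At the finest level the box is a single lattice point, so no smoothing is
        left and no error arises at this end.\<close>
      then have "ibox (kap N N) = {0}" by (simp add: set_eq_iff ibox_def kap_self vec_eq_iff)
      then have "U (kap N N) = return_pmf 0" by (simp add: pmf_of_set_singleton)
      then have "U (kap N N) \<oplus> Y = Y" using conv_return_0[of Y] by (simp add: conv_commute[of Y])
      then show ?thesis by (simp add: G_def)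
    qed
    finally show "(\<Sum>n=a..<N. split_prob N X n) \<le> C * (1 + ((H (X \<oplus> Y) - H Y)
       - (H (X \<oplus> (U (kap N a) \<oplus> Y)) - H (U (kap N a) \<oplus> Y))))"
      using P_Q by (simp add: G_def)
  qed
qed

text \<open>At level \<open>a\<close> smoothing by a box is replaced by rounding to cells, at a
  bounded cost \<open>E\<close>. The first conclusion holds because splitting probabilities are
  nonnegative; it keeps the factor in the second one nonnegative, so that its coefficient can be
  enlarged later.\<close>

lemma entropy_growth_discrete:
  assumes m: "\<And>j. ch j + 4 + CARD('d) * (1 + log 2 5) \<le> eps * m"
  shows "\<exists>C>0. \<forall>N a X Y t. a \<le> N \<and> finite (set_pmf X) \<and> finite (set_pmf Y) \<and> nonsat eps m N Y \<and> 0 < t \<and> t < 1 \<longrightarrow>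
    0 \<le> C + ((H (X \<oplus> Y) - H (map_pmf (cell N a) (X \<oplus> Y))) - (H Y - H (map_pmf (cell N a) Y))) \<and>
    H X - H (map_pmf (cell N a) X) \<le> C * (1 + log 2 (1 / t)) * (C + ((H (X \<oplus> Y) - H (map_pmf (cell N a) (X \<oplus> Y)))
       - (H Y - H (map_pmf (cell N a) Y)))) + C * t * (real N - real a)"
proof -
  obtain C1 where C1: "C1 > 0" "\<And>N a X Y. a \<le> N \<Longrightarrow> finite (set_pmf X) \<Longrightarrow> finite (set_pmf Y) \<Longrightarrow> nonsat eps m N Y \<Longrightarrow>
    (\<Sum>n=a..<N. split_prob N X n) \<le> C1 * (1 + ((H (X \<oplus> Y) - H Y)
       - (H (X \<oplus> (U (kap N a) \<oplus> Y)) - H (U (kap N a) \<oplus> Y))))"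
    using sum_split_prob_le[OF m] by blast
  define E where "E = CARD('d) * (1 + log 2 5)"
  \<comment> \<open>One constant for three roles: the factor of the splitting term, the factor of
    the threshold term, and the shift that makes the increment nonnegative.\<close>
  define C where "C = 3 * C1 + 3 * subcell_bound + (1 + E)"
  have "0 \<le> E" by (simp add: E_def)
  show ?thesis
  proof (intro exI[of _ C] conjI allI impI)
    show "C > 0" using C1 \<open>0 \<le> E\<close> by (simp add: C_def)
    fix N a and X Y :: "(int^'d) pmf" and t :: real
    assume as: "a \<le> N \<and> finite (set_pmf X) \<and> finite (set_pmf Y) \<and> nonsat eps m N Y \<and> 0 < t \<and> t < 1"
    then have aN: "a \<le> N" and finX: "finite (set_pmf X)" and finY: "finite (set_pmf Y)" and ns: "nonsat eps m N Y"
      and t: "0 < t" "t < 1" by auto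
    let ?k = "kap N a"
    let ?\<Delta> = "(H (X \<oplus> Y) - H (map_pmf (cell N a) (X \<oplus> Y))) - (H Y - H (map_pmf (cell N a) Y))"
    have "H (map_pmf (coarsen ?k) (X \<oplus> Y)) + H (U ?k) - CARD('d) * log 2 5 \<le> H (X \<oplus> Y \<oplus> U ?k)"
    proof (intro H_conv_ge_floor finite_conv finX finY finite_U)
      fix z j assume "z \<in> set_pmf (U ?k)"
      then have "z \<in> ibox ?k" by (simp only: set_U)
      then have "0 \<le> z$j \<and> z$j < 2 ^ ?k j" by (simp add: ibox_def)
      then show "\<bar>z$j\<bar> \<le> 2 * 2 ^ ?k j" by linarith
    qed
    moreover have "H (Y \<oplus> U ?k) \<le> H (map_pmf (coarsen ?k) Y) + (\<Sum>j\<in>UNIV. real (?k j)) + CARD('d)"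
      by (rule H_conv_U_le[OF finY])
    moreover have "X \<oplus> Y \<oplus> U ?k = X \<oplus> (U ?k \<oplus> Y)" "Y \<oplus> U ?k = U ?k \<oplus> Y"
      by (simp_all add: conv_assoc conv_commute[of Y])
    ultimately have "(H (X \<oplus> Y) - H Y) - (H (X \<oplus> (U ?k \<oplus> Y)) - H (U ?k \<oplus> Y)) \<le> E + ?\<Delta>"
      by (simp add: H_U E_def algebra_simps)
    then have "C1 * (1 + ((H (X \<oplus> Y) - H Y) - (H (X \<oplus> (U ?k \<oplus> Y)) - H (U ?k \<oplus> Y)))) \<le> C1 * (1 + E + ?\<Delta>)"
      using C1(1) by (intro mult_left_mono) auto
    then have P: "(\<Sum>n=a..<N. split_prob N X n) \<le> C1 * (1 + E + ?\<Delta>)"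
      using C1(2)[OF aN finX finY ns] by linarith
    have lt: "0 \<le> log 2 (1 / t)" using t by simp
    have P0: "0 \<le> (\<Sum>n=a..<N. split_prob N X n)"
      unfolding split_prob_def using mass_pos mass_antimono[OF finX]
      by (intro sum_nonneg mult_nonneg_nonneg) (auto simp: divide_le_eq_1)
    then have "0 \<le> C1 * (1 + E + ?\<Delta>)" using P by linarith
    then have \<Delta>0: "0 \<le> 1 + E + ?\<Delta>" using C1(1) by (simp only: zero_le_mult_iff) linarith
    have C: "3 * C1 \<le> C" "3 * real subcell_bound \<le> C" "1 + E \<le> C" "0 \<le> C"
      using C1(1) \<open>0 \<le> E\<close> by (simp_all add: C_def)
    show \<Delta>C: "0 \<le> C + ?\<Delta>" using \<Delta>0 C(3) by linarith
    have CC: "(3 * C1) * (1 + E + ?\<Delta>) \<le> C * (C + ?\<Delta>)"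
      using \<Delta>0 C by (intro mult_mono) linarith+
    have Ct: "3 * real subcell_bound * (t * (real N - real a)) \<le> C * (t * (real N - real a))"
      using C(2) t aN by (intro mult_right_mono) auto
    have "H X - H (map_pmf (cell N a) X)
      \<le> 3 * (1 + log 2 (1 / t)) * (\<Sum>n=a..<N. split_prob N X n) + 3 * t * subcell_bound * (real N - real a)"
      by (rule H_levels[OF finX aN t])
    also have "\<dots> \<le> 3 * (1 + log 2 (1 / t)) * (C1 * (1 + E + ?\<Delta>)) + 3 * t * subcell_bound * (real N - real a)"
      using lt P by (intro add_right_mono mult_left_mono) auto
    also have "\<dots> = (1 + log 2 (1 / t)) * ((3 * C1) * (1 + E + ?\<Delta>)) + 3 * real subcell_bound * (t * (real N - real a))"
    proof -
      have "3 * x * (b * z) + 3 * t * k * n = x * ((3 * b) * z) + 3 * k * (t * n)" for x b z k n :: real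
        by (simp add: algebra_simps)
      then show ?thesis .
    qed
    also have "\<dots> \<le> (1 + log 2 (1 / t)) * (C * (C + ?\<Delta>)) + C * (t * (real N - real a))"
      using lt by (intro add_mono mult_left_mono CC Ct) linarith
    finally show "H X - H (map_pmf (cell N a) X) \<le> C * (1 + log 2 (1 / t)) * (C + ?\<Delta>) + C * t * (real N - real a)"
      by (simp only: mult_ac)
  qed
qed

end

section \<open>From measures to laws on the lattice\<close>

text \<open>On a countable type a pushforward probability is discrete; as a \<open>pmf\<close> it is
  accessible to the entropy inequalities above.\<close>

definition law :: "'a measure \<Rightarrow> ('a \<Rightarrow> 'b::countable) \<Rightarrow> 'b pmf" where
  "law mu f = Abs_pmf (distr mu (count_space UNIV) f)"

lemma measure_pmf_law:
  fixes f :: "'a \<Rightarrow> 'b::countable"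
  assumes "prob_space mu" and f: "f \<in> measurable mu (count_space UNIV)"
  shows "measure_pmf (law mu f) = distr mu (count_space UNIV) f"
proof -
  interpret mu: prob_space mu by fact
  let ?D = "distr mu (count_space UNIV) f"
  interpret D: prob_space ?D using f by (rule mu.prob_space_distr)
  have "AE x in ?D. measure ?D {x} \<noteq> 0"
  proof (rule AE_I')
    have "(\<Union>x\<in>{x. measure ?D {x} = 0}. {x}) \<in> null_sets ?D"
      by (rule null_sets_UN') (auto simp: null_sets_def D.emeasure_eq_measure)
    then show "{x. measure ?D {x} = 0} \<in> null_sets ?D" by simp
  qed auto
  then show ?thesis unfolding law_def
    by (intro Abs_pmf_inverse) (simp add: D.prob_space_axioms)
qed

lemma pmf_law:
  fixes f :: "'a \<Rightarrow> 'b::countable"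
  assumes "prob_space mu" and f: "f \<in> measurable mu (count_space UNIV)"
  shows "pmf (law mu f) v = measure mu (f -` {v} \<inter> space mu)"
  unfolding pmf.rep_eq measure_pmf_law[OF assms] using f by (simp add: measure_distr)

lemma law_comp:
  fixes f :: "'a \<Rightarrow> 'b::countable" and g :: "'b \<Rightarrow> 'c::countable"
  assumes "prob_space mu" and f: "f \<in> measurable mu (count_space UNIV)"
  shows "map_pmf g (law mu f) = law mu (\<lambda>x. g (f x))"
proof -
  have "(\<lambda>x. g (f x)) \<in> measurable mu (count_space UNIV)"
    using f by (rule measurable_compose) simp
  then have "measure_pmf (map_pmf g (law mu f)) = measure_pmf (law mu (\<lambda>x. g (f x)))"
    using assms by (simp add: map_pmf_rep_eq measure_pmf_law distr_distr comp_def)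
  then show ?thesis by (simp add: measure_pmf_inject)
qed

lemma set_law_subset:
  fixes f :: "'a \<Rightarrow> 'b::countable"
  assumes "prob_space mu" and f: "f \<in> measurable mu (count_space UNIV)"
    and K: "K \<in> sets mu" "measure mu K = 1"
  shows "set_pmf (law mu f) \<subseteq> f ` K"
proof (rule ccontr)
  interpret mu: prob_space mu by fact
  assume "\<not> ?thesis"
  then obtain v where v: "v \<in> set_pmf (law mu f)" "v \<notin> f ` K" by auto
  have "f -` {v} \<inter> space mu \<in> sets mu" using f by (rule measurable_sets) simp
  then have "measure mu (f -` {v} \<inter> space mu) + measure mu K = measure mu ((f -` {v} \<inter> space mu) \<union> K)"
    using v(2) K by (intro mu.finite_measure_Union[symmetric]) auto
  also have "\<dots> \<le> 1" by simp
  finally have "pmf (law mu f) v = 0" using K(2) by (simp add: pmf_law[OF assms(1,2)] measure_le_0_iff)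
  then show False using v(1) by (simp add: set_pmf_iff)
qed

lemma shannon_h_eq: "shannon_h p = p * log 2 p"
  by (simp add: shannon_h_def)

lemma ent_eq_H:
  fixes f :: "'a \<Rightarrow> 'b::countable"
  assumes "prob_space mu" and f: "f \<in> measurable mu (count_space UNIV)" and fin: "finite (set_pmf (law mu f))"
  shows "ent mu f = H (law mu f)"
proof -
  have "(\<Sum>\<^sub>\<infinity>v\<in>UNIV. shannon_h (measure mu (f -` {v} \<inter> space mu)))
      = (\<Sum>\<^sub>\<infinity>v\<in>set_pmf (law mu f). shannon_h (pmf (law mu f) v))"
    unfolding pmf_law[OF assms(1,2), symmetric]
    by (rule infsum_cong_neutral) (auto simp: shannon_h_eq set_pmf_iff)
  then show ?thesis using fin by (simp add: ent_def H_def shannon_h_eq)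
qed

text \<open>The chain rule. The infinite sums are first cut down to the finite ranges of the joint
  law.\<close>

lemma cond_ent_eq_H:
  fixes f :: "'a \<Rightarrow> 'b::countable" and g :: "'a \<Rightarrow> 'c::countable"
  assumes mu: "prob_space mu" and f: "f \<in> measurable mu (count_space UNIV)" and g: "g \<in> measurable mu (count_space UNIV)"
    and fg: "(\<lambda>x. (f x, g x)) \<in> measurable mu (count_space UNIV)"
    and fin: "finite (set_pmf (law mu (\<lambda>x. (f x, g x))))"
  shows "cond_ent mu f g = H (law mu (\<lambda>x. (f x, g x))) - H (law mu g)"
proof -
  let ?P = "law mu (\<lambda>x. (f x, g x))" and ?G = "law mu g"
  let ?A = "fst ` set_pmf ?P" and ?B = "snd ` set_pmf ?P"
  have G: "?G = map_pmf snd ?P" using law_comp[OF mu fg, of snd] by simp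
  have setG: "set_pmf ?G = ?B" unfolding G by simp
  have joint: "measure mu (f -` {v} \<inter> g -` {w} \<inter> space mu) = pmf ?P (v, w)" for v w
  proof -
    have "f -` {v} \<inter> g -` {w} \<inter> space mu = (\<lambda>x. (f x, g x)) -` {(v, w)} \<inter> space mu" by auto
    then show ?thesis by (simp add: pmf_law[OF mu fg])
  qed
  have outA: "pmf ?P (v, w) = 0" if "v \<notin> ?A" for v w
  proof -
    have "(v, w) \<notin> set_pmf ?P" using that by force
    then show ?thesis by (simp add: set_pmf_iff)
  qed
  have outB: "pmf ?G w = 0" if "w \<notin> ?B" for w
    using that unfolding setG[symmetric] by (simp add: set_pmf_iff)
  have finA: "finite ?A" and finB: "finite ?B" using fin by auto
  have inner: "(\<Sum>\<^sub>\<infinity>v\<in>UNIV. shannon_h (pmf ?P (v, w) / pmf ?G w)) = (\<Sum>v\<in>?A. shannon_h (pmf ?P (v, w) / pmf ?G w))" for w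
  proof -
    have "(\<Sum>\<^sub>\<infinity>v\<in>UNIV. shannon_h (pmf ?P (v, w) / pmf ?G w)) = (\<Sum>\<^sub>\<infinity>v\<in>?A. shannon_h (pmf ?P (v, w) / pmf ?G w))"
      by (rule infsum_cong_neutral) (auto simp: shannon_h_eq outA)
    then show ?thesis using finA by simp
  qed
  have "cond_ent mu f g = (\<Sum>\<^sub>\<infinity>w\<in>UNIV. pmf ?G w * (- (\<Sum>v\<in>?A. shannon_h (pmf ?P (v, w) / pmf ?G w))))"
    unfolding cond_ent_def joint pmf_law[OF mu g, symmetric] inner ..
  also have "\<dots> = (\<Sum>\<^sub>\<infinity>w\<in>?B. pmf ?G w * (- (\<Sum>v\<in>?A. shannon_h (pmf ?P (v, w) / pmf ?G w))))"
    by (rule infsum_cong_neutral) (auto simp: outB)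
  also have "\<dots> = (\<Sum>w\<in>?B. pmf ?G w * (- (\<Sum>v\<in>?A. shannon_h (pmf ?P (v, w) / pmf ?G w))))"
    using finB by simp
  also have "\<dots> = (\<Sum>w\<in>?B. (\<Sum>v\<in>?A. pmf ?P (v, w)) * log 2 (pmf ?G w) - (\<Sum>v\<in>?A. pmf ?P (v, w) * log 2 (pmf ?P (v, w))))"
  proof (rule sum.cong[OF refl])
    fix w assume "w \<in> ?B"
    then have pos: "pmf ?G w > 0" unfolding setG[symmetric] by (simp add: pmf_positive)
    have "pmf ?G w * (- (\<Sum>v\<in>?A. shannon_h (pmf ?P (v, w) / pmf ?G w)))
       = (\<Sum>v\<in>?A. pmf ?P (v, w) * log 2 (pmf ?G w) - pmf ?P (v, w) * log 2 (pmf ?P (v, w)))"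
      unfolding sum_distrib_left sum_negf[symmetric]
    proof (rule sum.cong[OF refl])
      fix v
      show "pmf ?G w * - shannon_h (pmf ?P (v, w) / pmf ?G w)
        = pmf ?P (v, w) * log 2 (pmf ?G w) - pmf ?P (v, w) * log 2 (pmf ?P (v, w))"
      proof (cases "pmf ?P (v, w) = 0")
        case False
        then have L: "log 2 (pmf ?P (v, w) / pmf ?G w) = log 2 (pmf ?P (v, w)) - log 2 (pmf ?G w)"
          using pos by (subst log_divide) (auto simp: pmf_positive_iff set_pmf_iff)
        show ?thesis unfolding shannon_h_eq L using pos by (simp add: algebra_simps)
      qed (simp add: shannon_h_eq)
    qed
    then show "pmf ?G w * (- (\<Sum>v\<in>?A. shannon_h (pmf ?P (v, w) / pmf ?G w))) =
      (\<Sum>v\<in>?A. pmf ?P (v, w)) * log 2 (pmf ?G w) - (\<Sum>v\<in>?A. pmf ?P (v, w) * log 2 (pmf ?P (v, w)))"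
      by (simp add: sum_subtractf sum_distrib_right)
  qed
  also have "\<dots> = (\<Sum>w\<in>?B. pmf ?G w * log 2 (pmf ?G w)) - (\<Sum>w\<in>?B. \<Sum>v\<in>?A. pmf ?P (v, w) * log 2 (pmf ?P (v, w)))"
    unfolding sum_subtractf using sum_marginal[OF fin, of fst snd] by (simp add: G map_pmf_ident)
  also have "(\<Sum>w\<in>?B. \<Sum>v\<in>?A. pmf ?P (v, w) * log 2 (pmf ?P (v, w))) = (\<Sum>z\<in>?A \<times> ?B. pmf ?P z * log 2 (pmf ?P z))"
    by (subst sum.swap) (simp add: sum.cartesian_product)
  also have "\<dots> = (\<Sum>z\<in>set_pmf ?P. pmf ?P z * log 2 (pmf ?P z))"
    using finA finB by (intro sum.mono_neutral_right) (force simp: set_pmf_iff)+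
  finally show ?thesis by (simp add: H_def setG)
qed

text \<open>\<open>c\<close> holds reciprocal side lengths and \<open>s\<close> the shift, so that
  the shifted partitions of \<open>avg_ent\<close> and the dyadic ones of \<open>E_idx\<close> are
  instances of one family.\<close>

definition grid :: "real^'d::finite \<Rightarrow> real^'d \<Rightarrow> real^'d \<Rightarrow> int^'d" where
  "grid c s x = (\<chi> j. \<lfloor>x$j * c$j + s$j\<rfloor>)"

lemma measurable_vec_count_space:
  fixes f :: "'a \<Rightarrow> 'b::countable^'d::finite"
  assumes "\<And>j. (\<lambda>x. f x $ j) \<in> measurable M (count_space UNIV)"
  shows "f \<in> measurable M (count_space UNIV)"
proof (subst measurable_count_space_eq_countable[OF countableI_type], intro conjI ballI)
  fix v
  have "f -` {v} \<inter> space M = (\<Inter>j. (\<lambda>x. f x $ j) -` {v$j} \<inter> space M)" by (auto simp: vec_eq_iff)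
  also have "\<dots> \<in> sets M" using assms by (intro sets.finite_INT measurable_sets[OF assms]) auto
  finally show "f -` {v} \<inter> space M \<in> sets M" .
qed simp

lemma measurable_grid: "sets M = sets borel \<Longrightarrow> grid c s \<in> measurable M (count_space UNIV)"
proof (rule measurable_vec_count_space)
  fix j assume M: "sets M = sets borel"
  have "(\<lambda>x::real^'a. x$j * c$j + s$j) \<in> borel_measurable M"
    using M by (simp add: measurable_cong_sets[OF M refl])
  then show "(\<lambda>x. grid c s x $ j) \<in> measurable M (count_space UNIV)"
    unfolding grid_def by simp
qed

lemma cpt_probE:
  fixes mu :: "(real^'d::finite) measure"
  assumes "cpt_prob mu"
  obtains K B where "prob_space mu" "sets mu = sets borel" "K \<in> sets mu" "measure mu K = 1" "B > 0"
    "\<And>x j. x \<in> K \<Longrightarrow> \<bar>x$j\<bar> \<le> B"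
proof -
  obtain K where K: "compact K" "measure mu K = 1" and mu: "prob_space mu" "sets mu = sets borel"
    using assms by (auto simp: cpt_prob_def)
  obtain B where B: "B > 0" "\<And>x. x \<in> K \<Longrightarrow> norm x \<le> B"
    using compact_imp_bounded[OF K(1)] unfolding bounded_pos by blast
  show thesis
  proof (rule that[OF mu _ K(2) B(1)])
    show "K \<in> sets mu" using K(1) mu(2) by (simp add: borel_compact)
    show "\<bar>x$j\<bar> \<le> B" if "x \<in> K" for x j
      using component_le_norm_cart[of x j] B(2)[OF that] by linarith
  qed
qed

lemma grid_bounded:
  fixes c :: "real^'d::finite"
  assumes "\<And>j. \<bar>x$j\<bar> \<le> B" "\<And>j. 0 \<le> c$j" "\<And>j. 0 \<le> s$j \<and> s$j < 1"
  shows "grid c s x \<in> {z. \<forall>j. z$j \<in> {\<lfloor>- B * c$j\<rfloor>..\<lfloor>B * c$j + 1\<rfloor>}}"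
proof -
  have "\<lfloor>- B * c$j\<rfloor> \<le> \<lfloor>x$j * c$j + s$j\<rfloor> \<and> \<lfloor>x$j * c$j + s$j\<rfloor> \<le> \<lfloor>B * c$j + 1\<rfloor>" for j
  proof -
    have "- B * c$j \<le> x$j * c$j" "x$j * c$j \<le> B * c$j"
      using assms(1)[of j] by (intro mult_right_mono assms(2); linarith)+
    then show ?thesis using assms(3)[of j] by (intro conjI floor_mono) linarith+
  qed
  then show ?thesis by (simp add: grid_def)
qed

lemma finite_law_grid:
  fixes c :: "real^'d::finite"
  assumes "cpt_prob mu" "\<And>j. 0 \<le> c$j" "\<And>j. 0 \<le> s$j \<and> s$j < 1"
  shows "finite (set_pmf (law mu (grid c s)))"
proof -
  obtain K B where K: "prob_space mu" "sets mu = sets borel" "K \<in> sets mu" "measure mu K = 1"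
    "\<And>x j. x \<in> K \<Longrightarrow> \<bar>x$j\<bar> \<le> B" using cpt_probE[OF assms(1)] by metis
  have "set_pmf (law mu (grid c s)) \<subseteq> grid c s ` K"
    by (rule set_law_subset[OF K(1) measurable_grid[OF K(2)] K(3,4)])
  also have "\<dots> \<subseteq> {z. \<forall>j. z$j \<in> {\<lfloor>- B * c$j\<rfloor>..\<lfloor>B * c$j + 1\<rfloor>}}"
    using grid_bounded[OF K(5) assms(2,3)] by blast
  finally show ?thesis by (rule finite_subset) (rule finite_vec_set, simp)
qed

text \<open>A cell of length \<open>1 / c\<close> measures at most \<open>R\<close> in units of
  \<open>1 / c'\<close>, so it meets at most \<open>R + 1\<close> cells of the other grid, whatever
  the shifts.\<close>

lemma card_floor_rescale:
  assumes "0 < c" "0 < c'" "c' / c \<le> real R"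
  shows "\<lfloor>y * c' + s'\<rfloor> \<in> {\<lfloor>(of_int \<lfloor>y * c + s\<rfloor> - s) * (c' / c) + s'\<rfloor>..\<lfloor>(of_int \<lfloor>y * c + s\<rfloor> - s) * (c' / c) + s'\<rfloor> + int R}"
proof -
  let ?r = "c' / c" and ?u = "of_int \<lfloor>y * c + s\<rfloor> :: real"
  have r: "0 < ?r" using assms by simp
  have y: "y * c' = (y * c + s - s) * ?r" using assms by simp
  have "(?u - s) * ?r \<le> (y * c + s - s) * ?r" using r by (intro mult_right_mono) linarith+
  moreover have "(y * c + s - s) * ?r \<le> (?u - s + 1) * ?r" using r by (intro mult_right_mono) linarith+
  ultimately have "(?u - s) * ?r + s' \<le> y * c' + s'" "y * c' + s' \<le> ((?u - s) * ?r + s') + of_int (int R)"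
    using assms(3) y by (simp_all only: distrib_right mult_1 of_int_of_nat_eq)
  then have "\<lfloor>(?u - s) * ?r + s'\<rfloor> \<le> \<lfloor>y * c' + s'\<rfloor>" "\<lfloor>y * c' + s'\<rfloor> \<le> \<lfloor>((?u - s) * ?r + s') + of_int (int R)\<rfloor>"
    by (simp_all only: floor_mono)
  then show ?thesis by simp
qed

lemma H_grid_le:
  fixes c :: "real^'d::finite"
  assumes mu: "cpt_prob mu" and c: "\<And>j. 0 < c$j" "\<And>j. 0 < c'$j" "\<And>j. c'$j / c$j \<le> real R"
    and s: "\<And>j. 0 \<le> s$j \<and> s$j < 1" "\<And>j. 0 \<le> s'$j \<and> s'$j < 1"
  shows "H (law mu (grid c' s')) \<le> H (law mu (grid c s)) + CARD('d) * log 2 (real (R + 1))"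
proof -
  obtain K B where K: "prob_space mu" "sets mu = sets borel" "K \<in> sets mu" "measure mu K = 1"
    using cpt_probE[OF mu] by metis
  let ?f = "\<lambda>x. (grid c s x, grid c' s' x)"
  have mf: "?f \<in> measurable mu (count_space UNIV)"
    using measurable_Pair[OF measurable_grid[OF K(2), of c s] measurable_grid[OF K(2), of c' s']]
    by (simp add: pair_measure_countable)
  let ?P = "law mu ?f"
  have fst: "map_pmf fst ?P = law mu (grid c s)" and snd: "map_pmf snd ?P = law mu (grid c' s')"
    using law_comp[OF K(1) mf, of fst] law_comp[OF K(1) mf, of snd] by simp_all
  have "finite (fst ` set_pmf ?P \<times> snd ` set_pmf ?P)"
    unfolding set_map_pmf[symmetric] fst snd using mu c s by (intro finite_cartesian_product finite_law_grid less_imp_le)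
  then have finP: "finite (set_pmf ?P)" by (rule rev_finite_subset) force
  have ran: "set_pmf ?P \<subseteq> range ?f" using set_law_subset[OF K(1) mf K(3,4)] by auto
  have "H (map_pmf snd ?P) \<le> H (map_pmf fst ?P) + log 2 (real ((R + 1) ^ CARD('d)))"
  proof (rule H_cond_card[OF finP])
    fix w
    let ?S = "\<lambda>j. {\<lfloor>(of_int (fst w $ j) - s$j) * (c'$j / c$j) + s'$j\<rfloor>..\<lfloor>(of_int (fst w $ j) - s$j) * (c'$j / c$j) + s'$j\<rfloor> + int R}"
    have "snd ` {w' \<in> set_pmf ?P. fst w' = fst w} \<subseteq> {z. \<forall>j. z$j \<in> ?S j}"
    proof clarify
      fix z z' j assume "(z, z') \<in> set_pmf ?P" and z: "fst (z, z') = fst w"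
      then obtain x where "(z, z') = ?f x" using ran by auto
      then have x: "z = grid c s x" "z' = grid c' s' x" by auto
      show "snd (z, z') $ j \<in> ?S j"
        using card_floor_rescale[OF c(1)[of j] c(2)[of j] c(3)[of j], of "x$j" "s'$j" "s$j"] z
        unfolding z[symmetric] by (simp add: x grid_def)
    qed
    then have "card (snd ` {w' \<in> set_pmf ?P. fst w' = fst w}) \<le> card {z::int^'d. \<forall>j. z$j \<in> ?S j}"
      by (intro card_mono finite_vec_set) auto
    also have "\<dots> = (R + 1) ^ CARD('d)" unfolding card_vec_set by (simp add: nat_add_distrib)
    finally show "card (snd ` {w' \<in> set_pmf ?P. fst w' = fst w}) \<le> (R + 1) ^ CARD('d)" .
  qed simp
  then show ?thesis unfolding fst snd of_nat_power by (simp add: log_nat_power)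
qed

section \<open>Rounding of independent sums\<close>

lemma law_pair_independent:
  fixes f :: "'a \<Rightarrow> 'b::countable" and g :: "'c \<Rightarrow> 'e::countable"
  assumes nu: "prob_space nu" and mu: "prob_space mu"
    and f: "f \<in> measurable nu (count_space UNIV)" and g: "g \<in> measurable mu (count_space UNIV)"
    and fg: "(\<lambda>z. (f (fst z), g (snd z))) \<in> measurable (nu \<Otimes>\<^sub>M mu) (count_space UNIV)"
  shows "law (nu \<Otimes>\<^sub>M mu) (\<lambda>z. (f (fst z), g (snd z))) = pair_pmf (law nu f) (law mu g)"
proof (rule pmf_eqI)
  interpret nu: prob_space nu by fact
  interpret mu: prob_space mu by fact
  interpret pair_prob_space nu mu ..
  fix v
  have eq: "(\<lambda>z. (f (fst z), g (snd z))) -` {v} \<inter> space (nu \<Otimes>\<^sub>M mu)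
      = (f -` {fst v} \<inter> space nu) \<times> (g -` {snd v} \<inter> space mu)"
    by (auto simp: space_pair_measure)
  have "f -` {fst v} \<inter> space nu \<in> sets nu" "g -` {snd v} \<inter> space mu \<in> sets mu"
    using f g by (auto intro: measurable_sets)
  then have "pmf (law (nu \<Otimes>\<^sub>M mu) (\<lambda>z. (f (fst z), g (snd z)))) v = pmf (law nu f) (fst v) * pmf (law mu g) (snd v)"
    unfolding pmf_law[OF prob_space_axioms fg] pmf_law[OF nu f] pmf_law[OF mu g] eq
    by (simp add: measure_def mu.emeasure_pair_measure_Times enn2real_mult)
  then show "pmf (law (nu \<Otimes>\<^sub>M mu) (\<lambda>z. (f (fst z), g (snd z)))) v = pmf (pair_pmf (law nu f) (law mu g)) v"
    by (simp add: pmf_pair[of _ _ "fst v" "snd v", simplified])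
qed

lemma cpt_prob_convolution:
  fixes nu mu :: "(real^'d::finite) measure"
  assumes "cpt_prob nu" "cpt_prob mu"
  shows "cpt_prob (convolution nu mu)"
proof -
  obtain K where K: "prob_space nu" "sets nu = sets borel" "compact K" "measure nu K = 1"
    using assms(1) by (auto simp: cpt_prob_def)
  obtain L where L: "prob_space mu" "sets mu = sets borel" "compact L" "measure mu L = 1"
    using assms(2) by (auto simp: cpt_prob_def)
  interpret nu: prob_space nu by fact
  interpret mu: prob_space mu by fact
  interpret pair_prob_space nu mu ..
  have m: "(\<lambda>(x, y). x + y) \<in> measurable (nu \<Otimes>\<^sub>M mu) borel"
    using K(2) L(2) by (simp cong: measurable_cong_sets sets_pair_measure_cong)
  have pr: "prob_space (convolution nu mu)" unfolding convolution_def using m by (rule prob_space_distr)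
  let ?S = "{x + y | x y. x \<in> K \<and> y \<in> L}"
  have S: "compact ?S" using K(3) L(3) by (rule compact_sums)
  have "1 = measure nu K * measure mu L" using K L by simp
  also have "\<dots> = measure (nu \<Otimes>\<^sub>M mu) (K \<times> L)"
    using K(2,3) L(2,3) by (simp add: measure_def mu.emeasure_pair_measure_Times enn2real_mult borel_compact)
  also have "\<dots> \<le> measure (nu \<Otimes>\<^sub>M mu) ((\<lambda>(x, y). x + y) -` ?S \<inter> space (nu \<Otimes>\<^sub>M mu))"
    using m S K(2) L(2) by (intro finite_measure_mono measurable_sets[OF m])
      (auto simp: borel_compact space_pair_measure sets_eq_imp_space_eq[OF K(2)] sets_eq_imp_space_eq[OF L(2)])
  also have "\<dots> = measure (convolution nu mu) ?S"
    unfolding convolution_def using m S by (subst measure_distr) (auto simp: borel_compact)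
  finally have "measure (convolution nu mu) ?S = 1"
    using prob_space.prob_le_1[OF pr, of ?S] by linarith
  then show ?thesis unfolding cpt_prob_def using pr S by (auto simp: convolution_def)
qed

text \<open>Rounding a sum and summing the roundings differ by 0 or 1 in each coordinate.\<close>

lemma H_law_convolution:
  fixes nu mu :: "(real^'d::finite) measure" and k :: "'d \<Rightarrow> nat"
  assumes nu: "cpt_prob nu" and mu: "cpt_prob mu" and c: "\<And>j. 0 \<le> c$j"
  defines "Z \<equiv> map_pmf (coarsen k) (law (convolution nu mu) (grid c 0))"
    and "Z' \<equiv> map_pmf (coarsen k) (law nu (grid c 0) \<oplus> law mu (grid c 0))"
  shows "\<bar>H Z - H Z'\<bar> \<le> CARD('d)"
proof -
  obtain K A where K: "prob_space nu" "sets nu = sets borel" "K \<in> sets nu" "measure nu K = 1"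
    using cpt_probE[OF nu] by metis
  obtain L B where L: "prob_space mu" "sets mu = sets borel" "L \<in> sets mu" "measure mu L = 1"
    using cpt_probE[OF mu] by metis
  interpret nu: prob_space nu by fact
  interpret mu: prob_space mu by fact
  interpret pair_prob_space nu mu ..
  let ?M = "nu \<Otimes>\<^sub>M mu" and ?g = "grid c 0"
  have M: "sets ?M = sets (borel \<Otimes>\<^sub>M borel)" using K(2) L(2) by (rule sets_pair_measure_cong)
  have plus: "(\<lambda>(x, y). x + y) \<in> measurable ?M borel"
    using K(2) L(2) by (simp cong: measurable_cong_sets sets_pair_measure_cong)
  have m1: "(\<lambda>z. ?g (fst z)) \<in> measurable ?M (count_space UNIV)"
    by (rule measurable_compose[OF measurable_fst measurable_grid[OF K(2)]])
  have m2: "(\<lambda>z. ?g (snd z)) \<in> measurable ?M (count_space UNIV)"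
    by (rule measurable_compose[OF measurable_snd measurable_grid[OF L(2)]])
  have m3: "(\<lambda>z. ?g (case z of (x, y) \<Rightarrow> x + y)) \<in> measurable ?M (count_space UNIV)"
    by (rule measurable_compose[OF plus measurable_grid]) simp
  let ?q = "\<lambda>z. (?g (fst z), ?g (snd z))"
  let ?f = "\<lambda>z. (?g (case z of (x, y) \<Rightarrow> x + y), ?q z)"
  have mq: "?q \<in> measurable ?M (count_space UNIV)"
    using measurable_Pair[OF m1 m2] by (simp add: pair_measure_countable)
  have mf: "?f \<in> measurable ?M (count_space UNIV)"
    using measurable_Pair[OF m3 mq] by (simp add: pair_measure_countable)
  let ?P = "law ?M ?f"
  have ran: "set_pmf ?P \<subseteq> range ?f"
    using set_law_subset[OF prob_space_axioms mf sets.top prob_space] by (rule order_trans) (rule image_mono, simp)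
  have fst: "map_pmf fst ?P = law (convolution nu mu) ?g"
  proof -
    have "map_pmf fst ?P = law ?M (\<lambda>z. ?g (case z of (x, y) \<Rightarrow> x + y))"
      using law_comp[OF prob_space_axioms mf, of fst] by simp
    also have "\<dots> = law (convolution nu mu) ?g"
      unfolding law_def convolution_def using plus by (subst distr_distr) (auto intro: measurable_grid simp: comp_def)
    finally show ?thesis .
  qed
  have snd: "map_pmf (\<lambda>w. fst (snd w) + snd (snd w)) ?P = law nu ?g \<oplus> law mu ?g"
  proof -
    have "map_pmf snd ?P = law ?M ?q" using law_comp[OF prob_space_axioms mf, of snd] by simp
    also have "\<dots> = pair_pmf (law nu ?g) (law mu ?g)"
      by (rule law_pair_independent[OF K(1) L(1) measurable_grid[OF K(2)] measurable_grid[OF L(2)] mq])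
    finally have "map_pmf (\<lambda>(x, y). x + y) (map_pmf snd ?P) = law nu ?g \<oplus> law mu ?g" by (simp add: conv_pair)
    then show ?thesis by (simp add: map_pmf_comp case_prod_unfold)
  qed
  have "finite (fst ` set_pmf ?P \<times> snd ` set_pmf ?P)"
  proof (rule finite_cartesian_product)
    show "finite (fst ` set_pmf ?P)"
      unfolding set_map_pmf[symmetric] fst using cpt_prob_convolution[OF nu mu] c by (intro finite_law_grid) auto
    have "map_pmf snd ?P = pair_pmf (law nu ?g) (law mu ?g)"
      using law_comp[OF prob_space_axioms mf, of snd]
        law_pair_independent[OF K(1) L(1) measurable_grid[OF K(2)] measurable_grid[OF L(2)] mq] by simp
    then show "finite (snd ` set_pmf ?P)"
      unfolding set_map_pmf[symmetric] using nu mu c by (simp add: finite_law_grid)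
  qed
  then have finP: "finite (set_pmf ?P)" by (rule rev_finite_subset) force
  let ?a = "\<lambda>w. coarsen k (fst w)" and ?b = "\<lambda>w. coarsen k (fst (snd w) + snd (snd w))"
  have Z: "Z = map_pmf ?a ?P" "Z' = map_pmf ?b ?P"
    unfolding Z_def Z'_def fst[symmetric] snd[symmetric] by (simp_all add: map_pmf_comp)
  \<comment> \<open>The difference 0 or 1 survives coarsening: raising the numerator by 1 raises an
    integer quotient by at most 1.\<close>
  have near: "?a w $ j \<in> {?b w $ j .. ?b w $ j + 1}" if wP: "w \<in> set_pmf ?P" for w j
  proof -
    obtain z where z: "w = ?f z" using wP ran by auto
    obtain x y where xy: "z = (x, y)" by fastforce
    let ?u = "\<lfloor>x$j * c$j\<rfloor> + \<lfloor>y$j * c$j\<rfloor>" and ?v = "\<lfloor>(x + y)$j * c$j\<rfloor>"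
    have "?u \<le> ?v" "?v \<le> ?u + 1" by (simp_all add: distrib_right) linarith+
    then have "?u div 2 ^ k j \<le> ?v div 2 ^ k j" "?v div 2 ^ k j \<le> (?u + 1) div 2 ^ k j"
      by (intro zdiv_mono1; simp)+
    moreover have "(?u + 1) div 2 ^ k j \<le> (?u + 1 * 2 ^ k j) div 2 ^ k j" by (intro zdiv_mono1) auto
    moreover have "(?u + 1 * 2 ^ k j) div 2 ^ k j = 1 + ?u div 2 ^ k j" by (rule div_mult_self1) simp
    ultimately have "?u div 2 ^ k j \<le> ?v div 2 ^ k j \<and> ?v div 2 ^ k j \<le> ?u div 2 ^ k j + 1" by linarith
    then show ?thesis by (simp add: z xy coarsen_def grid_def)
  qed
  have two: "log 2 (real (2 ^ CARD('d))) = CARD('d)" by (simp add: log_nat_power)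
  have "H (map_pmf ?a ?P) \<le> H (map_pmf ?b ?P) + log 2 (real (2 ^ CARD('d)))"
  proof (rule H_cond_card[OF finP])
    fix w
    have "?a ` {w' \<in> set_pmf ?P. ?b w' = ?b w} \<subseteq> {z. \<forall>j. z$j \<in> {?b w $ j .. ?b w $ j + 1}}"
    proof (intro image_subsetI CollectI allI)
      fix w' j assume "w' \<in> {w' \<in> set_pmf ?P. ?b w' = ?b w}"
      then show "?a w' $ j \<in> {?b w $ j .. ?b w $ j + 1}" using near[of w' j] by (simp only: mem_Collect_eq)
    qed
    then have "card (?a ` {w' \<in> set_pmf ?P. ?b w' = ?b w}) \<le> card {z::int^'d. \<forall>j. z$j \<in> {?b w $ j .. ?b w $ j + 1}}"
      by (intro card_mono finite_vec_set) auto
    also have "\<dots> = 2 ^ CARD('d)" unfolding card_vec_set by simp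
    finally show "card (?a ` {w' \<in> set_pmf ?P. ?b w' = ?b w}) \<le> 2 ^ CARD('d)" .
  qed simp
  moreover have "H (map_pmf ?b ?P) \<le> H (map_pmf ?a ?P) + log 2 (real (2 ^ CARD('d)))"
  proof (rule H_cond_card[OF finP])
    fix w
    have "?b ` {w' \<in> set_pmf ?P. ?a w' = ?a w} \<subseteq> {z. \<forall>j. z$j \<in> {?a w $ j - 1 .. ?a w $ j}}"
    proof (intro image_subsetI CollectI allI)
      fix w' j assume "w' \<in> {w' \<in> set_pmf ?P. ?a w' = ?a w}"
      then have "?a w $ j \<in> {?b w' $ j .. ?b w' $ j + 1}" using near[of w' j] by (simp only: mem_Collect_eq)
      then show "?b w' $ j \<in> {?a w $ j - 1 .. ?a w $ j}" by simp
    qed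
    then have "card (?b ` {w' \<in> set_pmf ?P. ?a w' = ?a w}) \<le> card {z::int^'d. \<forall>j. z$j \<in> {?a w $ j - 1 .. ?a w $ j}}"
      by (intro card_mono finite_vec_set) auto
    also have "\<dots> = 2 ^ CARD('d)" unfolding card_vec_set by simp
    finally show "card (?b ` {w' \<in> set_pmf ?P. ?a w' = ?a w}) \<le> 2 ^ CARD('d)" .
  qed simp
  ultimately show ?thesis unfolding Z two by linarith
qed

text \<open>Measurability in the shift makes the integral in \<open>avg_ent\<close> a genuine one;
  without integrability \<open>integral\<close> would return the default value 0. Compact support
  confines the cell indices to one finite set for all shifts, so the entropy is a finite
  sum.\<close>

lemma measurable_ent_grid:
  fixes mu :: "(real^'d::finite) measure"
  assumes mu: "cpt_prob mu" and c: "\<And>j. 0 \<le> c$j"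
  shows "\<exists>h \<in> borel_measurable borel. \<forall>s. (\<forall>j. 0 \<le> s$j \<and> s$j < 1) \<longrightarrow> ent mu (grid c s) = h s"
proof -
  obtain K B where K: "prob_space mu" "sets mu = sets borel" "K \<in> sets mu" "measure mu K = 1"
    "\<And>x j. x \<in> K \<Longrightarrow> \<bar>x$j\<bar> \<le> B" using cpt_probE[OF mu] by metis
  interpret mu: prob_space mu by fact
  let ?V = "{z::int^'d. \<forall>j. z$j \<in> {\<lfloor>- B * c$j\<rfloor>..\<lfloor>B * c$j + 1\<rfloor>}}"
  have finV: "finite ?V" by (rule finite_vec_set) simp
  let ?p = "\<lambda>s v. measure mu (grid c s -` {v} \<inter> space mu)"
  define h where "h s = - (\<Sum>v\<in>?V. shannon_h (?p s v))" for s
  have p: "(\<lambda>s. ?p s v) \<in> borel_measurable borel" for v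
  proof -
    have "(\<lambda>z. grid c (fst z) (snd z)) \<in> measurable (borel \<Otimes>\<^sub>M mu) (count_space UNIV)"
    proof (rule measurable_vec_count_space)
      fix j
      have [measurable]: "(\<lambda>z::(real^'d) \<times> (real^'d). fst z $ j) \<in> borel_measurable (borel \<Otimes>\<^sub>M mu)"
        by (rule measurable_compose[OF measurable_fst]) simp
      have [measurable]: "(\<lambda>z. snd z $ j) \<in> borel_measurable (borel \<Otimes>\<^sub>M mu)"
        by (rule measurable_compose[OF measurable_snd]) (simp add: measurable_cong_sets[OF K(2) refl])
      show "(\<lambda>z. grid c (fst z) (snd z) $ j) \<in> measurable (borel \<Otimes>\<^sub>M mu) (count_space UNIV)"
        unfolding grid_def by simp
    qed
    then have "(\<lambda>z. grid c (fst z) (snd z)) -` {v} \<inter> space (borel \<Otimes>\<^sub>M mu) \<in> sets (borel \<Otimes>\<^sub>M mu)"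
      by (rule measurable_sets) simp
    from mu.measurable_emeasure_Pair[OF this]
    have "(\<lambda>s. measure mu (Pair s -` ((\<lambda>z. grid c (fst z) (snd z)) -` {v} \<inter> space (borel \<Otimes>\<^sub>M mu)))) \<in> borel_measurable borel"
      unfolding measure_def by (intro borel_measurable_enn2real)
    moreover have "Pair s -` ((\<lambda>z. grid c (fst z) (snd z)) -` {v} \<inter> space (borel \<Otimes>\<^sub>M mu)) = grid c s -` {v} \<inter> space mu" for s
      by (auto simp: space_pair_measure)
    ultimately show ?thesis by simp
  qed
  show ?thesis
  proof (intro bexI[of _ h] allI impI)
    show "h \<in> borel_measurable borel"
      unfolding h_def shannon_h_eq using p by (intro borel_measurable_uminus borel_measurable_sum borel_measurable_times borel_measurable_log) auto
    fix s :: "real^'d" assume s: "\<forall>j. 0 \<le> s$j \<and> s$j < 1"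
    have "set_pmf (law mu (grid c s)) \<subseteq> grid c s ` K"
      by (rule set_law_subset[OF K(1) measurable_grid[OF K(2)] K(3,4)])
    also have "\<dots> \<subseteq> ?V" using grid_bounded[OF K(5), of _ c s] c s by blast
    finally have V: "set_pmf (law mu (grid c s)) \<subseteq> ?V" .
    have "(\<Sum>\<^sub>\<infinity>v\<in>UNIV. shannon_h (?p s v)) = (\<Sum>\<^sub>\<infinity>v\<in>?V. shannon_h (?p s v))"
      unfolding pmf_law[OF K(1) measurable_grid[OF K(2)], symmetric]
      using V by (intro infsum_cong_neutral) (auto simp: shannon_h_eq set_pmf_iff)
    then show "ent mu (grid c s) = h s" unfolding ent_def h_def using finV by simp
  qed
qed

lemma unit_cube_content:
  "{x::real^'d::finite. \<forall>j. 0 \<le> x$j \<and> x$j < 1} \<in> sets borel"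
  "emeasure lborel {x::real^'d::finite. \<forall>j. 0 \<le> x$j \<and> x$j < 1} = 1"
proof -
  let ?S = "{x::real^'d. \<forall>j. 0 \<le> x$j \<and> x$j < 1}"
  show S: "?S \<in> sets borel" by measurable
  have basis: "(\<forall>i\<in>Basis. P (x \<bullet> i)) \<longleftrightarrow> (\<forall>j. P (x$j))" for P and x :: "real^'d"
    by (auto simp: Basis_vec_def cart_eq_inner_axis)
  have in_box: "x \<in> box 0 One \<longleftrightarrow> (\<forall>j. 0 < x$j \<and> x$j < 1)" for x :: "real^'d"
    by (simp add: mem_box basis[of "\<lambda>t. 0 < t \<and> t < 1"])
  have in_cbox: "x \<in> cbox 0 One \<longleftrightarrow> (\<forall>j. 0 \<le> x$j \<and> x$j \<le> 1)" for x :: "real^'d"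
    by (simp add: mem_box basis[of "\<lambda>t. 0 \<le> t \<and> t \<le> 1"])
  have "emeasure lborel (box 0 (One::real^'d)) = 1" "emeasure lborel (cbox 0 (One::real^'d)) = 1"
    by (simp_all add: emeasure_lborel_box emeasure_lborel_cbox)
  moreover have "emeasure lborel (box 0 (One::real^'d)) \<le> emeasure lborel ?S"
    using S by (intro emeasure_mono) (auto simp: in_box less_imp_le)
  moreover have "emeasure lborel ?S \<le> emeasure lborel (cbox 0 (One::real^'d))"
    by (intro emeasure_mono) (auto simp: in_cbox less_imp_le)
  ultimately show "emeasure lborel ?S = 1" by auto
qed

text \<open>For every shift the two grids have comparable sides, so the integrand stays within a
  fixed distance of a constant, and the cube of shifts has volume 1.\<close>

lemma avg_ent_near:
  fixes mu :: "(real^'d::finite) measure"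
  assumes mu: "cpt_prob mu" and r: "\<And>j. 0 < r$j" and c: "\<And>j. 0 < c$j"
    and ratio: "\<And>j. 1 / r$j / c$j \<le> real R" "\<And>j. c$j / (1 / r$j) \<le> real R"
  shows "\<bar>avg_ent mu r - H (law mu (grid c 0))\<bar> \<le> CARD('d) * log 2 (real (R + 1))"
proof -
  let ?S = "{x::real^'d. \<forall>j. 0 \<le> x$j \<and> x$j < 1}" and ?c = "\<chi> j. 1 / r$j"
  let ?D = "CARD('d) * log 2 (real (R + 1))" and ?h = "H (law mu (grid c 0))"
  obtain K B where K: "prob_space mu" "sets mu = sets borel" using cpt_probE[OF mu] by metis
  obtain h where h: "h \<in> borel_measurable borel" "\<And>s. s \<in> ?S \<Longrightarrow> ent mu (grid ?c s) = h s"
    using measurable_ent_grid[OF mu, of ?c] r by (auto simp: less_imp_le)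
  have bounds: "h s \<in> {?h - ?D..?h + ?D}" if s: "s \<in> ?S" for s
  proof -
    have "ent mu (grid ?c s) = H (law mu (grid ?c s))"
      using s r by (intro ent_eq_H K measurable_grid finite_law_grid mu) (auto simp: less_imp_le)
    moreover have "H (law mu (grid ?c s)) \<le> ?h + ?D"
      using s r c ratio by (intro H_grid_le mu) auto
    moreover have "?h \<le> H (law mu (grid ?c s)) + ?D"
      using s r c ratio by (intro H_grid_le mu) auto
    ultimately show ?thesis using h(2)[OF s] by auto
  qed
  have meas: "measure lebesgue ?S = 1" "?S \<in> lmeasurable"
    using unit_cube_content[where 'd = 'd] by (auto simp: measure_def fmeasurable_def)
  have int: "h integrable_on ?S"
  proof (rule measurable_bounded_by_integrable_imp_integrable)
    show "h \<in> borel_measurable (lebesgue_on ?S)" using h(1)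
      by (intro measurable_restrict_space1 borel_measurable_if_I) (simp add: measurable_completion)
    show "(\<lambda>_. \<bar>?h\<bar> + ?D) integrable_on ?S" using meas(2) by (rule integrable_on_const)
    show "norm (h s) \<le> \<bar>?h\<bar> + ?D" if "s \<in> ?S" for s using bounds[OF that] by auto
    show "?S \<in> sets lebesgue" using meas(2) by auto
  qed
  have avg: "avg_ent mu r = integral ?S h"
    unfolding avg_ent_def
  proof (rule integral_cong)
    fix s assume "s \<in> ?S"
    have "(\<lambda>X. \<chi> j. \<lfloor>X$j / r$j + s$j\<rfloor>) = grid ?c s" by (simp add: grid_def fun_eq_iff)
    then show "ent mu (\<lambda>X. (\<chi> j. \<lfloor>X$j / r$j + s$j\<rfloor>) :: int^'d) = h s" using h(2)[OF \<open>s \<in> ?S\<close>] by simp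
  qed
  have const: "(\<lambda>_. a) integrable_on ?S" "integral ?S (\<lambda>_. a) = a" for a :: real
    using meas integrable_on_const[OF meas(2), of a] lmeasure_integral[OF meas(2)]
      integral_mult_right[of ?S a "\<lambda>_. 1"] by simp_all
  have "integral ?S h \<le> integral ?S (\<lambda>_. ?h + ?D)"
    using bounds by (intro integral_le int const) auto
  moreover have "integral ?S (\<lambda>_. ?h - ?D) \<le> integral ?S h"
    using bounds by (intro integral_le int const) auto
  ultimately show ?thesis unfolding avg const by auto
qed

section \<open>The theorem\<close>

locale contraction_ratios =
  fixes lam :: "real^'d::finite"
  assumes lam: "0 < lam$j" "lam$j < 1" and lam_inj: "lam$i = lam$j \<Longrightarrow> i = j"
begin

sublocale levels "chi lam"
proof
  show "0 < chi lam j" for j using lam[of j] by (simp add: chi_def)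
  show "inj (chi lam)"
  proof (rule injI)
    fix i j assume "chi lam i = chi lam j"
    then have "lam$i = lam$j" using lam[of i] lam[of j] by (simp add: chi_def log_def)
    then show "i = j" by (rule lam_inj)
  qed
qed

abbreviation dyadic :: "nat \<Rightarrow> real^'d" where
  "dyadic n \<equiv> \<chi> j. 2 ^ lev j n"

lemma E_idx_eq_grid: "E_idx lam (int n) = grid (dyadic n) 0"
proof -
  have "2 powr real_of_int \<lfloor>chi lam j * real_of_int (int n)\<rfloor> = 2 ^ lev j n" for j
  proof -
    have "0 \<le> chi lam j * real n" using ch_pos[of j] by simp
    then have "real_of_int \<lfloor>chi lam j * real n\<rfloor> = real (lev j n)" by (simp add: lev_def)
    then show ?thesis by (simp add: powr_realpow)
  qed
  then show ?thesis by (simp add: E_idx_def grid_def fun_eq_iff)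
qed

text \<open>Floors nest: dividing the index at level \<open>N\<close> by a power of 2 and rounding
  gives the index at level \<open>n\<close>. One rounding to the finest lattice thus carries all
  coarser levels exactly.\<close>

lemma cell_grid:
  assumes "n \<le> N"
  shows "cell N n (grid (dyadic N) 0 x) = grid (dyadic n) 0 x"
proof -
  have "\<lfloor>x$j * 2 ^ lev j N\<rfloor> div 2 ^ kap N n j = \<lfloor>x$j * 2 ^ lev j n\<rfloor>" for j
  proof -
    have "(2::real) ^ lev j N = 2 ^ lev j n * 2 ^ kap N n j"
      using lev_mono[OF assms, of j] by (simp add: kap_def power_add[symmetric])
    then have "x$j * 2 ^ lev j N / real_of_int (2 ^ kap N n j) = x$j * 2 ^ lev j n" by simp
    then show ?thesis
      using floor_divide_real_eq_div[of "2 ^ kap N n j" "x$j * 2 ^ lev j N"] by simp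
  qed
  then show ?thesis by (simp add: coarsen_def grid_def)
qed

text \<open>Level \<open>n\<close> in all coordinates together with level \<open>n + m\<close> off
  \<open>j\<close> is the same partition as level \<open>n\<close> in \<open>j\<close> and level
  \<open>n + m\<close> elsewhere. The chain rule then turns the conditional entropy into the
  difference in \<open>nonsat\<close>, with \<open>m \<ge> 1\<close> needed to clear the
  denominator.\<close>

lemma nonsat_law:
  assumes mu: "cpt_prob mu" and m: "m \<ge> 1" and ns: "non_saturated lam eps m mu"
  shows "nonsat eps m N (law mu (grid (dyadic N) 0))"
  unfolding nonsat_def
proof (intro allI impI)
  fix j n assume nm: "n + m \<le> N"
  let ?E = "grid (dyadic N) 0" and ?k = "(kap N (n + m))(j := kap N n j)"
  let ?Y = "law mu ?E"
  obtain K B where K: "prob_space mu" "sets mu = sets borel" using cpt_probE[OF mu] by metis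
  let ?G = "\<lambda>z. (cell N n z, (\<chi> i. if i \<in> UNIV - {j} then cell N (n + m) z $ i else 0) :: int^'d)"
  let ?f = "E_idx lam (int n + int m)"
    and ?g = "\<lambda>x. (E_idx lam (int n) x, E_proj_idx lam (UNIV - {j}) (int n + int m) x)"
  have f: "?f = (\<lambda>x. cell N (n + m) (?E x))"
    using nm by (simp add: cell_grid E_idx_eq_grid flip: of_nat_add)
  have g: "?g = (\<lambda>x. ?G (?E x))"
    using nm by (simp add: cell_grid E_idx_eq_grid E_proj_idx_def fun_eq_iff flip: of_nat_add)
  have fg: "(\<lambda>x. (?f x, ?g x)) = (\<lambda>x. (cell N (n + m) (?E x), ?G (?E x)))"
    by (rule ext) (simp only: f[THEN fun_cong] g[THEN fun_cong])
  have mE: "?E \<in> measurable mu (count_space UNIV)" by (rule measurable_grid[OF K(2)])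
  have meas: "(\<lambda>x. h (?E x)) \<in> measurable mu (count_space UNIV)" for h :: "int^'d \<Rightarrow> 'z"
    by (rule measurable_compose[OF mE]) simp
  have finY: "finite (set_pmf ?Y)" by (intro finite_law_grid mu) auto
  have law_f: "law mu ?f = map_pmf (cell N (n + m)) ?Y" unfolding f by (rule law_comp[OF K(1) mE, symmetric])
  have law_g: "law mu ?g = map_pmf ?G ?Y" unfolding g by (rule law_comp[OF K(1) mE, symmetric])
  have law_fg: "law mu (\<lambda>x. (?f x, ?g x)) = map_pmf (\<lambda>z. (cell N (n + m) z, ?G z)) ?Y"
    unfolding fg by (rule law_comp[OF K(1) mE, symmetric])
  have "cond_ent mu ?f ?g = H (law mu (\<lambda>x. (?f x, ?g x))) - H (law mu ?g)"
  proof (rule cond_ent_eq_H[OF K(1)])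
    show "?f \<in> measurable mu (count_space UNIV)" unfolding f by (rule meas)
    show "?g \<in> measurable mu (count_space UNIV)" unfolding g by (rule meas)
    show "(\<lambda>x. (?f x, ?g x)) \<in> measurable mu (count_space UNIV)" unfolding fg by (rule meas)
    show "finite (set_pmf (law mu (\<lambda>x. (?f x, ?g x))))" unfolding law_fg using finY by simp
  qed
  moreover have "H (law mu ?f) \<le> H (law mu (\<lambda>x. (?f x, ?g x)))"
    unfolding law_f law_fg using H_map_comp_le[OF finY, of fst "\<lambda>z. (cell N (n + m) z, ?G z)"] by simp
  moreover have "H (law mu ?g) = H (map_pmf (coarsen ?k) ?Y)"
    unfolding law_g
  proof (rule H_map_equiv[OF finY])
    fix x y
    have coarse: "cell N n x $ i = cell N n y $ i" if "cell N (n + m) x $ i = cell N (n + m) y $ i" for i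
      using that cell_cell[of n "n + m" N x] cell_cell[of n "n + m" N y] by (simp add: coarsen_def)
    have "coarsen ?k x = coarsen ?k y \<longleftrightarrow> cell N n x $ j = cell N n y $ j \<and> (\<forall>i. i \<noteq> j \<longrightarrow> cell N (n + m) x $ i = cell N (n + m) y $ i)"
      by (auto simp: coarsen_def vec_eq_iff)
    also have "\<dots> \<longleftrightarrow> ?G x = ?G y"
    proof
      assume eq: "cell N n x $ j = cell N n y $ j \<and> (\<forall>i. i \<noteq> j \<longrightarrow> cell N (n + m) x $ i = cell N (n + m) y $ i)"
      have "cell N n x $ i = cell N n y $ i" for i using eq coarse[of i] by (cases "i = j") auto
      then show "?G x = ?G y" using eq by (simp add: vec_eq_iff)
    qed (auto simp: vec_eq_iff split: if_splits)
    finally show "?G x = ?G y \<longleftrightarrow> coarsen ?k x = coarsen ?k y" ..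
  qed
  moreover have "cond_ent mu ?f ?g \<le> (chi lam j - eps) * m"
  proof -
    have "1 / real m * cond_ent mu ?f ?g < chi lam j - eps" using ns unfolding non_saturated_def by blast
    then show ?thesis using m by (simp add: divide_less_eq mult.commute)
  qed
  ultimately show "H (map_pmf (cell N (n + m)) ?Y) - H (map_pmf (coarsen ?k) ?Y) \<le> (chi lam j - eps) * m"
    unfolding law_f by linarith
qed

text \<open>Taking integer parts of \<open>t\<close> and of the exponents changes each side length
  by a factor of at most \<open>2 powr (chi lam j + 1)\<close>, whatever the measure and
  \<open>t\<close>.\<close>

lemma avg_ent_lam_pow:
  "\<exists>D\<ge>0. \<forall>mu t. cpt_prob mu \<and> 0 < t \<longrightarrow>
     \<bar>avg_ent mu (lam_pow lam t) - H (law mu (grid (dyadic (nat \<lfloor>t\<rfloor>)) 0))\<bar> \<le> D"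
proof -
  obtain R :: nat where R: "\<And>j. 2 powr (chi lam j + 1) \<le> real R"
    using nat_bound_finite[of "\<lambda>j. 2 powr (chi lam j + 1)"] by auto
  show ?thesis
  proof (intro exI[of _ "CARD('d) * log 2 (real (R + 1))"] conjI allI impI)
    show "0 \<le> CARD('d) * log 2 (real (R + 1))" by simp
    fix mu :: "(real^'d) measure" and t :: real
    assume as: "cpt_prob mu \<and> 0 < t"
    let ?n = "nat \<lfloor>t\<rfloor>"
    have lamt: "lam_pow lam t $ j = 2 powr (- (chi lam j * t))" for j
    proof -
      have "lam$j = 2 powr (- chi lam j)" using lam[of j] by (simp add: chi_def)
      then have "lam_pow lam t $ j = (2 powr (- chi lam j)) powr t" by (simp add: lam_pow_def)
      then show ?thesis by (simp add: powr_powr)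
    qed
    have ub: "chi lam j * t - lev j ?n \<le> chi lam j + 1" for j
    proof -
      have "t \<le> real ?n + 1" using as by linarith
      then have "chi lam j * t \<le> chi lam j * (real ?n + 1)" using ch_pos[of j] by (intro mult_left_mono) auto
      then show ?thesis using lev_gt[of j ?n] by (simp add: distrib_left)
    qed
    have lb: "lev j ?n \<le> chi lam j * t" for j
    proof -
      have "chi lam j * real ?n \<le> chi lam j * t" using ch_pos[of j] as by (intro mult_left_mono) auto
      then show ?thesis using lev_le[of j ?n] by linarith
    qed
    have dy: "dyadic ?n $ j = 2 powr (lev j ?n)" for j by (simp add: powr_realpow)
    show "\<bar>avg_ent mu (lam_pow lam t) - H (law mu (grid (dyadic ?n) 0))\<bar> \<le> CARD('d) * log 2 (real (R + 1))"
    proof (rule avg_ent_near)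
      show "cpt_prob mu" using as by simp
      fix j
      show "0 < lam_pow lam t $ j" "0 < dyadic ?n $ j" by (simp_all add: lamt)
      have "1 / lam_pow lam t $ j / dyadic ?n $ j = 2 powr (chi lam j * t - lev j ?n)"
        unfolding lamt dy by (simp add: powr_minus powr_diff divide_simps)
      also have "\<dots> \<le> 2 powr (chi lam j + 1)" using ub[of j] by simp
      finally show "1 / lam_pow lam t $ j / dyadic ?n $ j \<le> real R" using R[of j] by linarith
      have "dyadic ?n $ j / (1 / lam_pow lam t $ j) = 2 powr (lev j ?n - chi lam j * t)"
        unfolding lamt dy by (simp add: powr_minus powr_diff divide_simps)
      also have "\<dots> \<le> 2 powr (chi lam j + 1)" using lb[of j] ch_pos[of j] by (intro powr_mono) linarith+
      finally show "dyadic ?n $ j / (1 / lam_pow lam t $ j) \<le> real R" using R[of j] by linarith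
    qed
  qed
qed

end

text \<open>The threshold \<open>b / (2 * (C + 1))\<close> makes the linear error at most
  \<open>b * (T + 1) / 2\<close>, which half of \<open>b * T\<close> and the constant
  \<open>D + 1\<close> absorb. As \<open>b < 1 / 2\<close> gives
  \<open>log 2 (1 / b) \<ge> 1\<close>, the constant part of the logarithm of the threshold is
  absorbed too, and \<open>A * log 2 (1 / b)\<close> bounds the whole factor.\<close>

lemma entropy_growth_arith:
  fixes C :: real
  assumes C: "0 < C" and "0 \<le> D" and T: "0 < T" and b: "0 < b" "b < 1 / 2"
    and low: "b * T \<le> h + D" and pos: "0 \<le> C + x"
    and growth: "h \<le> C * (1 + log 2 (1 / (b / (2 * (C + 1))))) * (C + x) + C * (b / (2 * (C + 1))) * (T + 1)"
    and A: "A = 2 + log 2 (2 * (C + 1))"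
  shows "b * (1 / log 2 (1 / b)) * T / (2 * C * A) - C - (D + 1) / (C * A) \<le> x"
proof -
  let ?L = "log 2 (1 / b)"
  have L: "1 \<le> ?L"
  proof -
    have "log 2 2 \<le> ?L" using b by (intro log_mono) (auto simp: field_simps)
    then show ?thesis by simp
  qed
  have A2: "2 \<le> A" using C by (simp add: A)
  have CA: "0 < C * A" using C A2 by simp
  have "log 2 (1 / (b / (2 * (C + 1)))) = log 2 (2 * (C + 1)) + ?L"
  proof -
    have "1 / (b / (2 * (C + 1))) = 2 * (C + 1) * (1 / b)" by simp
    then show ?thesis using b C by (simp only:) (subst log_mult; simp)
  qed
  then have "1 + log 2 (1 / (b / (2 * (C + 1)))) = (A - 1) * 1 + ?L" by (simp add: A)
  also have "\<dots> \<le> (A - 1) * ?L + ?L" using L A2 by (intro add_right_mono mult_left_mono) auto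
  also have "\<dots> = A * ?L" by (simp add: left_diff_distrib)
  finally have "C * (1 + log 2 (1 / (b / (2 * (C + 1))))) * (C + x) \<le> C * (A * ?L) * (C + x)"
    using C pos by (intro mult_right_mono mult_left_mono) auto
  moreover have "C * (b / (2 * (C + 1))) * (T + 1) \<le> b / 2 * (T + 1)"
  proof (rule mult_right_mono)
    have "C * (b / (2 * (C + 1))) = b / 2 * (C / (C + 1))" using C by (simp add: field_simps)
    also have "\<dots> \<le> b / 2 * 1" using C b by (intro mult_left_mono) auto
    finally show "C * (b / (2 * (C + 1))) \<le> b / 2" by simp
  qed (use T in simp)
  moreover have "b / 2 * (T + 1) = b * T / 2 + b / 2" by (simp add: distrib_left)
  ultimately have "b * T / 2 \<le> C * (A * ?L) * (C + x) + (D + 1)"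
    using low growth b by linarith
  then have "b * T / 2 / (C * A * ?L) \<le> (C * (A * ?L) * (C + x) + (D + 1)) / (C * A * ?L)"
    using CA L by (intro divide_right_mono) auto
  also have "\<dots> = C + x + (D + 1) / (C * A * ?L)" using CA L C A2 by (simp add: add_divide_distrib mult.assoc)
  also have "(D + 1) / (C * A * ?L) \<le> (D + 1) / (C * A)"
    using CA L \<open>0 \<le> D\<close> mult_left_mono[OF L, of "C * A"] by (intro divide_left_mono) auto
  finally have "b * T / 2 / (C * A * ?L) \<le> C + x + (D + 1) / (C * A)" by simp
  moreover have "b * (1 / ?L) * T / (2 * C * A) = b * T / 2 / (C * A * ?L)" by simp
  ultimately show ?thesis by linarith
qed

theorem theorem1p5:
  fixes lam :: "real^'d::{finite,linorder}"
  assumes "\<forall>j. 0 < lam$j \<and> lam$j < 1"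
    and "\<forall>i j. i < j \<longrightarrow> lam$j < lam$i"
  shows "\<forall>eps>0. \<forall>M::nat\<ge>1. \<exists>C>1. \<forall>mu nu beta t1 t2.
     cpt_prob mu \<and> cpt_prob nu \<and> (\<forall>m\<ge>M. non_saturated lam eps m mu) \<and>
     0 < beta \<and> beta < 1/2 \<and> 0 < t1 \<and> t1 < t2 \<and>
     1 / (t2 - t1) * avg_ent_cond nu (lam_pow lam t2) (lam_pow lam t1) > beta
     \<longrightarrow> avg_ent_cond (convolution nu mu) (lam_pow lam t2) (lam_pow lam t1)
         \<ge> avg_ent_cond mu (lam_pow lam t2) (lam_pow lam t1)
            + (1 / C) * beta * (1 / log 2 (1 / beta)) * (t2 - t1) - C"
proof (intro allI impI)
  interpret contraction_ratios lam
  proof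
    fix i j
    show "0 < lam$j" "lam$j < 1" using assms(1) by auto
    show "lam$i = lam$j \<Longrightarrow> i = j" using assms(2) by (metis less_irrefl linorder_neqE)
  qed
  fix eps :: real and M :: nat
  assume eps: "0 < eps" and M: "1 \<le> M"
  obtain m0 :: nat where m0: "\<And>j. (chi lam j + 4 + CARD('d) * (1 + log 2 5)) / eps \<le> real m0"
    using nat_bound_finite[of "\<lambda>j. (chi lam j + 4 + CARD('d) * (1 + log 2 5)) / eps"] by auto
  \<comment> \<open>At least \<open>M\<close>, so that non-saturation applies, and so long that
    \<open>eps * m\<close> exceeds the bounded losses at a single scale.\<close>
  define m where "m = M + m0"
  have m: "chi lam j + 4 + CARD('d) * (1 + log 2 5) \<le> eps * m" for j
  proof -
    have "chi lam j + 4 + CARD('d) * (1 + log 2 5) \<le> eps * m0"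
      using m0[of j] eps by (simp add: pos_divide_le_eq mult.commute)
    also have "\<dots> \<le> eps * m" using eps by (simp add: m_def)
    finally show ?thesis .
  qed
  obtain C where C: "C > 0" and growth: "\<And>N a X Y t. a \<le> N \<Longrightarrow> finite (set_pmf X) \<Longrightarrow> finite (set_pmf Y)
    \<Longrightarrow> nonsat eps m N Y \<Longrightarrow> 0 < t \<Longrightarrow> t < 1 \<Longrightarrow>
    0 \<le> C + ((H (X \<oplus> Y) - H (map_pmf (cell N a) (X \<oplus> Y))) - (H Y - H (map_pmf (cell N a) Y))) \<and>
    H X - H (map_pmf (cell N a) X) \<le> C * (1 + log 2 (1 / t)) * (C + ((H (X \<oplus> Y) - H (map_pmf (cell N a) (X \<oplus> Y)))
       - (H Y - H (map_pmf (cell N a) Y)))) + C * t * (real N - real a)"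
    using entropy_growth_discrete[of eps m, OF m] by blast
  obtain D where D: "0 \<le> D" and avg: "\<And>mu t. cpt_prob mu \<Longrightarrow> 0 < t \<Longrightarrow>
     \<bar>avg_ent mu (lam_pow lam t) - H (law mu (grid (dyadic (nat \<lfloor>t\<rfloor>)) 0))\<bar> \<le> D"
    using avg_ent_lam_pow by blast
  define A where "A = 2 + log 2 (2 * (C + 1))"
  have "2 \<le> A" using C by (simp add: A_def)
  \<comment> \<open>The first summand is the rate, the next two are the additive loss from
    \<open>entropy_growth_arith\<close> with \<open>2 * D\<close> in place of \<open>D\<close>. Two
    differences of average entropies cost \<open>2 * D\<close> each, and rounding the convolution at
    levels \<open>N\<close> and \<open>a\<close> costs \<open>CARD('d)\<close> each; the final 1
    makes the constant exceed 1.\<close>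
  define C' where "C' = 2 * C * A + C + (2 * D + 1) / (C * A) + (4 * D + 2 * CARD('d)) + 1"
  have nonneg: "0 < C * A" "0 \<le> (2 * D + 1) / (C * A)" using C D \<open>2 \<le> A\<close> by simp_all
  have C'_ge: "2 * C * A \<le> C'" using nonneg C D by (simp add: C'_def)
  have CA2: "0 < 2 * C * A" using nonneg(1) by (simp add: mult.assoc)
  show "\<exists>C>1. \<forall>mu nu beta t1 t2.
     cpt_prob mu \<and> cpt_prob nu \<and> (\<forall>m\<ge>M. non_saturated lam eps m mu) \<and>
     0 < beta \<and> beta < 1/2 \<and> 0 < t1 \<and> t1 < t2 \<and>
     1 / (t2 - t1) * avg_ent_cond nu (lam_pow lam t2) (lam_pow lam t1) > beta
     \<longrightarrow> avg_ent_cond (convolution nu mu) (lam_pow lam t2) (lam_pow lam t1)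
         \<ge> avg_ent_cond mu (lam_pow lam t2) (lam_pow lam t1)
            + (1 / C) * beta * (1 / log 2 (1 / beta)) * (t2 - t1) - C"
  proof (intro exI[of _ C'] conjI allI impI)
    show "C' > 1" using CA2 nonneg(2) C D of_nat_0_le_iff[of "CARD('d)"] unfolding C'_def by linarith
    fix mu nu beta t1 t2
    assume as: "cpt_prob mu \<and> cpt_prob nu \<and> (\<forall>m\<ge>M. non_saturated lam eps m mu) \<and>
     0 < beta \<and> beta < 1/2 \<and> 0 < t1 \<and> t1 < t2 \<and>
     1 / (t2 - t1) * avg_ent_cond nu (lam_pow lam t2) (lam_pow lam t1) > beta"
    then have mu: "cpt_prob mu" and nu: "cpt_prob nu" and ns: "non_saturated lam eps m mu"
      and b: "0 < beta" "beta < 1/2" and t: "0 < t1" "t1 < t2" by (auto simp: m_def)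
    let ?T = "t2 - t1"
    have low: "beta * ?T < avg_ent_cond nu (lam_pow lam t2) (lam_pow lam t1)"
      using as t by (simp add: less_divide_eq)
    define N where "N = nat \<lfloor>t2\<rfloor>"
    define a where "a = nat \<lfloor>t1\<rfloor>"
    have aN: "a \<le> N" using t by (auto simp: a_def N_def intro!: nat_mono floor_mono)
    have NaT: "real N - real a \<le> ?T + 1" using t unfolding N_def a_def by linarith
    define X where "X = law nu (grid (dyadic N) 0)"
    define Y where "Y = law mu (grid (dyadic N) 0)"
    define Z where "Z = law (convolution nu mu) (grid (dyadic N) 0)"
    have conv: "cpt_prob (convolution nu mu)" by (rule cpt_prob_convolution[OF nu mu])
    have coarse: "map_pmf (cell N a) (law q (grid (dyadic N) 0)) = law q (grid (dyadic a) 0)" if q: "cpt_prob q" for q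
    proof -
      obtain K B where K: "prob_space q" "sets q = sets borel" using cpt_probE[OF q] by metis
      show ?thesis using law_comp[OF K(1) measurable_grid[OF K(2)], of "cell N a" "dyadic N" 0] aN
        by (simp add: cell_grid)
    qed
    have cond: "\<bar>avg_ent_cond q (lam_pow lam t2) (lam_pow lam t1)
        - (H (law q (grid (dyadic N) 0)) - H (map_pmf (cell N a) (law q (grid (dyadic N) 0))))\<bar> \<le> 2 * D"
      if q: "cpt_prob q" for q
      using avg[OF q t(1), folded a_def] avg[OF q less_trans[OF t], folded N_def]
      unfolding coarse[OF q] avg_ent_cond_def by linarith
    have finX: "finite (set_pmf X)" and finY: "finite (set_pmf Y)"
      unfolding X_def Y_def by (intro finite_law_grid nu mu; simp)+
    define x where "x = (H (X \<oplus> Y) - H (map_pmf (cell N a) (X \<oplus> Y))) - (H Y - H (map_pmf (cell N a) Y))"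
    have nsY: "nonsat eps m N Y" unfolding Y_def using M by (intro nonsat_law mu ns) (simp add: m_def)
    let ?t = "beta / (2 * (C + 1))"
    have tt: "0 < ?t" "?t < 1" using b C by (simp_all add: divide_less_eq)
    have gr: "0 \<le> C + x" "H X - H (map_pmf (cell N a) X) \<le> C * (1 + log 2 (1 / ?t)) * (C + x) + C * ?t * (real N - real a)"
      using growth[OF aN finX finY nsY tt] unfolding x_def by blast+
    have "C * ?t * (real N - real a) \<le> C * ?t * (?T + 1)" using C tt NaT by (intro mult_left_mono mult_nonneg_nonneg) linarith+
    then have gr': "H X - H (map_pmf (cell N a) X) \<le> C * (1 + log 2 (1 / ?t)) * (C + x) + C * ?t * (?T + 1)"
      using gr(2) by linarith
    have "beta * ?T \<le> (H X - H (map_pmf (cell N a) X)) + 2 * D"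
      using low cond[OF nu] unfolding X_def by linarith
    then have x_ge: "beta * (1 / log 2 (1 / beta)) * ?T / (2 * C * A) - C - (2 * D + 1) / (C * A) \<le> x"
      using C D t b gr(1) gr' by (intro entropy_growth_arith[OF _ _ _ _ _ _ _ _ A_def]) auto
    have "cell N N = (\<lambda>x. x)" by (simp add: fun_eq_iff cell_self)
    then have "\<bar>H Z - H (X \<oplus> Y)\<bar> \<le> CARD('d)"
      using H_law_convolution[OF nu mu, of "dyadic N" "kap N N"] by (simp add: Z_def X_def Y_def)
    moreover have "\<bar>H (map_pmf (cell N a) Z) - H (map_pmf (cell N a) (X \<oplus> Y))\<bar> \<le> CARD('d)"
      using H_law_convolution[OF nu mu, of "dyadic N" "kap N a"] by (simp add: Z_def X_def Y_def)
    ultimately have "x - (4 * D + 2 * CARD('d)) \<le> avg_ent_cond (convolution nu mu) (lam_pow lam t2) (lam_pow lam t1)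
       - avg_ent_cond mu (lam_pow lam t2) (lam_pow lam t1)"
      using cond[OF conv] cond[OF mu] unfolding x_def Z_def Y_def by linarith
    moreover have "(1 / C') * beta * (1 / log 2 (1 / beta)) * ?T \<le> beta * (1 / log 2 (1 / beta)) * ?T / (2 * C * A)"
    proof -
      have "0 \<le> beta * (1 / log 2 (1 / beta)) * ?T" using b t by simp
      then have "beta * (1 / log 2 (1 / beta)) * ?T / C' \<le> beta * (1 / log 2 (1 / beta)) * ?T / (2 * C * A)"
        by (rule divide_left_mono[OF C'_ge _ mult_pos_pos[OF less_le_trans[OF CA2 C'_ge] CA2]])
      then show ?thesis by (simp only: divide_inverse mult_1_left mult_ac)
    qed
    moreover have "C + (2 * D + 1) / (C * A) + (4 * D + 2 * CARD('d)) \<le> C'" using CA2 by (simp add: C'_def)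
    ultimately show "avg_ent_cond (convolution nu mu) (lam_pow lam t2) (lam_pow lam t1)
         \<ge> avg_ent_cond mu (lam_pow lam t2) (lam_pow lam t1)
            + (1 / C') * beta * (1 / log 2 (1 / beta)) * (t2 - t1) - C'"
      using x_ge by linarith
  qed
qed

end
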